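(* Let $\mathcal{C}$ be a fusion category over an algebraically closed field $\Bbbk$ of characteristic zero. Let $A(\mathcal{C})=\{X_1,\dots,X_m\}$ be the set of all simple objects of $\mathcal{C}$ up to isomorphism, and let $N_{ij}^k$ be the multiplicity of $X_k$ in $X_i\otimes X_j$. Then $A(\mathcal{C})$ is a probability group with probability map $$p(X_i\cdot X_j=X_k)=\frac{N_{ij}^k\,\mathrm{FPdim}(X_k)}{\mathrm{FPdim}(X_i)\,\mathrm{FPdim}(X_j)},\qquad 1\le i,j,k\le m.$$
   Context: A fusion category over $\Bbbk$ is a semisimple, locally finite, $\Bbbk$-linear abelian rigid monoidal category with tensor product bilinear on morphisms, $\mathrm{End}(\mathbf 1)\cong\Bbbk$, and finitely many isomorphism classes of simple objects. The Grothendieck ring of $\mathcal{C}$ has basis $[X_1],\dots,[X_m]$ and product $[X_i][X_j]=\sum_k N_{ij}^k[X_k]$. The Frobenius-Perron dimension $\mathrm{FPdim}(X_i)$ is the largest positive eigenvalue of the matrix of left multiplication by $[X_i]$ in the Grothendieck ring. A probability group is a set $A$ with a map $(a,b,c)\mapsto p(a\cdot b=c)$ from $A\times A\times A$ to $\mathbb{R}_{\ge 0}$ (the probability map) such that: (1) for all $a,b\in A$, $p(a\cdot b=c)=0$ for all but finitely many $c\in A$, and $\sum_{c\in A}p(a\cdot b=c)=1$; (2) for all $a,b,c,d\in A$, $\sum_{x\in A}p(a\cdot b=x)p(x\cdot c=d)=\sum_{y\in A}p(a\cdot y=d)p(b\cdot c=y)$; (3) there is an element $1\in A$ with $p(1\cdot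 a=a)=1=p(a\cdot 1=a)$ for all $a\in A$; (4) for each $a\in A$ there is a unique $a^{-1}\in A$ with $p(a\cdot a^{-1}=1)>0$; (5) for all $a,b,c\in A$, $p(a\cdot b=c)=p(b^{-1}\cdot a^{-1}=c^{-1})$; (6) for all $a\in A$, $p(a\cdot a^{-1}=1)=p(a^{-1}\cdot a=1)$. *)

theory Defs
  imports "Jordan_Normal_Form.VS_Connect" "Jordan_Normal_Form.Char_Poly"
begin

section \<open>Categories\<close>

record ('o, 'm) cat =
  Obj :: "'o set"
  Arr :: "'m set"
  Dom :: "'m \<Rightarrow> 'o"
  Cod :: "'m \<Rightarrow> 'o"
  Ident :: "'o \<Rightarrow> 'm"
  Compose :: "'m \<Rightarrow> 'm \<Rightarrow> 'm"  (infixr \<open>\<cdot>\<index>\<close> 60)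

definition Hom :: "('o, 'm, 'r) cat_scheme \<Rightarrow> 'o \<Rightarrow> 'o \<Rightarrow> 'm set" where
  "Hom C X Y = {f \<in> Arr C. Dom C f = X \<and> Cod C f = Y}"

locale category =
  fixes C :: "('o, 'm, 'r) cat_scheme" (structure)
  assumes dom_obj: "f \<in> Arr C \<Longrightarrow> Dom C f \<in> Obj C"
    and cod_obj: "f \<in> Arr C \<Longrightarrow> Cod C f \<in> Obj C"
    and ident_hom: "X \<in> Obj C \<Longrightarrow> Ident C X \<in> Hom C X X"
    and comp_hom: "\<lbrakk>f \<in> Hom C X Y; g \<in> Hom C Y Z\<rbrakk> \<Longrightarrow> g \<cdot> f \<in> Hom C X Z"
    and comp_ident: "f \<in> Hom C X Y \<Longrightarrow> f \<cdot> Ident C X = f"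
    and ident_comp: "f \<in> Hom C X Y \<Longrightarrow> Ident C Y \<cdot> f = f"
    and comp_assoc:
      "\<lbrakk>f \<in> Hom C W X; g \<in> Hom C X Y; h \<in> Hom C Y Z\<rbrakk> \<Longrightarrow> (h \<cdot> g) \<cdot> f = h \<cdot> (g \<cdot> f)"

definition inverse_arrows :: "('o, 'm, 'r) cat_scheme \<Rightarrow> 'm \<Rightarrow> 'm \<Rightarrow> bool" where
  "inverse_arrows C f g \<longleftrightarrow>
     f \<in> Arr C \<and> g \<in> Hom C (Cod C f) (Dom C f) \<and>
     g \<cdot>\<^bsub>C\<^esub> f = Ident C (Dom C f) \<and> f \<cdot>\<^bsub>C\<^esub> g = Ident C (Cod C f)"

definition iso_arrow :: "('o, 'm, 'r) cat_scheme \<Rightarrow> 'm \<Rightarrow> bool" where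
  "iso_arrow C f \<longleftrightarrow> (\<exists>g. inverse_arrows C f g)"

definition inv_arrow :: "('o, 'm, 'r) cat_scheme \<Rightarrow> 'm \<Rightarrow> 'm" where
  "inv_arrow C f = (THE g. inverse_arrows C f g)"

definition isomorphic :: "('o, 'm, 'r) cat_scheme \<Rightarrow> 'o \<Rightarrow> 'o \<Rightarrow> bool" where
  "isomorphic C X Y \<longleftrightarrow> (\<exists>f \<in> Hom C X Y. iso_arrow C f)"

definition mono_arrow :: "('o, 'm, 'r) cat_scheme \<Rightarrow> 'm \<Rightarrow> bool" where
  "mono_arrow C f \<longleftrightarrow> f \<in> Arr C \<and>
     (\<forall>W. \<forall>g \<in> Hom C W (Dom C f). \<forall>h \<in> Hom C W (Dom C f). f \<cdot>\<^bsub>C\<^esub> g = f \<cdot>\<^bsub>C\<^esub> h \<longrightarrow> g = h)"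

definition epi_arrow :: "('o, 'm, 'r) cat_scheme \<Rightarrow> 'm \<Rightarrow> bool" where
  "epi_arrow C f \<longleftrightarrow> f \<in> Arr C \<and>
     (\<forall>W. \<forall>g \<in> Hom C (Cod C f) W. \<forall>h \<in> Hom C (Cod C f) W. g \<cdot>\<^bsub>C\<^esub> f = h \<cdot>\<^bsub>C\<^esub> f \<longrightarrow> g = h)"

definition zero_object :: "('o, 'm, 'r) cat_scheme \<Rightarrow> 'o \<Rightarrow> bool" where
  "zero_object C Z \<longleftrightarrow> Z \<in> Obj C \<and>
     (\<forall>X \<in> Obj C. (\<exists>!f. f \<in> Hom C Z X) \<and> (\<exists>!f. f \<in> Hom C X Z))"

definition simple_object :: "('o, 'm, 'r) cat_scheme \<Rightarrow> 'o \<Rightarrow> bool" where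
  "simple_object C S \<longleftrightarrow> S \<in> Obj C \<and> \<not> zero_object C S \<and>
     (\<forall>Z. \<forall>f \<in> Hom C Z S. mono_arrow C f \<longrightarrow> zero_object C Z \<or> iso_arrow C f)"


section \<open>Linear and abelian categories\<close>

text \<open>The field \<open>'k\<close> is a type of class \<^class>\<open>field\<close>; \<^const>\<open>class_ring\<close> is the corresponding
  \<open>HOL-Algebra\<close> ring. Of the record \<open>hom_space C X Y\<close>, the ring fields \<open>mult\<close> and \<open>one\<close> play no
  role.\<close>

record ('o, 'm, 'k) lin_cat = "('o, 'm) cat" +
  hom_space :: "'o \<Rightarrow> 'o \<Rightarrow> ('k, 'm) module"

abbreviation zero_arrow :: "('o, 'm, 'k, 'r) lin_cat_scheme \<Rightarrow> 'o \<Rightarrow> 'o \<Rightarrow> 'm" where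
  "zero_arrow C X Y \<equiv> \<zero>\<^bsub>hom_space C X Y\<^esub>"

locale linear_category = category C
  for C :: "('o, 'm, 'k :: field, 'r) lin_cat_scheme" (structure) +
  assumes hom_vectorspace:
      "\<lbrakk>X \<in> Obj C; Y \<in> Obj C\<rbrakk> \<Longrightarrow> vectorspace class_ring (hom_space C X Y)"
    and hom_carrier: "\<lbrakk>X \<in> Obj C; Y \<in> Obj C\<rbrakk> \<Longrightarrow> carrier (hom_space C X Y) = Hom C X Y"
    and comp_add_right: "\<lbrakk>f \<in> Hom C X Y; f' \<in> Hom C X Y; g \<in> Hom C Y Z\<rbrakk> \<Longrightarrow>
      g \<cdot> (f \<oplus>\<^bsub>hom_space C X Y\<^esub> f') = (g \<cdot> f) \<oplus>\<^bsub>hom_space C X Z\<^esub> (g \<cdot> f')"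
    and comp_add_left: "\<lbrakk>f \<in> Hom C X Y; g \<in> Hom C Y Z; g' \<in> Hom C Y Z\<rbrakk> \<Longrightarrow>
      (g \<oplus>\<^bsub>hom_space C Y Z\<^esub> g') \<cdot> f = (g \<cdot> f) \<oplus>\<^bsub>hom_space C X Z\<^esub> (g' \<cdot> f)"
    and comp_smult_right: "\<lbrakk>f \<in> Hom C X Y; g \<in> Hom C Y Z\<rbrakk> \<Longrightarrow>
      g \<cdot> (c \<odot>\<^bsub>hom_space C X Y\<^esub> f) = c \<odot>\<^bsub>hom_space C X Z\<^esub> (g \<cdot> f)"
    and comp_smult_left: "\<lbrakk>f \<in> Hom C X Y; g \<in> Hom C Y Z\<rbrakk> \<Longrightarrow>
      (c \<odot>\<^bsub>hom_space C Y Z\<^esub> g) \<cdot> f = c \<odot>\<^bsub>hom_space C X Z\<^esub> (g \<cdot> f)"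

text \<open>\<open>Y\<close> is a (finite, possibly empty) direct sum of the objects in the list \<open>Xs\<close>.\<close>

definition is_direct_sum :: "('o, 'm, 'k, 'r) lin_cat_scheme \<Rightarrow> 'o \<Rightarrow> 'o list \<Rightarrow> bool" where
  "is_direct_sum C Y Xs \<longleftrightarrow> Y \<in> Obj C \<and> set Xs \<subseteq> Obj C \<and>
     (\<exists>inj proj.
        (\<forall>i < length Xs. inj i \<in> Hom C (Xs ! i) Y \<and> proj i \<in> Hom C Y (Xs ! i)) \<and>
        (\<forall>i < length Xs. \<forall>j < length Xs.
           proj i \<cdot>\<^bsub>C\<^esub> inj j =
             (if i = j then Ident C (Xs ! i) else zero_arrow C (Xs ! j) (Xs ! i))) \<and>
        (\<Oplus>\<^bsub>hom_space C Y Y\<^esub> i \<in> {..<length Xs}. inj i \<cdot>\<^bsub>C\<^esub> proj i) = Ident C Y)"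

definition kernel_arrow :: "('o, 'm, 'k, 'r) lin_cat_scheme \<Rightarrow> 'm \<Rightarrow> 'm \<Rightarrow> bool" where
  "kernel_arrow C f k \<longleftrightarrow> f \<in> Arr C \<and> k \<in> Arr C \<and> Cod C k = Dom C f \<and>
     f \<cdot>\<^bsub>C\<^esub> k = zero_arrow C (Dom C k) (Cod C f) \<and>
     (\<forall>W. \<forall>h \<in> Hom C W (Dom C f). f \<cdot>\<^bsub>C\<^esub> h = zero_arrow C W (Cod C f) \<longrightarrow>
        (\<exists>!u. u \<in> Hom C W (Dom C k) \<and> k \<cdot>\<^bsub>C\<^esub> u = h))"

definition cokernel_arrow :: "('o, 'm, 'k, 'r) lin_cat_scheme \<Rightarrow> 'm \<Rightarrow> 'm \<Rightarrow> bool" where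
  "cokernel_arrow C f q \<longleftrightarrow> f \<in> Arr C \<and> q \<in> Arr C \<and> Dom C q = Cod C f \<and>
     q \<cdot>\<^bsub>C\<^esub> f = zero_arrow C (Dom C f) (Cod C q) \<and>
     (\<forall>W. \<forall>h \<in> Hom C (Cod C f) W. h \<cdot>\<^bsub>C\<^esub> f = zero_arrow C (Dom C f) W \<longrightarrow>
        (\<exists>!u. u \<in> Hom C (Cod C q) W \<and> u \<cdot>\<^bsub>C\<^esub> q = h))"

locale abelian_linear_category = linear_category +
  assumes ex_zero_object: "\<exists>Z. zero_object C Z"
    and ex_biproduct: "\<lbrakk>X \<in> Obj C; Y \<in> Obj C\<rbrakk> \<Longrightarrow> \<exists>Z. is_direct_sum C Z [X, Y]"
    and ex_kernel: "f \<in> Arr C \<Longrightarrow> \<exists>k. kernel_arrow C f k"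
    and ex_cokernel: "f \<in> Arr C \<Longrightarrow> \<exists>q. cokernel_arrow C f q"
    and mono_is_kernel: "mono_arrow C f \<Longrightarrow> \<exists>g. kernel_arrow C g f"
    and epi_is_cokernel: "epi_arrow C f \<Longrightarrow> \<exists>g. cokernel_arrow C g f"

text \<open>Existence of a finite filtration whose successive quotients are simple.\<close>

inductive finite_length :: "('o, 'm, 'k, 'r) lin_cat_scheme \<Rightarrow> 'o \<Rightarrow> bool" for C where
  zero: "zero_object C Z \<Longrightarrow> finite_length C Z"
| extend: "\<lbrakk>finite_length C X; i \<in> Hom C X Y; mono_arrow C i; cokernel_arrow C i q;
            simple_object C (Cod C q)\<rbrakk> \<Longrightarrow> finite_length C Y"

locale locally_finite_category = abelian_linear_category +
  assumes hom_fin_dim: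
      "\<lbrakk>X \<in> Obj C; Y \<in> Obj C\<rbrakk> \<Longrightarrow> vectorspace.fin_dim class_ring (hom_space C X Y)"
    and obj_finite_length: "X \<in> Obj C \<Longrightarrow> finite_length C X"

locale semisimple_category = abelian_linear_category +
  assumes semisimple:
    "X \<in> Obj C \<Longrightarrow> \<exists>Ss. (\<forall>S \<in> set Ss. simple_object C S) \<and> is_direct_sum C X Ss"


section \<open>Monoidal and rigid categories\<close>

record ('o, 'm, 'k) mon_cat = "('o, 'm, 'k) lin_cat" +
  tensor_obj :: "'o \<Rightarrow> 'o \<Rightarrow> 'o"  (infixr \<open>\<otimes>\<^sub>o\<index>\<close> 75)
  tensor_arr :: "'m \<Rightarrow> 'm \<Rightarrow> 'm"  (infixr \<open>\<otimes>\<^sub>a\<index>\<close> 75)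
  unit_obj :: "'o"
  associator :: "'o \<Rightarrow> 'o \<Rightarrow> 'o \<Rightarrow> 'm"
  lunitor :: "'o \<Rightarrow> 'm"
  runitor :: "'o \<Rightarrow> 'm"

locale monoidal_category = category C
  for C :: "('o, 'm, 'k, 'r) mon_cat_scheme" (structure) +
  assumes tensor_obj: "\<lbrakk>X \<in> Obj C; Y \<in> Obj C\<rbrakk> \<Longrightarrow> X \<otimes>\<^sub>o Y \<in> Obj C"
    and unit_obj: "unit_obj C \<in> Obj C"
    and tensor_arr: "\<lbrakk>f \<in> Hom C X Y; g \<in> Hom C X' Y'\<rbrakk> \<Longrightarrow>
      f \<otimes>\<^sub>a g \<in> Hom C (X \<otimes>\<^sub>o X') (Y \<otimes>\<^sub>o Y')"
    and tensor_ident: "\<lbrakk>X \<in> Obj C; Y \<in> Obj C\<rbrakk> \<Longrightarrow>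
      Ident C X \<otimes>\<^sub>a Ident C Y = Ident C (X \<otimes>\<^sub>o Y)"
    and tensor_comp:
      "\<lbrakk>f \<in> Hom C X Y; g \<in> Hom C Y Z; f' \<in> Hom C X' Y'; g' \<in> Hom C Y' Z'\<rbrakk> \<Longrightarrow>
      (g \<cdot> f) \<otimes>\<^sub>a (g' \<cdot> f') = (g \<otimes>\<^sub>a g') \<cdot> (f \<otimes>\<^sub>a f')"
    and associator_hom: "\<lbrakk>X \<in> Obj C; Y \<in> Obj C; Z \<in> Obj C\<rbrakk> \<Longrightarrow>
      associator C X Y Z \<in> Hom C ((X \<otimes>\<^sub>o Y) \<otimes>\<^sub>o Z) (X \<otimes>\<^sub>o (Y \<otimes>\<^sub>o Z))"
    and associator_iso: "\<lbrakk>X \<in> Obj C; Y \<in> Obj C; Z \<in> Obj C\<rbrakk> \<Longrightarrow>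
      iso_arrow C (associator C X Y Z)"
    and associator_natural:
      "\<lbrakk>f \<in> Hom C X X'; g \<in> Hom C Y Y'; h \<in> Hom C Z Z'\<rbrakk> \<Longrightarrow>
      associator C X' Y' Z' \<cdot> ((f \<otimes>\<^sub>a g) \<otimes>\<^sub>a h) = (f \<otimes>\<^sub>a (g \<otimes>\<^sub>a h)) \<cdot> associator C X Y Z"
    and lunitor_hom: "X \<in> Obj C \<Longrightarrow> lunitor C X \<in> Hom C (unit_obj C \<otimes>\<^sub>o X) X"
    and lunitor_iso: "X \<in> Obj C \<Longrightarrow> iso_arrow C (lunitor C X)"
    and lunitor_natural: "f \<in> Hom C X Y \<Longrightarrow>
      lunitor C Y \<cdot> (Ident C (unit_obj C) \<otimes>\<^sub>a f) = f \<cdot> lunitor C X"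
    and runitor_hom: "X \<in> Obj C \<Longrightarrow> runitor C X \<in> Hom C (X \<otimes>\<^sub>o unit_obj C) X"
    and runitor_iso: "X \<in> Obj C \<Longrightarrow> iso_arrow C (runitor C X)"
    and runitor_natural: "f \<in> Hom C X Y \<Longrightarrow>
      runitor C Y \<cdot> (f \<otimes>\<^sub>a Ident C (unit_obj C)) = f \<cdot> runitor C X"
    and pentagon: "\<lbrakk>W \<in> Obj C; X \<in> Obj C; Y \<in> Obj C; Z \<in> Obj C\<rbrakk> \<Longrightarrow>
      associator C W X (Y \<otimes>\<^sub>o Z) \<cdot> associator C (W \<otimes>\<^sub>o X) Y Z =
      (Ident C W \<otimes>\<^sub>a associator C X Y Z) \<cdot> associator C W (X \<otimes>\<^sub>o Y) Z \<cdot>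
        (associator C W X Y \<otimes>\<^sub>a Ident C Z)"
    and triangle: "\<lbrakk>X \<in> Obj C; Y \<in> Obj C\<rbrakk> \<Longrightarrow>
      (Ident C X \<otimes>\<^sub>a lunitor C Y) \<cdot> associator C X (unit_obj C) Y = runitor C X \<otimes>\<^sub>a Ident C Y"

text \<open>\<open>V\<close> is a left dual of \<open>X\<close>, with evaluation \<open>V \<otimes> X \<rightarrow> 1\<close> and coevaluation \<open>1 \<rightarrow> X \<otimes> V\<close>;
  equivalently, \<open>X\<close> is a right dual of \<open>V\<close>. The last two conjuncts are the zigzag identities
  with the unitors moved to the right-hand sides.\<close>

definition left_dual :: "('o, 'm, 'k, 'r) mon_cat_scheme \<Rightarrow> 'o \<Rightarrow> 'o \<Rightarrow> bool" where
  "left_dual C V X \<longleftrightarrow> V \<in> Obj C \<and> X \<in> Obj C \<and>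
     (\<exists>ev \<in> Hom C (V \<otimes>\<^sub>o\<^bsub>C\<^esub> X) (unit_obj C). \<exists>coev \<in> Hom C (unit_obj C) (X \<otimes>\<^sub>o\<^bsub>C\<^esub> V).
        runitor C X \<cdot>\<^bsub>C\<^esub> (Ident C X \<otimes>\<^sub>a\<^bsub>C\<^esub> ev) \<cdot>\<^bsub>C\<^esub> associator C X V X
          \<cdot>\<^bsub>C\<^esub> (coev \<otimes>\<^sub>a\<^bsub>C\<^esub> Ident C X) = lunitor C X \<and>
        lunitor C V \<cdot>\<^bsub>C\<^esub> (ev \<otimes>\<^sub>a\<^bsub>C\<^esub> Ident C V) \<cdot>\<^bsub>C\<^esub> inv_arrow C (associator C V X V)
          \<cdot>\<^bsub>C\<^esub> (Ident C V \<otimes>\<^sub>a\<^bsub>C\<^esub> coev) = runitor C V)"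

locale rigid_monoidal_category = monoidal_category +
  assumes ex_left_dual: "X \<in> Obj C \<Longrightarrow> \<exists>V. left_dual C V X"
    and ex_right_dual: "X \<in> Obj C \<Longrightarrow> \<exists>W. left_dual C X W"


section \<open>Fusion categories\<close>

text \<open>Every \<open>'k\<close>-algebra homomorphism from \<open>'k\<close> to \<open>End(1)\<close> sends \<open>c\<close> to \<open>c \<odot> id\<close>, so
  \<open>End(1) \<cong> 'k\<close> means that this map is bijective.\<close>

locale fusion_category =
  semisimple_category C + locally_finite_category C + rigid_monoidal_category C
  for C :: "('o, 'm, 'k :: field, 'r) mon_cat_scheme" (structure) +
  assumes tensor_add_left: "\<lbrakk>f \<in> Hom C X Y; f' \<in> Hom C X Y; g \<in> Hom C X' Y'\<rbrakk> \<Longrightarrow>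
      (f \<oplus>\<^bsub>hom_space C X Y\<^esub> f') \<otimes>\<^sub>a g
        = (f \<otimes>\<^sub>a g) \<oplus>\<^bsub>hom_space C (X \<otimes>\<^sub>o X') (Y \<otimes>\<^sub>o Y')\<^esub> (f' \<otimes>\<^sub>a g)"
    and tensor_add_right: "\<lbrakk>f \<in> Hom C X Y; g \<in> Hom C X' Y'; g' \<in> Hom C X' Y'\<rbrakk> \<Longrightarrow>
      f \<otimes>\<^sub>a (g \<oplus>\<^bsub>hom_space C X' Y'\<^esub> g')
        = (f \<otimes>\<^sub>a g) \<oplus>\<^bsub>hom_space C (X \<otimes>\<^sub>o X') (Y \<otimes>\<^sub>o Y')\<^esub> (f \<otimes>\<^sub>a g')"
    and tensor_smult_left: "\<lbrakk>f \<in> Hom C X Y; g \<in> Hom C X' Y'\<rbrakk> \<Longrightarrow>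
      (c \<odot>\<^bsub>hom_space C X Y\<^esub> f) \<otimes>\<^sub>a g = c \<odot>\<^bsub>hom_space C (X \<otimes>\<^sub>o X') (Y \<otimes>\<^sub>o Y')\<^esub> (f \<otimes>\<^sub>a g)"
    and tensor_smult_right: "\<lbrakk>f \<in> Hom C X Y; g \<in> Hom C X' Y'\<rbrakk> \<Longrightarrow>
      f \<otimes>\<^sub>a (c \<odot>\<^bsub>hom_space C X' Y'\<^esub> g) = c \<odot>\<^bsub>hom_space C (X \<otimes>\<^sub>o X') (Y \<otimes>\<^sub>o Y')\<^esub> (f \<otimes>\<^sub>a g)"
    and end_unit: "bij_betw
      (\<lambda>c. c \<odot>\<^bsub>hom_space C (unit_obj C) (unit_obj C)\<^esub> Ident C (unit_obj C))
      UNIV (Hom C (unit_obj C) (unit_obj C))"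
    and finitely_many_simples:
      "\<exists>R. finite R \<and> (\<forall>S. simple_object C S \<longrightarrow> (\<exists>T \<in> R. isomorphic C S T))"


section \<open>Grothendieck ring and Frobenius--Perron dimension\<close>

text \<open>\<open>Xs = [X\<^sub>1, \<dots>, X\<^sub>m]\<close> lists the simple objects up to isomorphism, without
  repetition. List indices start at \<open>0\<close>.\<close>

definition simple_representatives :: "('o, 'm, 'r) cat_scheme \<Rightarrow> 'o list \<Rightarrow> bool" where
  "simple_representatives C Xs \<longleftrightarrow>
     (\<forall>S \<in> set Xs. simple_object C S) \<and>
     (\<forall>i < length Xs. \<forall>j < length Xs. i \<noteq> j \<longrightarrow> \<not> isomorphic C (Xs ! i) (Xs ! j)) \<and>
     (\<forall>S. simple_object C S \<longrightarrow> (\<exists>T \<in> set Xs. isomorphic C S T))"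

text \<open>The number of summands isomorphic to \<open>S\<close> in a decomposition of \<open>Y\<close> into simple objects.\<close>

definition multiplicity :: "('o, 'm, 'k, 'r) lin_cat_scheme \<Rightarrow> 'o \<Rightarrow> 'o \<Rightarrow> nat" where
  "multiplicity C S Y =
     (THE n. \<exists>Ss. (\<forall>T \<in> set Ss. simple_object C T) \<and> is_direct_sum C Y Ss \<and>
        n = length (filter (isomorphic C S) Ss))"

definition fusion_coeff :: "('o, 'm, 'k, 'r) mon_cat_scheme \<Rightarrow> 'o \<Rightarrow> 'o \<Rightarrow> 'o \<Rightarrow> nat" where
  "fusion_coeff C X Y Z = multiplicity C Z (X \<otimes>\<^sub>o\<^bsub>C\<^esub> Y)"

definition groth_class :: "('o, 'm, 'k, 'r) lin_cat_scheme \<Rightarrow> 'o list \<Rightarrow> 'o \<Rightarrow> int vec" where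
  "groth_class C Xs Y = vec (length Xs) (\<lambda>k. int (multiplicity C (Xs ! k) Y))"

text \<open>Elements are written in coordinates with respect to the basis
  \<open>[X\<^sub>1], \<dots>, [X\<^sub>m]\<close>.\<close>

definition groth_ring :: "('o, 'm, 'k, 'r) mon_cat_scheme \<Rightarrow> 'o list \<Rightarrow> int vec ring" where
  "groth_ring C Xs = (let m = length Xs in
     \<lparr>carrier = carrier_vec m,
      monoid.mult = (\<lambda>u v. vec m (\<lambda>k. \<Sum>i<m. \<Sum>j<m.
        u $ i * v $ j * int (fusion_coeff C (Xs ! i) (Xs ! j) (Xs ! k)))),
      one = groth_class C Xs (unit_obj C),
      zero = 0\<^sub>v m,
      add = (+)\<rparr>)"

text \<open>Column \<open>j\<close> holds the coordinates of \<open>[X] [X\<^sub>j]\<close>.\<close>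

definition left_mult_matrix :: "('o, 'm, 'k, 'r) mon_cat_scheme \<Rightarrow> 'o list \<Rightarrow> 'o \<Rightarrow> real mat" where
  "left_mult_matrix C Xs X = mat (length Xs) (length Xs)
     (\<lambda>(k, j). real_of_int
        ((groth_class C Xs X \<otimes>\<^bsub>groth_ring C Xs\<^esub> groth_class C Xs (Xs ! j)) $ k))"

definition FPdim :: "('o, 'm, 'k, 'r) mon_cat_scheme \<Rightarrow> 'o list \<Rightarrow> 'o \<Rightarrow> real" where
  "FPdim C Xs X = Max {r. 0 < r \<and> eigenvalue (left_mult_matrix C Xs X) r}"


section \<open>Probability groups\<close>

text \<open>The sums range over finite sets containing all nonzero terms. By \<open>sum_one\<close> and the unit
  law, the identity element is unique, and \<open>inv_pos\<close>, \<open>inv_unique\<close> determine \<open>pinv\<close> on \<open>A\<close>, so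
  the existential quantifiers below are over uniquely determined data.\<close>

locale probability_structure =
  fixes A :: "'a set" and p :: "'a \<Rightarrow> 'a \<Rightarrow> 'a \<Rightarrow> real" and e :: 'a and pinv :: "'a \<Rightarrow> 'a"
  assumes nonneg: "\<lbrakk>a \<in> A; b \<in> A; c \<in> A\<rbrakk> \<Longrightarrow> 0 \<le> p a b c"
    and finite_support: "\<lbrakk>a \<in> A; b \<in> A\<rbrakk> \<Longrightarrow> finite {c \<in> A. p a b c \<noteq> 0}"
    and sum_one: "\<lbrakk>a \<in> A; b \<in> A\<rbrakk> \<Longrightarrow> (\<Sum>c \<in> {c \<in> A. p a b c \<noteq> 0}. p a b c) = 1"
    and assoc: "\<lbrakk>a \<in> A; b \<in> A; c \<in> A; d \<in> A\<rbrakk> \<Longrightarrow>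
      (\<Sum>x \<in> {x \<in> A. p a b x \<noteq> 0}. p a b x * p x c d) =
      (\<Sum>y \<in> {y \<in> A. p b c y \<noteq> 0}. p a y d * p b c y)"
    and unit_mem: "e \<in> A"
    and left_unit: "a \<in> A \<Longrightarrow> p e a a = 1"
    and right_unit: "a \<in> A \<Longrightarrow> p a e a = 1"
    and inv_mem: "a \<in> A \<Longrightarrow> pinv a \<in> A"
    and inv_pos: "a \<in> A \<Longrightarrow> 0 < p a (pinv a) e"
    and inv_unique: "\<lbrakk>a \<in> A; b \<in> A; 0 < p a b e\<rbrakk> \<Longrightarrow> b = pinv a"
    and inv_anti: "\<lbrakk>a \<in> A; b \<in> A; c \<in> A\<rbrakk> \<Longrightarrow> p a b c = p (pinv b) (pinv a) (pinv c)"
    and inv_comm: "a \<in> A \<Longrightarrow> p a (pinv a) e = p (pinv a) a e"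

definition probability_group :: "'a set \<Rightarrow> ('a \<Rightarrow> 'a \<Rightarrow> 'a \<Rightarrow> real) \<Rightarrow> bool" where
  "probability_group A p \<longleftrightarrow> (\<exists>e pinv. probability_structure A p e pinv)"

end

theory Submission
  imports Defs "HOL-Analysis.Function_Topology"
begin

text \<open>Over an algebraically closed field, Schur's lemma identifies the multiplicity of a simple object \<open>S\<close> in
  \<open>Y\<close> with \<open>dim Hom(S, Y) = dim Hom(Y, S)\<close> (\<open>simple_end_scalar\<close>, \<open>multiplicity_eq_hom_dim\<close>). So the fusion
  coefficients \<open>N a b c\<close> are dimensions of \<open>Hom(c, a \<otimes> b)\<close>. Associativity and the unit laws
  for \<open>N\<close> come from the associator and the unitors, once tensor products are decomposed into simple
  objects (\<open>hom_dim_tensor\<close>).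

  Duality needs only one estimate. If \<open>V\<close> is a left dual of \<open>x\<close>, then transposition embeds
  \<open>Hom(V \<otimes> a, b)\<close> into \<open>Hom(a, x \<otimes> b)\<close> (\<open>hom_dim_left_dual\<close>), and \<open>V\<close> is not zero. Writing \<open>s x\<close> for the class
  of some simple summand of \<open>V\<close>, one gets \<open>N (s x) a b \<le> N x b a\<close>. Putting \<open>a\<close> or \<open>b\<close> equal to the unit
  forces \<open>s\<close> to be an involution and \<open>N x y 1\<close> to be \<open>1\<close> for \<open>y = s x\<close> and \<open>0\<close> otherwise; then the
  inequality is an equality, and together with associativity it makes \<open>s\<close> an anti-automorphism (\<open>dual_anti\<close>). All this is combinatorics
  of a \<open>fusion_rule\<close>.

  Right multiplication by the sum of all simple objects is a strictly positive matrix, so by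
  Perron's theorem it has a positive eigenvector, unique up to scaling. Left multiplications commute
  with it and therefore share this eigenvector; their eigenvalues form a positive character \<open>d\<close>
  with \<open>d (s a) = d a\<close> (\<open>ex_positive_character\<close>). A positive eigenvector of a nonnegative matrix belongs
  to its largest eigenvalue, hence \<open>d\<close> is the Frobenius--Perron dimension (\<open>FPdim_eq_character\<close>). The
  probability map is \<open>N\<close> rescaled by the character \<open>d\<close>, and each axiom of a probability group is the
  rescaled form of an identity for \<open>N\<close> (\<open>probability_structure_of_character\<close>).\<close>

section \<open>Perron--Frobenius theory for positive matrices\<close>

text \<open>The Collatz--Wielandt argument: among the pairs \<open>(l, x)\<close> with \<open>x\<close> in the standard simplex and
  \<open>l x \<le> W x\<close>, there is one with largest \<open>l\<close>, by compactness. If this inequality were strict in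
  some coordinate, then applying the positive matrix \<open>W\<close> once more would make it strict in all
  coordinates, and \<open>l\<close> could be increased.\<close>

lemma positive_matrix_has_positive_eigenvector:
  fixes W :: "'a \<Rightarrow> 'a \<Rightarrow> real"
  assumes fin: "finite A" and ne: "A \<noteq> {}"
    and pos: "\<And>i j. i \<in> A \<Longrightarrow> j \<in> A \<Longrightarrow> 0 < W i j"
  shows "\<exists>l w. (\<forall>i\<in>A. 0 < w i) \<and> (\<forall>i\<in>A. (\<Sum>j\<in>A. W i j * w j) = l * w i)"
proof -
  \<comment> \<open>An upper bound for all feasible \<open>l\<close>, obtained by summing \<open>l x \<le> W x\<close> over the coordinates.\<close>
  define c where "c = (\<Sum>i\<in>A. \<Sum>j\<in>A. W i j)"
  define K where "K = (\<Pi>\<^sub>E i\<in>UNIV. if i \<in> A then {0..1::real} else {0})"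
  define D where "D = {0..c} \<times> K \<inter> {z. (\<Sum>i\<in>A. snd z i) = 1 \<and>
    (\<forall>i\<in>A. fst z * snd z i \<le> (\<Sum>j\<in>A. W i j * snd z j))}"
  have K_iff: "x \<in> K \<longleftrightarrow> (\<forall>i. if i \<in> A then 0 \<le> x i \<and> x i \<le> 1 else x i = 0)" for x
    unfolding K_def PiE_iff by (auto split: if_splits)
  have "compactin (product_topology (\<lambda>i. euclidean) UNIV) K"
    unfolding K_def compactin_PiE by (auto simp: compactin_euclidean_iff)
  then have K: "compact K"
    by (simp add: euclidean_product_topology compactin_euclidean_iff)
  have closed_Collect_ball: "closed {z. \<forall>i\<in>A. P i z}"
    if "\<And>i. i \<in> A \<Longrightarrow> closed {z. P i z}" for P :: "'a \<Rightarrow> real \<times> ('a \<Rightarrow> real) \<Rightarrow> bool"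
  proof -
    have "closed (\<Inter>i\<in>A. {z. P i z})" using that by (intro closed_INT) auto
    moreover have "(\<Inter>i\<in>A. {z. P i z}) = {z. \<forall>i\<in>A. P i z}" by auto
    ultimately show ?thesis by simp
  qed
  have cont: "continuous_on UNIV (\<lambda>z :: real \<times> ('a \<Rightarrow> real). snd z i)" for i
    by (rule continuous_on_compose2[OF continuous_on_product_coordinates
        continuous_on_snd[OF continuous_on_id]]) auto
  have "closed {z :: real \<times> ('a \<Rightarrow> real). (\<Sum>i\<in>A. snd z i) = 1 \<and>
    (\<forall>i\<in>A. fst z * snd z i \<le> (\<Sum>j\<in>A. W i j * snd z j))}"
    by (intro closed_Collect_conj closed_Collect_eq closed_Collect_ball closed_Collect_le
        continuous_on_sum continuous_on_mult continuous_on_const continuous_on_fst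
        continuous_on_id cont)
  then have D: "compact D"
    unfolding D_def by (intro compact_Int_closed compact_Times K) auto
  have D_I: "(l, x) \<in> D" if l: "0 \<le> l" and x: "\<And>i. i \<in> A \<Longrightarrow> 0 \<le> x i" "\<And>i. i \<notin> A \<Longrightarrow> x i = 0"
    and s: "(\<Sum>i\<in>A. x i) = 1" and le: "\<And>i. i \<in> A \<Longrightarrow> l * x i \<le> (\<Sum>j\<in>A. W i j * x j)" for l x
  proof -
    have x1: "x i \<le> 1" if "i \<in> A" for i
      using member_le_sum[of i A x] that x(1) fin s by auto
    have "l = (\<Sum>i\<in>A. l * x i)" using s by (simp flip: sum_distrib_left)
    also have "\<dots> \<le> (\<Sum>i\<in>A. \<Sum>j\<in>A. W i j * x j)" by (intro sum_mono le)
    also have "\<dots> \<le> c" unfolding c_def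
      by (intro sum_mono) (use pos x1 in \<open>simp add: mult_left_le less_imp_le\<close>)
    finally show ?thesis unfolding D_def using l x x1 s le by (auto simp: K_iff)
  qed
  have "(0, \<lambda>i. if i \<in> A then 1 / card A else 0) \<in> D"
  proof (rule D_I)
    fix i assume "i \<in> A"
    then show "0 * (if i \<in> A then 1 / real (card A) else 0)
        \<le> (\<Sum>j\<in>A. W i j * (if j \<in> A then 1 / real (card A) else 0))"
      using pos by (auto intro!: sum_nonneg simp: less_imp_le)
  qed (use fin ne in simp_all)
  then have "D \<noteq> {}" by blast
  from continuous_attains_sup[OF D this continuous_on_fst[OF continuous_on_id]]
  obtain l x where lx: "(l, x) \<in> D" and max: "\<And>l' y. (l', y) \<in> D \<Longrightarrow> l' \<le> l"
    by fastforce
  from lx have "x \<in> K" by (simp add: D_def)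
  with K_iff have x0: "0 \<le> x i" if "i \<in> A" for i using that by (metis (full_types))
  from lx have l: "0 \<le> l" and x1: "(\<Sum>i\<in>A. x i) = 1"
    and le: "\<And>i. i \<in> A \<Longrightarrow> l * x i \<le> (\<Sum>j\<in>A. W i j * x j)"
    by (simp_all add: D_def)
  note x = x0 x1
  \<comment> \<open>One application of \<open>W\<close>: if \<open>l x \<le> y\<close> is not an equality, then \<open>l y < W y\<close> everywhere.\<close>
  define y where "y i = (\<Sum>j\<in>A. W i j * x j)" for i
  have W_pos: "0 < (\<Sum>j\<in>A. W i j * z j)"
    if "i \<in> A" "\<And>j. j \<in> A \<Longrightarrow> 0 \<le> z j" "k \<in> A" "z k \<noteq> 0" for i k and z :: "'a \<Rightarrow> real"
    using that pos fin
    by (intro sum_pos2[of A k]) (auto intro!: mult_pos_pos mult_nonneg_nonneg simp: less_le)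
  obtain k0 where "k0 \<in> A" "x k0 \<noteq> 0" using x(2) by (metis sum.neutral zero_neq_one)
  then have y_pos: "0 < y i" if "i \<in> A" for i
    unfolding y_def using W_pos[of i x] that x(1) by blast
  have eq: "y i = l * x i" if "i \<in> A" for i
  proof (rule ccontr)
    assume "y i \<noteq> l * x i"
    then have *: "0 < (\<Sum>j\<in>A. W k j * (y j - l * x j))" if "k \<in> A" for k
      using that \<open>i \<in> A\<close> le by (intro W_pos[of k _ i]) (auto simp: y_def)
    have gt: "l * y k < (\<Sum>j\<in>A. W k j * y j)" if "k \<in> A" for k
      using *[OF that] unfolding y_def
      by (simp add: algebra_simps sum_subtractf sum_distrib_left)
    define l' where "l' = Min ((\<lambda>k. (\<Sum>j\<in>A. W k j * y j) / y k) ` A)"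
    have l': "l' * y k \<le> (\<Sum>j\<in>A. W k j * y j)" if "k \<in> A" for k
    proof -
      have "l' \<le> (\<Sum>j\<in>A. W k j * y j) / y k" unfolding l'_def using fin that by auto
      then show ?thesis using y_pos[OF that] by (simp add: field_simps)
    qed
    have "l < l'" unfolding l'_def
      using fin ne gt y_pos by (subst Min_gr_iff) (auto simp: field_simps)
    define s where "s = (\<Sum>k\<in>A. y k)"
    have s: "0 < s" unfolding s_def using fin ne y_pos by (intro sum_pos) auto
    have "(l', \<lambda>k. if k \<in> A then y k / s else 0) \<in> D"
    proof (rule D_I)
      show "(\<Sum>k\<in>A. if k \<in> A then y k / s else 0) = 1"
        using s by (simp add: s_def flip: sum_divide_distrib)
      fix k assume k: "k \<in> A"
      have "(\<Sum>j\<in>A. W k j * (if j \<in> A then y j / s else 0)) = (\<Sum>j\<in>A. W k j * y j) / s"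
        by (simp add: sum_divide_distrib)
      then show "l' * (if k \<in> A then y k / s else 0)
          \<le> (\<Sum>j\<in>A. W k j * (if j \<in> A then y j / s else 0))"
        using l'[OF k] s k by (simp add: divide_right_mono)
    qed (use \<open>l < l'\<close> l s y_pos in \<open>auto simp: less_imp_le\<close>)
    from max[OF this] \<open>l < l'\<close> show False by simp
  qed
  show ?thesis
  proof (intro exI conjI ballI)
    fix i assume i: "i \<in> A"
    show "0 < x i" using eq[OF i] y_pos[OF i] x(1)[OF i] by (auto simp: less_le)
    show "(\<Sum>j\<in>A. W i j * x j) = l * x i" using eq[OF i] by (simp add: y_def)
  qed
qed

text \<open>Subtract from \<open>v\<close> the largest multiple of \<open>w\<close> for which the difference stays nonnegative. The
  difference is annihilated by \<open>W - l\<close> and vanishes in some coordinate, so the positivity of \<open>W\<close>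
  makes it vanish in all of them.\<close>

lemma positive_matrix_eigenvector_unique:
  fixes W :: "'a \<Rightarrow> 'a \<Rightarrow> real"
  assumes fin: "finite A" and ne: "A \<noteq> {}"
    and pos: "\<And>i j. i \<in> A \<Longrightarrow> j \<in> A \<Longrightarrow> 0 < W i j"
    and w: "\<And>i. i \<in> A \<Longrightarrow> 0 < w i" "\<And>i. i \<in> A \<Longrightarrow> (\<Sum>j\<in>A. W i j * w j) = l * w i"
    and v: "\<And>i. i \<in> A \<Longrightarrow> (\<Sum>j\<in>A. W i j * v j) = l * v i"
  shows "\<exists>t. \<forall>i\<in>A. v i = t * w i"
proof -
  define t where "t = Min ((\<lambda>i. v i / w i) ` A)"
  have ge: "0 \<le> v i - t * w i" if "i \<in> A" for i
  proof -
    have "t \<le> v i / w i" unfolding t_def using fin that by auto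
    then show ?thesis using w(1)[OF that] by (simp add: field_simps)
  qed
  have "t \<in> (\<lambda>i. v i / w i) ` A" unfolding t_def using fin ne by (intro Min_in) auto
  then obtain k where k: "k \<in> A" "t = v k / w k" by blast
  have "(\<Sum>j\<in>A. W k j * (v j - t * w j)) = l * v k - t * (l * w k)"
    using v[OF k(1)] w(2)[OF k(1)]
    by (simp add: algebra_simps sum_subtractf flip: sum_distrib_left)
  also have "\<dots> = 0" using k w(1)[OF k(1)] by simp
  finally have "\<forall>j\<in>A. W k j * (v j - t * w j) = 0"
    using fin k pos ge by (subst (asm) sum_nonneg_eq_0_iff) (auto simp: less_imp_le)
  then have "\<forall>j\<in>A. v j = t * w j" using pos[OF k(1)] by fastforce
  then show ?thesis ..
qed

text \<open>A positive eigenvector of a nonnegative matrix belongs to the largest eigenvalue. Given an eigenvector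
  \<open>v\<close> for \<open>r\<close>, scale \<open>w\<close> to the smallest \<open>t w \<ge> \<bar>v\<bar>\<close>, which touches \<open>\<bar>v\<bar>\<close> in some coordinate \<open>k\<close>; there
  \<open>\<bar>r\<bar> \<bar>v\<^sub>k\<bar> \<le> (L \<bar>v\<bar>)\<^sub>k \<le> t (L w)\<^sub>k = d \<bar>v\<^sub>k\<bar>\<close>.\<close>

lemma Max_eigenvalue_nonneg_matrix:
  fixes L :: "real mat"
  assumes L: "L \<in> carrier_mat n n"
    and nonneg: "\<And>i j. i < n \<Longrightarrow> j < n \<Longrightarrow> 0 \<le> L $$ (i, j)"
    and n: "0 < n" and d: "0 < d"
    and w: "\<And>i. i < n \<Longrightarrow> 0 < w i" "\<And>i. i < n \<Longrightarrow> (\<Sum>j<n. L $$ (i, j) * w j) = d * w i"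
  shows "Max {r. 0 < r \<and> eigenvalue L r} = d"
proof -
  have mv: "(L *\<^sub>v v) $ i = (\<Sum>j<n. L $$ (i, j) * v $ j)" if "i < n" "v \<in> carrier_vec n" for v i
    using that L by (auto simp: scalar_prod_def lessThan_atLeast0)
  have "eigenvector L (vec n w) d"
    unfolding eigenvector_def
  proof (intro conjI)
    show "vec n w \<noteq> 0\<^sub>v (dim_row L)"
    proof
      assume "vec n w = 0\<^sub>v (dim_row L)"
      then have "vec n w $ 0 = 0\<^sub>v (dim_row L) $ 0" by simp
      then show False using n w(1)[of 0] L by simp
    qed
    show "L *\<^sub>v vec n w = d \<cdot>\<^sub>v vec n w"
      using L w(2) by (intro eq_vecI) (auto simp del: index_mult_mat_vec simp: mv)
  qed (use L in auto)
  then have ev: "d \<in> {r. 0 < r \<and> eigenvalue L r}" using d by (auto simp: eigenvalue_def)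
  have ub: "r \<le> d" if r: "eigenvalue L r" for r
  proof -
    from r L obtain v where v: "v \<in> carrier_vec n" "v \<noteq> 0\<^sub>v n" "L *\<^sub>v v = r \<cdot>\<^sub>v v"
      by (auto simp: eigenvalue_def eigenvector_def)
    define t where "t = Max ((\<lambda>i. \<bar>v $ i\<bar> / w i) ` {..<n})"
    have le: "\<bar>v $ i\<bar> \<le> t * w i" if "i < n" for i
    proof -
      have "\<bar>v $ i\<bar> / w i \<le> t" unfolding t_def using that by auto
      then show ?thesis using w(1)[OF that] by (simp add: field_simps)
    qed
    have "t \<in> (\<lambda>i. \<bar>v $ i\<bar> / w i) ` {..<n}" unfolding t_def using n by (intro Max_in) auto
    then obtain k where k: "k < n" "t = \<bar>v $ k\<bar> / w k" by blast
    have "\<exists>i<n. v $ i \<noteq> 0" using v(1,2) by (metis carrier_vecD eq_vecI index_zero_vec)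
    then obtain i where i: "i < n" "v $ i \<noteq> 0" by blast
    then have "0 < t * w i" using le[of i] by linarith
    with w(1)[OF i(1)] have t: "0 < t" by (simp add: zero_less_mult_iff)
    have "r * v $ k = (\<Sum>j<n. L $$ (k, j) * v $ j)"
      using mv[OF k(1) v(1)] v(1) k(1) by (simp add: v(3))
    then have "\<bar>r\<bar> * \<bar>v $ k\<bar> = \<bar>\<Sum>j<n. L $$ (k, j) * v $ j\<bar>" by (simp flip: abs_mult)
    also have "\<dots> \<le> (\<Sum>j<n. L $$ (k, j) * (t * w j))"
      using nonneg[OF k(1)] le
      by (intro order.trans[OF sum_abs] sum_mono) (auto simp: abs_mult intro!: mult_left_mono)
    also have "\<dots> = t * (\<Sum>j<n. L $$ (k, j) * w j)"
      by (simp add: sum_distrib_left ac_simps)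
    also have "\<dots> = d * \<bar>v $ k\<bar>" using k w(1)[OF k(1)] w(2)[OF k(1)] by simp
    finally have "\<bar>r\<bar> * \<bar>v $ k\<bar> \<le> d * \<bar>v $ k\<bar>" .
    moreover have "0 < \<bar>v $ k\<bar>" using k t w(1)[OF k(1)] by (auto simp: zero_less_divide_iff)
    ultimately show "r \<le> d" by (simp add: mult_le_cancel_right)
  qed
  have "char_poly L \<noteq> 0" using degree_monic_char_poly[OF L] by auto
  then have "finite {r. eigenvalue L r}"
    by (simp add: eigenvalue_root_char_poly[OF L] poly_roots_finite)
  then have "finite {r. 0 < r \<and> eigenvalue L r}" by (rule rev_finite_subset) auto
  then show ?thesis using ev ub by (intro Max_eqI) auto
qed

section \<open>Fusion rules and their characters\<close>

text \<open>The structure constants of a Grothendieck ring in the basis of simple objects. Duality enters only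
  through the inequality that transposition along a left dual yields directly; the following lemmas
  show that it already makes \<open>s\<close> an involution and an anti-automorphism.\<close>

locale fusion_rule =
  fixes A :: "'a set" and N :: "'a \<Rightarrow> 'a \<Rightarrow> 'a \<Rightarrow> nat" and e :: 'a and s :: "'a \<Rightarrow> 'a"
  assumes finite_A: "finite A"
    and unit_mem: "e \<in> A"
    and assoc: "\<lbrakk>a \<in> A; b \<in> A; c \<in> A; d \<in> A\<rbrakk> \<Longrightarrow>
      (\<Sum>x\<in>A. N a b x * N x c d) = (\<Sum>y\<in>A. N a y d * N b c y)"
    and unit_left: "\<lbrakk>a \<in> A; b \<in> A\<rbrakk> \<Longrightarrow> N e a b = (if a = b then 1 else 0)"
    and unit_right: "\<lbrakk>a \<in> A; b \<in> A\<rbrakk> \<Longrightarrow> N a e b = (if a = b then 1 else 0)"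
    and dual_mem: "x \<in> A \<Longrightarrow> s x \<in> A"
    and dual_le: "\<lbrakk>x \<in> A; a \<in> A; b \<in> A\<rbrakk> \<Longrightarrow> N (s x) a b \<le> N x b a"
begin

text \<open>Taking \<open>a = e\<close> in \<open>dual_le\<close> gives \<open>N x (s x) e \<ge> 1\<close>, and taking \<open>b = e\<close> shows that \<open>N (s x) a e\<close> is at
  most \<open>1\<close>, and is \<open>0\<close> unless \<open>a = x\<close>. The
  first fact for \<open>s x\<close> and the second for \<open>x\<close> leave only \<open>s (s x) = x\<close>.\<close>

lemma dual_dual: "x \<in> A \<Longrightarrow> s (s x) = x"
  and dual_pairing: "\<lbrakk>x \<in> A; y \<in> A\<rbrakk> \<Longrightarrow> N x y e = (if y = s x then 1 else 0)"
proof -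
  have ge: "1 \<le> N x (s x) e" if "x \<in> A" for x
    using dual_le[OF that unit_mem dual_mem[OF that]] unit_right[of "s x" "s x"] dual_mem[OF that]
    by simp
  have le: "N (s x) a e \<le> (if x = a then 1 else 0)" if "x \<in> A" "a \<in> A" for x a
    using dual_le[OF that(1,2) unit_mem] unit_right that by simp
  show ss: "s (s x) = x" if "x \<in> A" for x
    using ge[of "s x"] le[of x "s (s x)"] that dual_mem by (auto split: if_splits)
  show "N x y e = (if y = s x then 1 else 0)" if "x \<in> A" "y \<in> A" for x y
    using ge[of x] le[of "s x" y] that dual_mem ss by (auto split: if_splits)
qed

text \<open>The inequality for \<open>x\<close> and the inequality for \<open>s x\<close> are converse to each other.\<close>

lemma dual_eq: "\<lbrakk>x \<in> A; a \<in> A; b \<in> A\<rbrakk> \<Longrightarrow> N (s x) a b = N x b a"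
  using dual_le[of x a b] dual_le[of "s x" b a] dual_dual[of x] dual_mem[of x] by simp

text \<open>Both sides are the multiplicity of the unit in \<open>a b c\<close>, computed with the two bracketings.\<close>

lemma rotate:
  assumes "a \<in> A" "b \<in> A" "c \<in> A"
  shows "N a b (s c) = N b c (s a)"
proof -
  have "(\<Sum>x\<in>A. N a b x * N x c e) = (\<Sum>x\<in>A. if x = s c then N a b x else 0)"
    using assms dual_pairing dual_dual by (intro sum.cong) auto
  moreover have "(\<Sum>y\<in>A. N a y e * N b c y) = (\<Sum>y\<in>A. if y = s a then N b c y else 0)"
    using assms dual_pairing by (intro sum.cong) auto
  ultimately show ?thesis
    using assoc[OF assms unit_mem] finite_A assms dual_mem by simp
qed

lemma dual_anti:
  assumes "a \<in> A" "b \<in> A" "c \<in> A"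
  shows "N a b c = N (s b) (s a) (s c)"
  using rotate[of a b "s c"] dual_eq[of b "s a" "s c"] assms dual_mem dual_dual by simp

text \<open>Since \<open>j (s j)\<close> contains the unit, \<open>j (s j) k\<close> contains \<open>k\<close>; so \<open>k\<close> occurs in \<open>j y\<close> for some
  constituent \<open>y\<close> of \<open>(s j) k\<close>.\<close>

lemma ex_left_factor:
  assumes "j \<in> A" "k \<in> A"
  shows "\<exists>y\<in>A. 0 < N j y k"
proof -
  have "0 < N j (s j) e * N e k k" using assms dual_mem dual_pairing unit_left by simp
  also have "\<dots> \<le> (\<Sum>x\<in>A. N j (s j) x * N x k k)"
    using finite_A unit_mem by (intro member_le_sum) auto
  also have "\<dots> = (\<Sum>y\<in>A. N j y k * N (s j) k y)" using assms dual_mem by (intro assoc) auto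
  finally have "(\<Sum>y\<in>A. N j y k * N (s j) k y) \<noteq> 0" by simp
  then obtain y where "y \<in> A" "N j y k * N (s j) k y \<noteq> 0" by (rule sum.not_neutral_contains_not_neutral)
  then show ?thesis by auto
qed

text \<open>Right multiplication by the sum of all basis elements is the matrix \<open>W\<close> below. It is strictly positive
  by \<open>ex_left_factor\<close>, so it has a positive eigenvector \<open>w\<close>, unique up to scaling. Left
  multiplications commute with \<open>W\<close>, hence they map \<open>w\<close> to multiples of itself, and the eigenvalues \<open>d a\<close>
  form a character. Because left multiplication by \<open>s a\<close> is the transpose of left multiplication by \<open>a\<close>,
  evaluating the quadratic form of the latter at \<open>w\<close> gives \<open>d (s a) = d a\<close>. The last property exhibits
  \<open>d\<close> itself as a positive eigenvector of all left multiplications.\<close>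

theorem ex_positive_character:
  obtains d where "\<And>a. a \<in> A \<Longrightarrow> 0 < d a"
    and "\<And>a b. \<lbrakk>a \<in> A; b \<in> A\<rbrakk> \<Longrightarrow> (\<Sum>c\<in>A. real (N a b c) * d c) = d a * d b"
    and "\<And>a. a \<in> A \<Longrightarrow> d (s a) = d a"
    and "\<And>a c. \<lbrakk>a \<in> A; c \<in> A\<rbrakk> \<Longrightarrow> (\<Sum>b\<in>A. real (N a b c) * d b) = d a * d c"
proof -
  have rassoc: "(\<Sum>x\<in>A. real (N a b x) * real (N x c d)) = (\<Sum>y\<in>A. real (N a y d) * real (N b c y))"
    if "a \<in> A" "b \<in> A" "c \<in> A" "d \<in> A" for a b c d
    using arg_cong[OF assoc[OF that], of real] by simp
  define W where "W k j = (\<Sum>i\<in>A. real (N j i k))" for k j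
  have W: "0 < W k j" if kj: "k \<in> A" "j \<in> A" for k j
  proof -
    obtain y where "y \<in> A" "0 < N j y k" using ex_left_factor[OF kj(2,1)] by blast
    then show ?thesis unfolding W_def using finite_A by (intro sum_pos2[of A y]) auto
  qed
  have A: "A \<noteq> {}" using unit_mem by blast
  obtain l w where w: "\<And>i. i \<in> A \<Longrightarrow> 0 < w i" "\<And>i. i \<in> A \<Longrightarrow> (\<Sum>j\<in>A. W i j * w j) = l * w i"
    using positive_matrix_has_positive_eigenvector[where W = W, OF finite_A A W] by blast
  have "\<exists>t. \<forall>c\<in>A. (\<Sum>b\<in>A. real (N a b c) * w b) = t * w c" if a: "a \<in> A" for a
  proof -
    have "(\<Sum>j\<in>A. W i j * (\<Sum>b\<in>A. real (N a b j) * w b)) = l * (\<Sum>b\<in>A. real (N a b i) * w b)"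
      if i: "i \<in> A" for i
    proof -
      \<comment> \<open>Left multiplication by \<open>a\<close> commutes with \<open>W\<close>, by associativity.\<close>
      have com: "(\<Sum>j\<in>A. W i j * real (N a b j)) = (\<Sum>y\<in>A. real (N a y i) * W y b)" if "b \<in> A" for b
      proof -
        have "(\<Sum>j\<in>A. W i j * real (N a b j)) = (\<Sum>k\<in>A. \<Sum>j\<in>A. real (N a b j) * real (N j k i))"
          unfolding W_def by (subst sum.swap) (simp add: sum_distrib_left sum_distrib_right ac_simps)
        also have "\<dots> = (\<Sum>k\<in>A. \<Sum>y\<in>A. real (N a y i) * real (N b k y))"
          by (rule sum.cong[OF refl], rule rassoc) (use a i that in auto)
        also have "\<dots> = (\<Sum>y\<in>A. real (N a y i) * W y b)"
          unfolding W_def by (subst sum.swap) (simp add: sum_distrib_left)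
        finally show ?thesis .
      qed
      have "(\<Sum>j\<in>A. W i j * (\<Sum>b\<in>A. real (N a b j) * w b))
          = (\<Sum>b\<in>A. (\<Sum>j\<in>A. W i j * real (N a b j)) * w b)"
        by (simp add: sum_distrib_left sum_distrib_right mult.assoc) (rule sum.swap)
      also have "\<dots> = (\<Sum>b\<in>A. (\<Sum>y\<in>A. real (N a y i) * W y b) * w b)"
        using com by (intro sum.cong) auto
      also have "\<dots> = (\<Sum>y\<in>A. real (N a y i) * (\<Sum>b\<in>A. W y b * w b))"
        by (simp add: sum_distrib_left sum_distrib_right mult.assoc) (rule sum.swap)
      also have "\<dots> = (\<Sum>y\<in>A. real (N a y i) * (l * w y))"
        using w(2) by (intro sum.cong) auto
      also have "\<dots> = l * (\<Sum>b\<in>A. real (N a b i) * w b)"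
        by (simp add: sum_distrib_left ac_simps)
      finally show ?thesis .
    qed
    from positive_matrix_eigenvector_unique[where W = W and w = w, OF finite_A A W w this]
    show ?thesis by blast
  qed
  then obtain d where d: "\<And>a c. \<lbrakk>a \<in> A; c \<in> A\<rbrakk> \<Longrightarrow> (\<Sum>b\<in>A. real (N a b c) * w b) = d a * w c"
    by metis
  have d_pos: "0 < d a" if a: "a \<in> A" for a
  proof -
    have "0 < (\<Sum>b\<in>A. real (N a b e) * w b)"
      using a dual_mem dual_pairing finite_A w(1)
      by (intro sum_pos2[of A "s a"]) (auto simp: less_imp_le)
    then show ?thesis using d[OF a unit_mem] w(1)[OF unit_mem] by (simp add: zero_less_mult_iff)
  qed
  have mult: "(\<Sum>c\<in>A. real (N a b c) * d c) = d a * d b" if a: "a \<in> A" and b: "b \<in> A" for a b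
  proof -
    have "(\<Sum>c\<in>A. real (N a b c) * d c) * w e = (\<Sum>c\<in>A. real (N a b c) * (\<Sum>j\<in>A. real (N c j e) * w j))"
      using d unit_mem by (simp add: sum_distrib_right mult.assoc)
    also have "\<dots> = (\<Sum>j\<in>A. (\<Sum>c\<in>A. real (N a b c) * real (N c j e)) * w j)"
      by (simp add: sum_distrib_left sum_distrib_right mult.assoc) (rule sum.swap)
    also have "\<dots> = (\<Sum>j\<in>A. (\<Sum>y\<in>A. real (N a y e) * real (N b j y)) * w j)"
      using rassoc a b unit_mem by (intro sum.cong) auto
    also have "\<dots> = (\<Sum>y\<in>A. real (N a y e) * (\<Sum>j\<in>A. real (N b j y) * w j))"
      by (simp add: sum_distrib_left sum_distrib_right mult.assoc) (rule sum.swap)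
    also have "\<dots> = (\<Sum>y\<in>A. real (N a y e) * (d b * w y))"
      using d b by (intro sum.cong) auto
    also have "\<dots> = d b * (\<Sum>y\<in>A. real (N a y e) * w y)"
      by (simp add: sum_distrib_left ac_simps)
    also have "\<dots> = d a * d b * w e" using d[OF a unit_mem] by simp
    finally show ?thesis using w(1)[OF unit_mem] by simp
  qed
  have dual: "d (s a) = d a" if a: "a \<in> A" for a
  proof -
    \<comment> \<open>Both ends are the quadratic form of left multiplication by \<open>a\<close> at \<open>w\<close>.\<close>
    have "d a * (\<Sum>c\<in>A. w c * w c) = (\<Sum>c\<in>A. (\<Sum>b\<in>A. real (N a b c) * w b) * w c)"
      using d a by (simp add: sum_distrib_left mult.assoc)
    also have "\<dots> = (\<Sum>b\<in>A. \<Sum>c\<in>A. real (N a b c) * w b * w c)"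
      unfolding sum_distrib_right by (rule sum.swap)
    also have "\<dots> = (\<Sum>b\<in>A. (\<Sum>c\<in>A. real (N a b c) * w c) * w b)"
      unfolding sum_distrib_right by (simp only: mult.assoc mult.commute[of "w _" "w _"])
    also have "\<dots> = (\<Sum>b\<in>A. (\<Sum>c\<in>A. real (N (s a) c b) * w c) * w b)"
      using dual_eq a by (intro sum.cong arg_cong2[of _ _ _ _ "(*)"]) auto
    also have "\<dots> = d (s a) * (\<Sum>c\<in>A. w c * w c)"
      using d[OF dual_mem[OF a]] by (simp add: sum_distrib_left mult.assoc)
    finally show ?thesis
      using sum_pos[of A "\<lambda>c. w c * w c"] finite_A A w(1) by auto
  qed
  have "(\<Sum>b\<in>A. real (N a b c) * d b) = d a * d c" if a: "a \<in> A" and c: "c \<in> A" for a c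
    using mult[OF dual_mem[OF a] c] dual_eq[OF a c] dual[OF a] by simp
  with that d_pos mult dual show thesis by blast
qed

end

text \<open>The probability map is \<open>N\<close> rescaled by the character \<open>d\<close>. In each axiom the factors of \<open>d\<close> either cancel
  or agree on both sides, which leaves an identity for \<open>N\<close>; that the probabilities add up to \<open>1\<close> is the
  multiplicativity of \<open>d\<close>.\<close>

theorem (in fusion_rule) probability_structure_of_character:
  fixes d :: "'a \<Rightarrow> real"
  assumes pos: "\<And>a. a \<in> A \<Longrightarrow> 0 < d a"
    and mult: "\<And>a b. \<lbrakk>a \<in> A; b \<in> A\<rbrakk> \<Longrightarrow> (\<Sum>c\<in>A. real (N a b c) * d c) = d a * d b"
    and dual: "\<And>a. a \<in> A \<Longrightarrow> d (s a) = d a"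
  shows "probability_structure A (\<lambda>a b c. real (N a b c) * d c / (d a * d b)) e s"
proof -
  define p where "p a b c = real (N a b c) * d c / (d a * d b)" for a b c
  have nz: "d a \<noteq> 0" if "a \<in> A" for a using pos[OF that] by simp
  have de: "d e = 1"
  proof -
    have "d e * d e = (\<Sum>c\<in>A. real (N e e c) * d c)"
      by (rule mult[OF unit_mem unit_mem, symmetric])
    also have "\<dots> = (\<Sum>c\<in>A. if e = c then d c else 0)"
      by (rule sum.cong[OF refl]) (simp add: unit_left[OF unit_mem])
    also have "\<dots> = d e" using finite_A unit_mem by simp
    finally show ?thesis using nz[OF unit_mem] by simp
  qed
  have supp: "(\<Sum>c\<in>{c \<in> A. p a b c \<noteq> 0}. p a b c * f c) = (\<Sum>c\<in>A. p a b c * f c)" for a b f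
    using finite_A by (intro sum.mono_neutral_left) auto
  have p_sum: "(\<Sum>c\<in>A. p a b c) = 1" if "a \<in> A" "b \<in> A" for a b
    using mult[OF that] nz that by (simp add: p_def flip: sum_divide_distrib)
  have p_assoc: "(\<Sum>x\<in>A. p a b x * p x c f) = (\<Sum>y\<in>A. p b c y * p a y f)"
    if "a \<in> A" "b \<in> A" "c \<in> A" "f \<in> A" for a b c f
  proof -
    have "(\<Sum>x\<in>A. p a b x * p x c f)
        = (\<Sum>x\<in>A. real (N a b x * N x c f) * (d f / (d a * d b * d c)))"
      using nz that by (intro sum.cong) (auto simp: p_def)
    also have "\<dots> = real (\<Sum>x\<in>A. N a b x * N x c f) * (d f / (d a * d b * d c))"
      by (simp only: of_nat_sum sum_distrib_right)
    also have "\<dots> = real (\<Sum>y\<in>A. N a y f * N b c y) * (d f / (d a * d b * d c))"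
      by (simp only: assoc[OF that])
    also have "\<dots> = (\<Sum>y\<in>A. real (N a y f * N b c y) * (d f / (d a * d b * d c)))"
      by (simp only: of_nat_sum sum_distrib_right)
    also have "\<dots> = (\<Sum>y\<in>A. p b c y * p a y f)"
      using nz that by (intro sum.cong) (auto simp: p_def ac_simps)
    finally show ?thesis .
  qed
  have "probability_structure A p e s"
  proof
    fix a b c f assume abcf: "a \<in> A" "b \<in> A" "c \<in> A" "f \<in> A"
    show "(\<Sum>x \<in> {x \<in> A. p a b x \<noteq> 0}. p a b x * p x c f) =
        (\<Sum>y \<in> {y \<in> A. p b c y \<noteq> 0}. p a y f * p b c y)"
      using supp[of a b "\<lambda>x. p x c f"] supp[of b c "\<lambda>y. p a y f"] p_assoc[OF abcf]
      by (simp add: mult.commute)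
  next
    fix a b assume ab: "a \<in> A" "b \<in> A"
    show "(\<Sum>c \<in> {c \<in> A. p a b c \<noteq> 0}. p a b c) = 1"
      using supp[of a b "\<lambda>_. 1"] p_sum[OF ab] by simp
    show "b = s a" if "0 < p a b e"
      using that dual_pairing[OF ab] by (auto simp: p_def split: if_splits)
  next
    fix a b c assume abc: "a \<in> A" "b \<in> A" "c \<in> A"
    show "0 \<le> p a b c" using abc pos by (simp add: p_def less_imp_le)
    show "p a b c = p (s b) (s a) (s c)"
      using abc dual dual_anti[OF abc] by (simp add: p_def mult.commute)
  next
    fix a assume a: "a \<in> A"
    show "p a (s a) e = p (s a) a e"
      using a dual dual_mem dual_pairing dual_dual by (simp add: p_def unit_mem)
    show "0 < p a (s a) e"
      using a dual_mem dual_pairing pos by (simp add: p_def unit_mem)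
    show "p e a a = 1" "p a e a = 1"
      using a unit_left unit_right nz by (simp_all add: p_def de)
  qed (use finite_A unit_mem dual_mem in auto)
  moreover have "p = (\<lambda>a b c. real (N a b c) * d c / (d a * d b))" by (intro ext) (simp add: p_def)
  ultimately show ?thesis by simp
qed

section \<open>Dimension counts\<close>

lemma linear_mapI:
  assumes "vectorspace K V" "vectorspace K W"
    and "\<And>v. v \<in> carrier V \<Longrightarrow> T v \<in> carrier W"
    and "\<And>v w. \<lbrakk>v \<in> carrier V; w \<in> carrier V\<rbrakk> \<Longrightarrow> T (v \<oplus>\<^bsub>V\<^esub> w) = T v \<oplus>\<^bsub>W\<^esub> T w"
    and "\<And>c v. \<lbrakk>c \<in> carrier K; v \<in> carrier V\<rbrakk> \<Longrightarrow> T (c \<odot>\<^bsub>V\<^esub> v) = c \<odot>\<^bsub>W\<^esub> T v"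
  shows "linear_map K V W T"
proof -
  have "T \<in> LinearCombinations.module_hom K V W"
    unfolding LinearCombinations.module_hom_def using assms(3-5) by blast
  then show ?thesis using assms(1,2)
    by (intro linear_map.intro mod_hom.intro mod_hom_axioms.intro) (auto simp: vectorspace_def)
qed

lemma (in linear_map) inj_onI_kernel:
  assumes "\<And>v. \<lbrakk>v \<in> carrier V; T v = \<zero>\<^bsub>W\<^esub>\<rbrakk> \<Longrightarrow> v = \<zero>\<^bsub>V\<^esub>"
  shows "inj_on T (carrier V)"
proof (rule inj_onI)
  fix v w assume vw: "v \<in> carrier V" "w \<in> carrier V" "T v = T w"
  then have "T (v \<ominus>\<^bsub>V\<^esub> w) = \<zero>\<^bsub>W\<^esub>" by (simp add: W.module.M.minus_other_side)
  then have "v \<ominus>\<^bsub>V\<^esub> w = \<zero>\<^bsub>V\<^esub>" using vw assms[of "v \<ominus>\<^bsub>V\<^esub> w"] by simp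
  then show "v = w" using vw by simp
qed

text \<open>An injective linear map sends a basis to a linearly independent set.\<close>

lemma (in linear_map) inj_dim_le:
  assumes V: "V.fin_dim" and W: "W.fin_dim" and inj: "inj_on T (carrier V)"
  shows "V.dim \<le> W.dim"
proof -
  obtain B where B: "finite B" "V.basis B" using V.finite_basis_exists[OF V] by blast
  then have BV: "B \<subseteq> carrier V" and li: "V.module.lin_indpt B" by (auto simp: V.basis_def)
  have "W.module.lin_indpt (T ` B)"
  proof (rule W.module.finite_lin_indpt2)
    fix a assume a: "a \<in> T ` B \<rightarrow> carrier K" and z: "W.module.lincomb a (T ` B) = \<zero>\<^bsub>W\<^esub>"
    have aT: "a \<circ> T \<in> B \<rightarrow> carrier K" using a by auto
    then have "V.module.lincomb (a \<circ> T) B \<in> carrier V" using BV by (intro V.module.lincomb_closed)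
    moreover have "T (V.module.lincomb (a \<circ> T) B) = T \<zero>\<^bsub>V\<^esub>"
      using z lincomb_linear_image[OF inj BV a B(1)] by simp
    ultimately have "V.module.lincomb (a \<circ> T) B = \<zero>\<^bsub>V\<^esub>"
      using inj_onD[OF inj] V.module.M.zero_closed by blast
    from V.not_lindepD[OF li B(1) order.refl aT this]
    show "\<forall>v\<in>T ` B. a v = \<zero>\<^bsub>K\<^esub>" by auto
  qed (use B BV in auto)
  then have "card (T ` B) \<le> W.dim" using W BV by (intro W.li_le_dim) auto
  moreover have "card (T ` B) = V.dim"
    using B inj_on_subset[OF inj BV] by (simp add: card_image V.dim_basis)
  ultimately show ?thesis by simp
qed

text \<open>The functionals \<open>c i\<close> are the coordinates of a linear map from \<open>V\<close> to the coordinate space indexed by \<open>J\<close>.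
  It is injective because they separate points, and onto because its image is a subspace
  that contains all unit vectors.\<close>

lemma dim_eq_card_dual_basis:
  fixes V :: "('k :: field, 'v, 'r) module_scheme"
  assumes V: "vectorspace class_ring V" and fd: "vectorspace.fin_dim class_ring V"
    and J: "finite J"
    and add: "\<And>i v w. \<lbrakk>i \<in> J; v \<in> carrier V; w \<in> carrier V\<rbrakk> \<Longrightarrow> c i (v \<oplus>\<^bsub>V\<^esub> w) = c i v + c i w"
    and smult: "\<And>i a v. \<lbrakk>i \<in> J; v \<in> carrier V\<rbrakk> \<Longrightarrow> c i (a \<odot>\<^bsub>V\<^esub> v) = a * c i v"
    and sep: "\<And>v. \<lbrakk>v \<in> carrier V; \<And>i. i \<in> J \<Longrightarrow> c i v = 0\<rbrakk> \<Longrightarrow> v = \<zero>\<^bsub>V\<^esub>"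
    and b: "\<And>i. i \<in> J \<Longrightarrow> b i \<in> carrier V"
    and dual: "\<And>i j. \<lbrakk>i \<in> J; j \<in> J\<rbrakk> \<Longrightarrow> c i (b j) = (if i = j then 1 else 0)"
  shows "vectorspace.dim class_ring V = card J"
proof -
  define n where "n = card J"
  obtain h where h: "bij_betw h {..<n} J"
    using ex_bij_betw_nat_finite[OF J] by (auto simp: n_def atLeast0LessThan)
  then have hJ: "h i \<in> J" if "i < n" for i using that by (auto simp: bij_betw_def)
  interpret k: vec_space "TYPE('k)" n .
  define T where "T v = vec n (\<lambda>i. c (h i) v)" for v
  interpret linear_map class_ring V "module_vec TYPE('k) n" T
    using V k.vectorspace_axioms
    by (rule linear_mapI) (auto simp: T_def module_vec_simps add smult hJ)
  have inj: "inj_on T (carrier V)"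
  proof (rule inj_onI_kernel)
    fix v assume v: "v \<in> carrier V" "T v = \<zero>\<^bsub>module_vec TYPE('k) n\<^esub>"
    have "c i v = 0" if i: "i \<in> J" for i
    proof -
      obtain m where m: "m < n" "i = h m" using h i by (auto simp: bij_betw_def)
      have "T v $ m = 0" using v(2) m by (simp add: module_vec_simps)
      then show ?thesis using m by (simp add: T_def)
    qed
    with v(1) show "v = \<zero>\<^bsub>V\<^esub>" by (rule sep)
  qed
  have sub: "submodule class_ring im (module_vec TYPE('k) n)" by (rule im_is_submodule)
  have "unit_vec n i \<in> im" if "i < n" for i
  proof -
    have "T (b (h i)) = unit_vec n i"
      using that hJ h by (intro eq_vecI) (auto simp: T_def dual bij_betw_def inj_on_def)
    then show ?thesis using b hJ that unfolding im_def by (metis imageI)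
  qed
  then have "set (unit_vecs n) \<subseteq> im" by (auto simp: unit_vecs_def)
  with sub have "k.span (set (unit_vecs n)) \<subseteq> im"
    by (intro k.span_is_subset) simp_all
  then have "T ` carrier V = carrier (module_vec TYPE('k) n)"
    using im_is_submodule unfolding im_def[symmetric] submodule_def
    by (auto simp: k.span_unit_vecs_is_carrier module_vec_simps)
  with fd inj have "V.dim = k.dim" by (intro dim_eq)
  then show ?thesis using k.dim_is_n unfolding n_def by metis
qed

section \<open>Isomorphisms and composition in a category\<close>

context category
begin

lemma Hom_iff: "f \<in> Hom C X Y \<longleftrightarrow> f \<in> Arr C \<and> Dom C f = X \<and> Cod C f = Y"
  by (auto simp: Hom_def)

lemma Hom_obj: "f \<in> Hom C X Y \<Longrightarrow> X \<in> Obj C" "f \<in> Hom C X Y \<Longrightarrow> Y \<in> Obj C"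
  using dom_obj cod_obj by (auto simp: Hom_def)

text \<open>Composability is expressed below by equations between \<open>Dom\<close> and \<open>Cod\<close>. Unlike membership in \<open>Hom\<close>, such
  premises contain no objects that would have to be guessed, so that the simplifier can bring
  composites into right-associated form on its own.\<close>

lemma ident_arr [simp]:
  assumes "X \<in> Obj C"
  shows "Ident C X \<in> Arr C" "Dom C (Ident C X) = X" "Cod C (Ident C X) = X"
  using ident_hom[OF assms] by (auto simp: Hom_iff)

lemma comp_arr [simp]:
  assumes "f \<in> Arr C" "g \<in> Arr C" "Dom C g = Cod C f"
  shows "g \<cdot> f \<in> Arr C" "Dom C (g \<cdot> f) = Dom C f" "Cod C (g \<cdot> f) = Cod C g"
  using comp_hom[of f "Dom C f" "Cod C f" g "Cod C g"] assms by (auto simp: Hom_iff)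

lemma comp_assoc_arr [simp]:
  assumes "f \<in> Arr C" "g \<in> Arr C" "h \<in> Arr C" "Dom C g = Cod C f" "Dom C h = Cod C g"
  shows "(h \<cdot> g) \<cdot> f = h \<cdot> g \<cdot> f"
  using comp_assoc[of f "Dom C f" "Cod C f" g "Cod C g" h "Cod C h"] assms by (auto simp: Hom_iff)

lemma comp_ident_arr [simp]: "\<lbrakk>f \<in> Arr C; Dom C f = X\<rbrakk> \<Longrightarrow> f \<cdot> Ident C X = f"
  and ident_comp_arr [simp]: "\<lbrakk>f \<in> Arr C; Cod C f = X\<rbrakk> \<Longrightarrow> Ident C X \<cdot> f = f"
  using comp_ident[of f "Dom C f" "Cod C f"] ident_comp[of f "Dom C f" "Cod C f"]
  by (auto simp: Hom_iff)

lemma arr_obj [simp]: "f \<in> Arr C \<Longrightarrow> Dom C f \<in> Obj C" "f \<in> Arr C \<Longrightarrow> Cod C f \<in> Obj C"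
  by (rule dom_obj cod_obj; assumption)+

lemma inverse_arrows_iff:
  assumes "f \<in> Hom C X Y"
  shows "inverse_arrows C f g \<longleftrightarrow> g \<in> Hom C Y X \<and> g \<cdot> f = Ident C X \<and> f \<cdot> g = Ident C Y"
  using assms by (auto simp: inverse_arrows_def Hom_iff)

lemma inverse_arrows_unique:
  assumes "inverse_arrows C f g" "inverse_arrows C f h"
  shows "g = h"
proof -
  have f: "f \<in> Hom C (Dom C f) (Cod C f)" using assms by (auto simp: inverse_arrows_def Hom_iff)
  from assms have g: "g \<in> Hom C (Cod C f) (Dom C f)" "g \<cdot> f = Ident C (Dom C f)"
    and h: "h \<in> Hom C (Cod C f) (Dom C f)" "f \<cdot> h = Ident C (Cod C f)"
    by (auto simp: inverse_arrows_iff[OF f])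
  have "g = g \<cdot> f \<cdot> h" using g(1) h by (simp add: Hom_iff)
  also have "\<dots> = (g \<cdot> f) \<cdot> h" using f g(1) h(1) by (simp add: Hom_iff)
  also have "\<dots> = h" using g h(1) by (simp add: Hom_iff)
  finally show ?thesis .
qed

lemma inv_arrow:
  assumes "iso_arrow C f" "f \<in> Hom C X Y"
  shows "inv_arrow C f \<in> Hom C Y X" "inv_arrow C f \<cdot> f = Ident C X" "f \<cdot> inv_arrow C f = Ident C Y"
proof -
  obtain g where g: "inverse_arrows C f g" using assms by (auto simp: iso_arrow_def)
  then have "inv_arrow C f = g"
    unfolding inv_arrow_def by (auto intro: inverse_arrows_unique)
  with g show "inv_arrow C f \<in> Hom C Y X" "inv_arrow C f \<cdot> f = Ident C X"
    "f \<cdot> inv_arrow C f = Ident C Y"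
    by (auto simp: inverse_arrows_iff[OF assms(2)])
qed

lemma iso_arrowI:
  assumes "f \<in> Hom C X Y" "g \<in> Hom C Y X" "g \<cdot> f = Ident C X" "f \<cdot> g = Ident C Y"
  shows "iso_arrow C f"
  using assms inverse_arrows_iff[OF assms(1)] by (auto simp: iso_arrow_def)

lemma isomorphicE:
  assumes "isomorphic C X Y"
  obtains f g where "f \<in> Hom C X Y" "g \<in> Hom C Y X" "g \<cdot> f = Ident C X" "f \<cdot> g = Ident C Y"
  using assms inv_arrow unfolding isomorphic_def by blast

lemma isomorphicI:
  assumes "f \<in> Hom C X Y" "g \<in> Hom C Y X" "g \<cdot> f = Ident C X" "f \<cdot> g = Ident C Y"
  shows "isomorphic C X Y"
  using assms iso_arrowI unfolding isomorphic_def by blast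

lemma isomorphic_sym: "isomorphic C X Y \<Longrightarrow> isomorphic C Y X"
  by (elim isomorphicE) (rule isomorphicI)

lemma isomorphic_trans:
  assumes "isomorphic C X Y" "isomorphic C Y Z"
  shows "isomorphic C X Z"
proof -
  obtain f g where fg: "f \<in> Hom C X Y" "g \<in> Hom C Y X" "g \<cdot> f = Ident C X" "f \<cdot> g = Ident C Y"
    using assms(1) by (rule isomorphicE)
  obtain h k where hk: "h \<in> Hom C Y Z" "k \<in> Hom C Z Y" "k \<cdot> h = Ident C Y" "h \<cdot> k = Ident C Z"
    using assms(2) by (rule isomorphicE)
  have "(g \<cdot> k) \<cdot> h \<cdot> f = g \<cdot> (k \<cdot> h) \<cdot> f" "(h \<cdot> f) \<cdot> g \<cdot> k = h \<cdot> (f \<cdot> g) \<cdot> k"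
    using fg(1,2) hk(1,2) by (auto simp: Hom_iff)
  then have "(g \<cdot> k) \<cdot> h \<cdot> f = Ident C X" "(h \<cdot> f) \<cdot> g \<cdot> k = Ident C Z"
    using fg hk by (auto simp: Hom_iff)
  then show ?thesis using fg(1,2) hk(1,2) comp_hom by (intro isomorphicI[of "h \<cdot> f" _ _ "g \<cdot> k"])
qed

lemma isomorphic_refl: "X \<in> Obj C \<Longrightarrow> isomorphic C X X"
  using ident_hom by (auto intro!: isomorphicI)

end

section \<open>Linear categories\<close>

context linear_category
begin

lemma hom_zero: "\<lbrakk>X \<in> Obj C; Y \<in> Obj C\<rbrakk> \<Longrightarrow> zero_arrow C X Y \<in> Hom C X Y"
  and hom_add: "\<lbrakk>f \<in> Hom C X Y; g \<in> Hom C X Y\<rbrakk> \<Longrightarrow> f \<oplus>\<^bsub>hom_space C X Y\<^esub> g \<in> Hom C X Y"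
  and hom_smult: "f \<in> Hom C X Y \<Longrightarrow> c \<odot>\<^bsub>hom_space C X Y\<^esub> f \<in> Hom C X Y"
proof -
  show "zero_arrow C X Y \<in> Hom C X Y" if XY: "X \<in> Obj C" "Y \<in> Obj C"
  proof -
    interpret vectorspace class_ring "hom_space C X Y" by (rule hom_vectorspace[OF XY])
    show ?thesis using hom_carrier[OF XY] M.zero_closed by simp
  qed
  show "f \<oplus>\<^bsub>hom_space C X Y\<^esub> g \<in> Hom C X Y" if "f \<in> Hom C X Y" "g \<in> Hom C X Y"
  proof -
    note XY = Hom_obj[OF that(1)]
    interpret vectorspace class_ring "hom_space C X Y" by (rule hom_vectorspace[OF XY])
    show ?thesis using hom_carrier[OF XY] M.add.m_closed that by simp
  qed
  show "c \<odot>\<^bsub>hom_space C X Y\<^esub> f \<in> Hom C X Y" if "f \<in> Hom C X Y"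
  proof -
    note XY = Hom_obj[OF that(1)]
    interpret vectorspace class_ring "hom_space C X Y" by (rule hom_vectorspace[OF XY])
    show ?thesis using hom_carrier[OF XY] smult_closed that by (simp add: class_ring_simps)
  qed
qed

lemma hom_linear_mapI:
  assumes "X \<in> Obj C" "Y \<in> Obj C" "X' \<in> Obj C" "Y' \<in> Obj C"
    and "\<And>f. f \<in> Hom C X Y \<Longrightarrow> T f \<in> Hom C X' Y'"
    and "\<And>f g. \<lbrakk>f \<in> Hom C X Y; g \<in> Hom C X Y\<rbrakk> \<Longrightarrow>
      T (f \<oplus>\<^bsub>hom_space C X Y\<^esub> g) = T f \<oplus>\<^bsub>hom_space C X' Y'\<^esub> T g"
    and "\<And>c f. f \<in> Hom C X Y \<Longrightarrow> T (c \<odot>\<^bsub>hom_space C X Y\<^esub> f) = c \<odot>\<^bsub>hom_space C X' Y'\<^esub> T f"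
  shows "linear_map class_ring (hom_space C X Y) (hom_space C X' Y') T"
  by (rule linear_mapI) (use assms in \<open>auto simp: hom_carrier intro: hom_vectorspace\<close>)

lemma linear_post_comp:
  assumes "g \<in> Hom C Y Z" "X \<in> Obj C"
  shows "linear_map class_ring (hom_space C X Y) (hom_space C X Z) (\<lambda>f. g \<cdot> f)"
  using assms Hom_obj[OF assms(1)]
  by (intro hom_linear_mapI) (auto intro: comp_hom comp_add_right comp_smult_right)

lemma linear_pre_comp:
  assumes "f \<in> Hom C X Y" "Z \<in> Obj C"
  shows "linear_map class_ring (hom_space C Y Z) (hom_space C X Z) (\<lambda>g. g \<cdot> f)"
  using assms Hom_obj[OF assms(1)]
  by (intro hom_linear_mapI) (auto intro: comp_hom comp_add_left comp_smult_left)

lemma comp_zero_right: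
  assumes "g \<in> Hom C Y Z" "X \<in> Obj C"
  shows "g \<cdot> zero_arrow C X Y = zero_arrow C X Z"
proof -
  interpret linear_map class_ring "hom_space C X Y" "hom_space C X Z" "\<lambda>f. g \<cdot> f"
    by (rule linear_post_comp[OF assms])
  show ?thesis by (rule f0_is_0)
qed

lemma comp_zero_left:
  assumes "f \<in> Hom C X Y" "Z \<in> Obj C"
  shows "zero_arrow C Y Z \<cdot> f = zero_arrow C X Z"
proof -
  interpret linear_map class_ring "hom_space C Y Z" "hom_space C X Z" "\<lambda>g. g \<cdot> f"
    by (rule linear_pre_comp[OF assms])
  show ?thesis by (rule f0_is_0)
qed

lemma smult_zero_iff:
  assumes "f \<in> Hom C X Y"
  shows "c \<odot>\<^bsub>hom_space C X Y\<^esub> f = zero_arrow C X Y \<longleftrightarrow> c = 0 \<or> f = zero_arrow C X Y"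
proof -
  note XY = Hom_obj[OF assms(1)]
  interpret vectorspace class_ring "hom_space C X Y" by (rule hom_vectorspace[OF XY])
  have f: "f \<in> carrier (hom_space C X Y)" using assms hom_carrier[OF XY] by simp
  have "f = inverse c \<odot>\<^bsub>hom_space C X Y\<^esub> (c \<odot>\<^bsub>hom_space C X Y\<^esub> f)" if "c \<noteq> 0"
    using f that smult_assoc1[of "inverse c" c f] smult_one[OF f] by (simp add: class_ring_simps)
  then have "f = zero_arrow C X Y" if "c \<noteq> 0" "c \<odot>\<^bsub>hom_space C X Y\<^esub> f = zero_arrow C X Y"
    using that rmult_0[of "inverse c"] by (simp add: class_ring_simps)
  then show ?thesis
    using f lmult_0[of f] rmult_0[of c] by (auto simp: class_ring_simps)
qed

lemma zero_object_iff:
  "zero_object C Z \<longleftrightarrow> Z \<in> Obj C \<and> Ident C Z = zero_arrow C Z Z"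
proof
  assume "zero_object C Z"
  then have Z: "Z \<in> Obj C" and "\<exists>!f. f \<in> Hom C Z Z" unfolding zero_object_def by auto
  with ident_hom[OF Z] hom_zero[OF Z Z] show "Z \<in> Obj C \<and> Ident C Z = zero_arrow C Z Z" by blast
next
  assume *: "Z \<in> Obj C \<and> Ident C Z = zero_arrow C Z Z"
  have "f = zero_arrow C Z X" if "f \<in> Hom C Z X" for f X
    using comp_ident[OF that] comp_zero_right[OF that] * by simp
  moreover have "f = zero_arrow C X Z" if "f \<in> Hom C X Z" for f X
    using ident_comp[OF that] comp_zero_left[OF that] * by simp
  ultimately show "zero_object C Z"
    unfolding zero_object_def using * hom_zero by blast
qed

lemma mono_arrowI:
  assumes f: "f \<in> Hom C X Y"
    and ker: "\<And>W g. \<lbrakk>g \<in> Hom C W X; f \<cdot> g = zero_arrow C W Y\<rbrakk> \<Longrightarrow> g = zero_arrow C W X"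
  shows "mono_arrow C f"
  unfolding mono_arrow_def
proof (intro conjI allI ballI impI)
  fix W g h assume "g \<in> Hom C W (Dom C f)" "h \<in> Hom C W (Dom C f)" and eq: "f \<cdot> g = f \<cdot> h"
  then have gh: "g \<in> Hom C W X" "h \<in> Hom C W X" using f by (auto simp: Hom_iff)
  note W = Hom_obj[OF gh(1)]
  interpret linear_map class_ring "hom_space C W X" "hom_space C W Y" "\<lambda>g. f \<cdot> g"
    by (rule linear_post_comp[OF f W(1)])
  have "inj_on (\<lambda>g. f \<cdot> g) (carrier (hom_space C W X))"
    using ker hom_carrier[OF W] by (intro inj_onI_kernel) auto
  then show "g = h" using gh eq hom_carrier[OF W] by (auto dest: inj_onD)
qed (use f in \<open>auto simp: Hom_iff\<close>)

end

text \<open>The kernel of \<open>f\<close> is a monomorphism into \<open>S\<close>, so it is an isomorphism, in which case \<open>f\<close> vanishes, or its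
  domain is zero; in the latter case \<open>f\<close> is a monomorphism into the simple object \<open>T\<close>.\<close>

lemma (in abelian_linear_category) simple_hom_zero_or_iso:
  assumes S: "simple_object C S" and T: "simple_object C T" and f: "f \<in> Hom C S T"
  shows "f = zero_arrow C S T \<or> iso_arrow C f"
proof -
  obtain k where k: "kernel_arrow C f k" using ex_kernel f by (auto simp: Hom_iff)
  define K where "K = Dom C k"
  have kS: "k \<in> Hom C K S" and fk: "f \<cdot> k = zero_arrow C K T"
    and univ: "\<And>W h. \<lbrakk>h \<in> Hom C W S; f \<cdot> h = zero_arrow C W T\<rbrakk> \<Longrightarrow> \<exists>!u. u \<in> Hom C W K \<and> k \<cdot> u = h"
    using k f unfolding kernel_arrow_def K_def by (auto simp: Hom_iff)
  note K = Hom_obj(1)[OF kS]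
  have "mono_arrow C k"
  proof (rule mono_arrowI[OF kS])
    fix W g assume g: "g \<in> Hom C W K" "k \<cdot> g = zero_arrow C W S"
    note W = Hom_obj(1)[OF g(1)]
    have "f \<cdot> zero_arrow C W S = zero_arrow C W T" by (rule comp_zero_right[OF f W])
    from univ[OF hom_zero[OF W Hom_obj(1)[OF f]] this] g hom_zero[OF W K] comp_zero_right[OF kS W]
    show "g = zero_arrow C W K" by blast
  qed
  then consider "iso_arrow C k" | "zero_object C K"
    using S kS unfolding simple_object_def by blast
  then show ?thesis
  proof cases
    case 1
    note i = inv_arrow[OF this kS]
    have "f = (f \<cdot> k) \<cdot> inv_arrow C k" using f kS i by (simp add: Hom_iff)
    also have "\<dots> = zero_arrow C S T" using fk comp_zero_left[OF i(1)] Hom_obj[OF f] by simp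
    finally show ?thesis by blast
  next
    case 2
    have "mono_arrow C f"
    proof (rule mono_arrowI[OF f])
      fix W g assume g: "g \<in> Hom C W S" "f \<cdot> g = zero_arrow C W T"
      then obtain u where u: "u \<in> Hom C W K" "k \<cdot> u = g" using univ by blast
      have "u = zero_arrow C W K"
        using ident_comp[OF u(1)] 2 comp_zero_left[OF u(1) K] by (simp add: zero_object_iff)
      then show "g = zero_arrow C W S" using u comp_zero_right[OF kS Hom_obj(1)[OF u(1)]] by simp
    qed
    then show ?thesis using S T f unfolding simple_object_def by blast
  qed
qed

section \<open>Associators and transposition along a dual pair\<close>

text \<open>Rewriting with an equation between composites inside a right-associated composite.\<close>

lemma (in category) comp_eq_tail:
  assumes "g \<cdot> f = h \<cdot> k" "f \<in> Arr C" "g \<in> Arr C" "h \<in> Arr C" "k \<in> Arr C" "w \<in> Arr C"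
    and "Dom C g = Cod C f" "Dom C h = Cod C k" "Cod C w = Dom C f" "Dom C k = Dom C f"
  shows "g \<cdot> f \<cdot> w = h \<cdot> k \<cdot> w"
proof -
  have "g \<cdot> f \<cdot> w = (g \<cdot> f) \<cdot> w" using assms(2-) by simp
  also have "\<dots> = h \<cdot> k \<cdot> w" using assms(2-) by (simp add: assms(1))
  finally show ?thesis .
qed

context monoidal_category
begin

lemma tensor_obj_simp [simp]: "\<lbrakk>X \<in> Obj C; Y \<in> Obj C\<rbrakk> \<Longrightarrow> X \<otimes>\<^sub>o Y \<in> Obj C"
  by (rule tensor_obj)

lemma unit_obj_simp [simp]: "unit_obj C \<in> Obj C"
  by (rule unit_obj)

lemma tensor_arr_simps [simp]:
  assumes "f \<in> Arr C" "g \<in> Arr C"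
  shows "f \<otimes>\<^sub>a g \<in> Arr C" "Dom C (f \<otimes>\<^sub>a g) = Dom C f \<otimes>\<^sub>o Dom C g"
    "Cod C (f \<otimes>\<^sub>a g) = Cod C f \<otimes>\<^sub>o Cod C g"
  using tensor_arr[of f "Dom C f" "Cod C f" g "Dom C g" "Cod C g"] assms by (auto simp: Hom_iff)

lemma tensor_comp_arr:
  assumes "f \<in> Arr C" "g \<in> Arr C" "f' \<in> Arr C" "g' \<in> Arr C" "Dom C g = Cod C f" "Dom C g' = Cod C f'"
  shows "(g \<otimes>\<^sub>a g') \<cdot> (f \<otimes>\<^sub>a f') = (g \<cdot> f) \<otimes>\<^sub>a (g' \<cdot> f')"
  using assms
  by (intro tensor_comp[symmetric, of _ "Dom C f" "Cod C f" _ "Cod C g" _ "Dom C f'" "Cod C f'" _ "Cod C g'"])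
    (auto simp: Hom_iff)

abbreviation inv_associator :: "'o \<Rightarrow> 'o \<Rightarrow> 'o \<Rightarrow> 'm" where
  "inv_associator X Y Z \<equiv> inv_arrow C (associator C X Y Z)"

lemma associator_simps [simp]:
  assumes "X \<in> Obj C" "Y \<in> Obj C" "Z \<in> Obj C"
  shows "associator C X Y Z \<in> Arr C"
    "Dom C (associator C X Y Z) = (X \<otimes>\<^sub>o Y) \<otimes>\<^sub>o Z"
    "Cod C (associator C X Y Z) = X \<otimes>\<^sub>o (Y \<otimes>\<^sub>o Z)"
    "inv_associator X Y Z \<in> Arr C"
    "Cod C (inv_associator X Y Z) = (X \<otimes>\<^sub>o Y) \<otimes>\<^sub>o Z"
    "Dom C (inv_associator X Y Z) = X \<otimes>\<^sub>o (Y \<otimes>\<^sub>o Z)"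
    "inv_associator X Y Z \<cdot> associator C X Y Z = Ident C ((X \<otimes>\<^sub>o Y) \<otimes>\<^sub>o Z)"
    "associator C X Y Z \<cdot> inv_associator X Y Z = Ident C (X \<otimes>\<^sub>o (Y \<otimes>\<^sub>o Z))"
  using associator_hom[OF assms] inv_arrow[OF associator_iso[OF assms] associator_hom[OF assms]]
  by (auto simp: Hom_iff)

lemma unitor_simps [simp]:
  assumes "X \<in> Obj C"
  shows "lunitor C X \<in> Arr C" "Dom C (lunitor C X) = unit_obj C \<otimes>\<^sub>o X" "Cod C (lunitor C X) = X"
    "runitor C X \<in> Arr C" "Dom C (runitor C X) = X \<otimes>\<^sub>o unit_obj C" "Cod C (runitor C X) = X"
  using lunitor_hom[OF assms] runitor_hom[OF assms] by (auto simp: Hom_iff)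

lemma inv_associator_natural:
  assumes f: "f \<in> Hom C X X'" and g: "g \<in> Hom C Y Y'" and h: "h \<in> Hom C Z Z'"
  shows "inv_associator X' Y' Z' \<cdot> (f \<otimes>\<^sub>a (g \<otimes>\<^sub>a h)) = ((f \<otimes>\<^sub>a g) \<otimes>\<^sub>a h) \<cdot> inv_associator X Y Z"
proof -
  note O [simp] = Hom_obj[OF f] Hom_obj[OF g] Hom_obj[OF h]
  note A [simp] = f[unfolded Hom_iff] g[unfolded Hom_iff] h[unfolded Hom_iff]
  have "inv_associator X' Y' Z' \<cdot> (f \<otimes>\<^sub>a (g \<otimes>\<^sub>a h))
      = inv_associator X' Y' Z' \<cdot> ((f \<otimes>\<^sub>a (g \<otimes>\<^sub>a h)) \<cdot> associator C X Y Z) \<cdot> inv_associator X Y Z"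
    by simp
  also have "\<dots> = inv_associator X' Y' Z' \<cdot> (associator C X' Y' Z' \<cdot> ((f \<otimes>\<^sub>a g) \<otimes>\<^sub>a h)) \<cdot> inv_associator X Y Z"
    by (simp only: associator_natural[OF f g h])
  also have "\<dots> = (inv_associator X' Y' Z' \<cdot> associator C X' Y' Z') \<cdot> ((f \<otimes>\<^sub>a g) \<otimes>\<^sub>a h) \<cdot> inv_associator X Y Z"
    by (simp del: associator_simps(7,8))
  also have "\<dots> = ((f \<otimes>\<^sub>a g) \<otimes>\<^sub>a h) \<cdot> inv_associator X Y Z" by simp
  finally show ?thesis .
qed

lemma pentagon_inv:
  assumes [simp]: "W \<in> Obj C" "X \<in> Obj C" "Y \<in> Obj C" "Z \<in> Obj C"
  shows "inv_associator W X (Y \<otimes>\<^sub>o Z) \<cdot> (Ident C W \<otimes>\<^sub>a associator C X Y Z)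
    = associator C (W \<otimes>\<^sub>o X) Y Z \<cdot> (inv_associator W X Y \<otimes>\<^sub>a Ident C Z) \<cdot> inv_associator W (X \<otimes>\<^sub>o Y) Z"
proof -
  let ?l = "inv_associator W X (Y \<otimes>\<^sub>o Z)" and ?m = "Ident C W \<otimes>\<^sub>a associator C X Y Z"
  let ?a = "associator C W (X \<otimes>\<^sub>o Y) Z" and ?a' = "inv_associator W (X \<otimes>\<^sub>o Y) Z"
  let ?b = "associator C W X Y \<otimes>\<^sub>a Ident C Z" and ?b' = "inv_associator W X Y \<otimes>\<^sub>a Ident C Z"
  have bb: "?b \<cdot> ?b' = Ident C ((W \<otimes>\<^sub>o X \<otimes>\<^sub>o Y) \<otimes>\<^sub>o Z)"
    by (simp add: tensor_comp_arr tensor_ident)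
  have "?a \<cdot> ?b \<cdot> ?b' \<cdot> ?a' = ?a \<cdot> (?b \<cdot> ?b') \<cdot> ?a'" by simp
  also have "\<dots> = Ident C (W \<otimes>\<^sub>o (X \<otimes>\<^sub>o Y) \<otimes>\<^sub>o Z)" by (simp add: bb)
  finally have ab: "?a \<cdot> ?b \<cdot> ?b' \<cdot> ?a' = Ident C (W \<otimes>\<^sub>o (X \<otimes>\<^sub>o Y) \<otimes>\<^sub>o Z)" .
  have "?l \<cdot> ?m = (?l \<cdot> ?m) \<cdot> ?a \<cdot> ?b \<cdot> ?b' \<cdot> ?a'" by (simp only: ab) simp
  also have "\<dots> = ?l \<cdot> (?m \<cdot> ?a \<cdot> ?b) \<cdot> ?b' \<cdot> ?a'" by simp
  also have "\<dots> = ?l \<cdot> (associator C W X (Y \<otimes>\<^sub>o Z) \<cdot> associator C (W \<otimes>\<^sub>o X) Y Z) \<cdot> ?b' \<cdot> ?a'"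
    by (simp only: pentagon[OF assms])
  also have "\<dots> = (?l \<cdot> associator C W X (Y \<otimes>\<^sub>o Z)) \<cdot> associator C (W \<otimes>\<^sub>o X) Y Z \<cdot> ?b' \<cdot> ?a'"
    by (simp del: associator_simps(7,8))
  also have "\<dots> = associator C (W \<otimes>\<^sub>o X) Y Z \<cdot> ?b' \<cdot> ?a'" by simp
  finally show ?thesis .
qed

text \<open>Sending \<open>f : V \<otimes> A \<rightarrow> B\<close> to its transpose \<open>A \<rightarrow> X \<otimes> B\<close> and back amounts, up to associators, to
  precomposing \<open>f\<close> with the zigzag \<open>(ev \<otimes> V) (V \<otimes> coev)\<close> tensored with \<open>A\<close>. Naturality moves \<open>f\<close> to
  the outside, and the pentagon for \<open>V, X, V, A\<close> regroups what remains.\<close>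

lemma transpose_transpose:
  assumes ev: "ev \<in> Hom C (V \<otimes>\<^sub>o X) (unit_obj C)" and coev: "coev \<in> Hom C (unit_obj C) (X \<otimes>\<^sub>o V)"
    and f: "f \<in> Hom C (V \<otimes>\<^sub>o A) B" and V [simp]: "V \<in> Obj C" and X [simp]: "X \<in> Obj C" and A [simp]: "A \<in> Obj C"
  shows "(ev \<otimes>\<^sub>a Ident C B) \<cdot> inv_associator V X B \<cdot>
      (Ident C V \<otimes>\<^sub>a ((Ident C X \<otimes>\<^sub>a f) \<cdot> associator C X V A \<cdot> (coev \<otimes>\<^sub>a Ident C A)))
    = (Ident C (unit_obj C) \<otimes>\<^sub>a f) \<cdot> associator C (unit_obj C) V A \<cdot>
      (((ev \<otimes>\<^sub>a Ident C V) \<cdot> inv_associator V X V \<cdot> (Ident C V \<otimes>\<^sub>a coev)) \<otimes>\<^sub>a Ident C A) \<cdot>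
      inv_associator V (unit_obj C) A"
proof -
  note B [simp] = Hom_obj(2)[OF f]
  note arr [simp] = ev[unfolded Hom_iff] coev[unfolded Hom_iff] f[unfolded Hom_iff]
  let ?u = "unit_obj C"
  have split: "Ident C V \<otimes>\<^sub>a ((Ident C X \<otimes>\<^sub>a f) \<cdot> associator C X V A \<cdot> (coev \<otimes>\<^sub>a Ident C A))
    = (Ident C V \<otimes>\<^sub>a (Ident C X \<otimes>\<^sub>a f)) \<cdot> (Ident C V \<otimes>\<^sub>a associator C X V A) \<cdot> (Ident C V \<otimes>\<^sub>a (coev \<otimes>\<^sub>a Ident C A))"
    by (simp add: tensor_comp_arr)
  have split': "((ev \<otimes>\<^sub>a Ident C V) \<cdot> inv_associator V X V \<cdot> (Ident C V \<otimes>\<^sub>a coev)) \<otimes>\<^sub>a Ident C A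
    = ((ev \<otimes>\<^sub>a Ident C V) \<otimes>\<^sub>a Ident C A) \<cdot> (inv_associator V X V \<otimes>\<^sub>a Ident C A) \<cdot> ((Ident C V \<otimes>\<^sub>a coev) \<otimes>\<^sub>a Ident C A)"
    by (simp add: tensor_comp_arr)
  have "inv_associator V X B \<cdot> (Ident C V \<otimes>\<^sub>a (Ident C X \<otimes>\<^sub>a f))
    = (Ident C (V \<otimes>\<^sub>o X) \<otimes>\<^sub>a f) \<cdot> inv_associator V X (V \<otimes>\<^sub>o A)"
    using inv_associator_natural[OF ident_hom[OF V] ident_hom[OF X] f] by (simp add: tensor_ident)
  note s1 = comp_eq_tail[OF this]
  have "(ev \<otimes>\<^sub>a Ident C B) \<cdot> (Ident C (V \<otimes>\<^sub>o X) \<otimes>\<^sub>a f) = (Ident C ?u \<otimes>\<^sub>a f) \<cdot> (ev \<otimes>\<^sub>a Ident C (V \<otimes>\<^sub>o A))"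
    by (simp add: tensor_comp_arr)
  note s2 = comp_eq_tail[OF this]
  note s3 = comp_eq_tail[OF pentagon_inv[OF V X V A]]
  have s4: "inv_associator V (X \<otimes>\<^sub>o V) A \<cdot> (Ident C V \<otimes>\<^sub>a (coev \<otimes>\<^sub>a Ident C A))
    = ((Ident C V \<otimes>\<^sub>a coev) \<otimes>\<^sub>a Ident C A) \<cdot> inv_associator V ?u A"
    using inv_associator_natural[OF ident_hom[OF V] coev ident_hom[OF A]] .
  have "(ev \<otimes>\<^sub>a Ident C (V \<otimes>\<^sub>o A)) \<cdot> associator C (V \<otimes>\<^sub>o X) V A
    = associator C ?u V A \<cdot> ((ev \<otimes>\<^sub>a Ident C V) \<otimes>\<^sub>a Ident C A)"
    using associator_natural[OF ev ident_hom[OF V] ident_hom[OF A]] by (simp add: tensor_ident)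
  note s5 = comp_eq_tail[OF this]
  show ?thesis
    unfolding split split' by (simp add: s1 s2 s3 s4 s5)
qed

end

section \<open>Direct sum decompositions\<close>

context linear_category
begin

abbreviation hom_dim :: "'o \<Rightarrow> 'o \<Rightarrow> nat" where
  "hom_dim X Y \<equiv> vectorspace.dim class_ring (hom_space C X Y)"

text \<open>A direct sum decomposition over any finite index set. That the projections are jointly monic and the
  inclusions jointly epic is equivalent to \<open>\<Sum>i. inc i \<cdot> proj i = id\<close> and, unlike this equation, passes to
  iterated decompositions without any computation with nested sums.\<close>

definition decomposes ::
  "'o \<Rightarrow> 'i set \<Rightarrow> ('i \<Rightarrow> 'o) \<Rightarrow> ('i \<Rightarrow> 'm) \<Rightarrow> ('i \<Rightarrow> 'm) \<Rightarrow> bool" where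
  "decomposes Y I X inc proj \<longleftrightarrow> finite I \<and> Y \<in> Obj C \<and>
     (\<forall>i\<in>I. inc i \<in> Hom C (X i) Y \<and> proj i \<in> Hom C Y (X i)) \<and>
     (\<forall>i\<in>I. \<forall>j\<in>I. proj i \<cdot> inc j = (if i = j then Ident C (X i) else zero_arrow C (X j) (X i))) \<and>
     (\<forall>W. \<forall>f\<in>Hom C W Y. (\<forall>i\<in>I. proj i \<cdot> f = zero_arrow C W (X i)) \<longrightarrow> f = zero_arrow C W Y) \<and>
     (\<forall>W. \<forall>f\<in>Hom C Y W. (\<forall>i\<in>I. f \<cdot> inc i = zero_arrow C (X i) W) \<longrightarrow> f = zero_arrow C Y W)"

lemma linear_finsum:
  assumes T: "linear_map class_ring (hom_space C X Y) (hom_space C X' Y') T"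
    and XY: "X \<in> Obj C" "Y \<in> Obj C" and I: "finite I" and g: "\<And>i. i \<in> I \<Longrightarrow> g i \<in> Hom C X Y"
  shows "T (\<Oplus>\<^bsub>hom_space C X Y\<^esub> i\<in>I. g i) = (\<Oplus>\<^bsub>hom_space C X' Y'\<^esub> i\<in>I. T (g i))"
proof -
  interpret linear_map class_ring "hom_space C X Y" "hom_space C X' Y'" T by (rule T)
  have "g ` I \<subseteq> carrier (hom_space C X Y)" using g hom_carrier[OF XY] by auto
  with I show ?thesis
  proof induction
    case (insert i I)
    then have 1: "g \<in> I \<rightarrow> carrier (hom_space C X Y)" "g i \<in> carrier (hom_space C X Y)" by auto
    then have 2: "(\<lambda>i. T (g i)) \<in> I \<rightarrow> carrier (hom_space C X' Y')" "T (g i) \<in> carrier (hom_space C X' Y')"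
      by auto
    show ?case
      using insert.hyps insert.IH insert.prems 1 2 by (simp add: V.module.M.finsum_closed)
  qed simp
qed

lemma decomposesI:
  assumes I: "finite I" and Y: "Y \<in> Obj C"
    and inc: "\<And>i. i \<in> I \<Longrightarrow> inc i \<in> Hom C (X i) Y"
    and proj: "\<And>i. i \<in> I \<Longrightarrow> proj i \<in> Hom C Y (X i)"
    and orth: "\<And>i j. \<lbrakk>i \<in> I; j \<in> I\<rbrakk> \<Longrightarrow>
      proj i \<cdot> inc j = (if i = j then Ident C (X i) else zero_arrow C (X j) (X i))"
    and sum: "(\<Oplus>\<^bsub>hom_space C Y Y\<^esub> i\<in>I. inc i \<cdot> proj i) = Ident C Y"
  shows "decomposes Y I X inc proj"
proof -
  have ip: "inc i \<cdot> proj i \<in> Hom C Y Y" if "i \<in> I" for i using inc proj that comp_hom by blast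
  have "f = zero_arrow C W Y" if f: "f \<in> Hom C W Y" and z: "\<And>i. i \<in> I \<Longrightarrow> proj i \<cdot> f = zero_arrow C W (X i)"
    for W f
  proof -
    have W: "W \<in> Obj C" using Hom_obj f by blast
    have "f = (\<Oplus>\<^bsub>hom_space C Y Y\<^esub> i\<in>I. inc i \<cdot> proj i) \<cdot> f" using f sum ident_comp by simp
    also have "\<dots> = (\<Oplus>\<^bsub>hom_space C W Y\<^esub> i\<in>I. (inc i \<cdot> proj i) \<cdot> f)"
      by (rule linear_finsum[OF linear_pre_comp[OF f Y] Y Y I ip])
    also have "\<dots> = (\<Oplus>\<^bsub>hom_space C W Y\<^esub> i\<in>I. zero_arrow C W Y)"
    proof -
      interpret vectorspace class_ring "hom_space C W Y" by (rule hom_vectorspace[OF W Y])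
      have "(inc i \<cdot> proj i) \<cdot> f = zero_arrow C W Y" if "i \<in> I" for i
        using comp_assoc[OF f proj inc, OF that that] z[OF that] comp_zero_right[OF inc[OF that] W] by simp
      then show ?thesis using M.zero_closed by (intro M.finsum_cong') auto
    qed
    also have "\<dots> = zero_arrow C W Y"
    proof -
      interpret vectorspace class_ring "hom_space C W Y" by (rule hom_vectorspace[OF W Y])
      show ?thesis by (rule M.finsum_zero)
    qed
    finally show ?thesis .
  qed
  moreover have "f = zero_arrow C Y W" if f: "f \<in> Hom C Y W" and z: "\<And>i. i \<in> I \<Longrightarrow> f \<cdot> inc i = zero_arrow C (X i) W"
    for W f
  proof -
    have W: "W \<in> Obj C" using Hom_obj f by blast
    have "f = f \<cdot> (\<Oplus>\<^bsub>hom_space C Y Y\<^esub> i\<in>I. inc i \<cdot> proj i)" using f sum comp_ident by simp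
    also have "\<dots> = (\<Oplus>\<^bsub>hom_space C Y W\<^esub> i\<in>I. f \<cdot> inc i \<cdot> proj i)"
      by (rule linear_finsum[OF linear_post_comp[OF f Y] Y Y I ip])
    also have "\<dots> = (\<Oplus>\<^bsub>hom_space C Y W\<^esub> i\<in>I. zero_arrow C Y W)"
    proof -
      interpret vectorspace class_ring "hom_space C Y W" by (rule hom_vectorspace[OF Y W])
      have "f \<cdot> inc i \<cdot> proj i = zero_arrow C Y W" if "i \<in> I" for i
        using comp_assoc[OF proj inc f, OF that that] z[OF that] comp_zero_left[OF proj[OF that] W] by simp
      then show ?thesis using M.zero_closed by (intro M.finsum_cong') auto
    qed
    also have "\<dots> = zero_arrow C Y W"
    proof -
      interpret vectorspace class_ring "hom_space C Y W" by (rule hom_vectorspace[OF Y W])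
      show ?thesis by (rule M.finsum_zero)
    qed
    finally show ?thesis .
  qed
  ultimately show ?thesis unfolding decomposes_def using I Y inc proj orth by blast
qed

lemma is_direct_sumE:
  assumes "is_direct_sum C Y Xs"
  obtains inc proj where
    "\<And>i. i < length Xs \<Longrightarrow> inc i \<in> Hom C (Xs ! i) Y"
    "\<And>i. i < length Xs \<Longrightarrow> proj i \<in> Hom C Y (Xs ! i)"
    "\<And>i j. \<lbrakk>i < length Xs; j < length Xs\<rbrakk> \<Longrightarrow>
      proj i \<cdot> inc j = (if i = j then Ident C (Xs ! i) else zero_arrow C (Xs ! j) (Xs ! i))"
    "(\<Oplus>\<^bsub>hom_space C Y Y\<^esub> i \<in> {..<length Xs}. inc i \<cdot> proj i) = Ident C Y"
proof -
  obtain inc proj where *: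
    "\<forall>i<length Xs. inc i \<in> Hom C (Xs ! i) Y \<and> proj i \<in> Hom C Y (Xs ! i)"
    "\<forall>i<length Xs. \<forall>j<length Xs.
      proj i \<cdot> inc j = (if i = j then Ident C (Xs ! i) else zero_arrow C (Xs ! j) (Xs ! i))"
    "(\<Oplus>\<^bsub>hom_space C Y Y\<^esub> i \<in> {..<length Xs}. inc i \<cdot> proj i) = Ident C Y"
    using assms unfolding is_direct_sum_def by (elim conjE exE) (rule that)
  show thesis by (rule that[of inc proj]) (use * in blast)+
qed

lemma is_direct_sum_decomposes:
  assumes "is_direct_sum C Y Xs"
  shows "\<exists>inc proj. decomposes Y {..<length Xs} ((!) Xs) inc proj"
  using assms
proof (rule is_direct_sumE)
  fix inc proj
  assume *: "\<And>i. i < length Xs \<Longrightarrow> inc i \<in> Hom C (Xs ! i) Y"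
    "\<And>i. i < length Xs \<Longrightarrow> proj i \<in> Hom C Y (Xs ! i)"
    "\<And>i j. \<lbrakk>i < length Xs; j < length Xs\<rbrakk> \<Longrightarrow>
      proj i \<cdot> inc j = (if i = j then Ident C (Xs ! i) else zero_arrow C (Xs ! j) (Xs ! i))"
    "(\<Oplus>\<^bsub>hom_space C Y Y\<^esub> i \<in> {..<length Xs}. inc i \<cdot> proj i) = Ident C Y"
  have "Y \<in> Obj C" using assms by (simp add: is_direct_sum_def)
  with * show ?thesis by (intro exI decomposesI) auto
qed

lemma decomposes_Sigma:
  assumes Y: "decomposes Y I X inc proj" and X: "\<And>i. i \<in> I \<Longrightarrow> decomposes (X i) (J i) (Z i) (inc' i) (proj' i)"
  shows "decomposes Y (Sigma I J) (\<lambda>(i, j). Z i j) (\<lambda>(i, j). inc i \<cdot> inc' i j) (\<lambda>(i, j). proj' i j \<cdot> proj i)"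
proof -
  have a: "inc i \<in> Hom C (X i) Y" "proj i \<in> Hom C Y (X i)" if "i \<in> I" for i
    using Y that by (auto simp: decomposes_def)
  have b: "inc' i j \<in> Hom C (Z i j) (X i)" "proj' i j \<in> Hom C (X i) (Z i j)" if "i \<in> I" "j \<in> J i" for i j
    using X[OF that(1)] that by (auto simp: decomposes_def)
  have orth: "(proj' i j \<cdot> proj i) \<cdot> (inc k \<cdot> inc' k l)
      = (if (i, j) = (k, l) then Ident C (Z i j) else zero_arrow C (Z k l) (Z i j))"
    if ij: "i \<in> I" "j \<in> J i" and kl: "k \<in> I" "l \<in> J k" for i j k l
  proof -
    note h = a[OF ij(1)] a[OF kl(1)] b[OF ij] b[OF kl]
    have "(proj' i j \<cdot> proj i) \<cdot> (inc k \<cdot> inc' k l) = proj' i j \<cdot> (proj i \<cdot> inc k) \<cdot> inc' k l"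
      using h by (simp add: Hom_iff)
    also have "\<dots> = (if i = k then proj' i j \<cdot> inc' k l else zero_arrow C (Z k l) (Z i j))"
      using Y ij kl h comp_zero_left[OF h(7) Hom_obj(1)[OF h(6)]] comp_zero_right[OF h(6) Hom_obj(1)[OF h(7)]] ident_comp[OF h(7)]
      by (auto simp: decomposes_def)
    also have "\<dots> = (if (i, j) = (k, l) then Ident C (Z i j) else zero_arrow C (Z k l) (Z i j))"
      using X[OF ij(1)] ij kl by (auto simp: decomposes_def)
    finally show ?thesis .
  qed
  have mono: "f = zero_arrow C W Y"
    if f: "f \<in> Hom C W Y" and z: "\<And>i j. \<lbrakk>i \<in> I; j \<in> J i\<rbrakk> \<Longrightarrow> (proj' i j \<cdot> proj i) \<cdot> f = zero_arrow C W (Z i j)" for W f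
  proof -
    have "proj i \<cdot> f = zero_arrow C W (X i)" if i: "i \<in> I" for i
    proof -
      have "proj' i j \<cdot> proj i \<cdot> f = zero_arrow C W (Z i j)" if "j \<in> J i" for j
        using z[OF i that] comp_assoc[OF f a(2)[OF i] b(2)[OF i that]] by simp
      then show ?thesis using X[OF i] comp_hom[OF f a(2)[OF i]] unfolding decomposes_def by blast
    qed
    then show ?thesis using Y f unfolding decomposes_def by blast
  qed
  have epi: "f = zero_arrow C Y W"
    if f: "f \<in> Hom C Y W" and z: "\<And>i j. \<lbrakk>i \<in> I; j \<in> J i\<rbrakk> \<Longrightarrow> f \<cdot> inc i \<cdot> inc' i j = zero_arrow C (Z i j) W" for W f
  proof -
    have "f \<cdot> inc i = zero_arrow C (X i) W" if i: "i \<in> I" for i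
    proof -
      have "(f \<cdot> inc i) \<cdot> inc' i j = zero_arrow C (Z i j) W" if "j \<in> J i" for j
        using z[OF i that] comp_assoc[OF b(1)[OF i that] a(1)[OF i] f] by simp
      then show ?thesis using X[OF i] comp_hom[OF a(1)[OF i] f] unfolding decomposes_def by blast
    qed
    then show ?thesis using Y f unfolding decomposes_def by blast
  qed
  have fin: "finite (Sigma I J)" "Y \<in> Obj C" using Y X by (auto simp: decomposes_def)
  show ?thesis
    unfolding decomposes_def
    using fin orth mono epi comp_hom[OF b(1) a(1)] comp_hom[OF a(2) b(2)]
    by (simp add: split_beta Ball_def del: comp_assoc_arr)
qed

end

section \<open>Dimensions of Hom spaces\<close>

lemma (in locally_finite_category) hom_dim_mono:
  assumes T: "linear_map class_ring (hom_space C X Y) (hom_space C X' Y') T"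
    and obj: "X \<in> Obj C" "Y \<in> Obj C" "X' \<in> Obj C" "Y' \<in> Obj C"
    and ker: "\<And>f. \<lbrakk>f \<in> Hom C X Y; T f = zero_arrow C X' Y'\<rbrakk> \<Longrightarrow> f = zero_arrow C X Y"
  shows "hom_dim X Y \<le> hom_dim X' Y'"
proof -
  interpret linear_map class_ring "hom_space C X Y" "hom_space C X' Y'" T by (rule T)
  have "inj_on T (carrier (hom_space C X Y))"
    using ker hom_carrier[OF obj(1,2)] by (intro inj_onI_kernel) auto
  then show ?thesis using obj hom_fin_dim by (intro inj_dim_le)
qed

lemma (in locally_finite_category) hom_dim_retract:
  assumes i: "i \<in> Hom C X Y" and r: "r \<in> Hom C Y X" and ri: "r \<cdot> i = Ident C X" and W: "W \<in> Obj C"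
  shows "hom_dim W X \<le> hom_dim W Y" "hom_dim X W \<le> hom_dim Y W"
proof -
  note XY = Hom_obj[OF i]
  have "f = zero_arrow C W X" if f: "f \<in> Hom C W X" and z: "i \<cdot> f = zero_arrow C W Y" for f
  proof -
    have "f = r \<cdot> i \<cdot> f" using comp_assoc[OF f i r] ri ident_comp[OF f] by simp
    then show ?thesis using z comp_zero_right[OF r W] by simp
  qed
  then show "hom_dim W X \<le> hom_dim W Y"
    using linear_post_comp[OF i W] XY W by (intro hom_dim_mono)
  have "f = zero_arrow C X W" if f: "f \<in> Hom C X W" and z: "f \<cdot> r = zero_arrow C Y W" for f
  proof -
    have "f = (f \<cdot> r) \<cdot> i" using comp_assoc[OF i r f] ri comp_ident[OF f] by simp
    then show ?thesis using z comp_zero_left[OF i W] by simp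
  qed
  then show "hom_dim X W \<le> hom_dim Y W"
    using linear_pre_comp[OF r W] XY W by (intro hom_dim_mono)
qed

lemma (in locally_finite_category) hom_dim_isomorphic:
  assumes "isomorphic C X Y" and W: "W \<in> Obj C"
  shows "hom_dim W X = hom_dim W Y" "hom_dim X W = hom_dim Y W"
proof -
  obtain f g where fg: "f \<in> Hom C X Y" "g \<in> Hom C Y X" "g \<cdot> f = Ident C X" "f \<cdot> g = Ident C Y"
    using assms(1) by (rule isomorphicE)
  show "hom_dim W X = hom_dim W Y" "hom_dim X W = hom_dim Y W"
    using hom_dim_retract[OF fg(1-3) W] hom_dim_retract[OF fg(2,1,4) W] by simp_all
qed

section \<open>Schur's lemma and multiplicities\<close>

locale alg_closed_fusion_category = fusion_category C
  for C :: "('o, 'm, 'k :: alg_closed_field, 'r) mon_cat_scheme" (structure)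
begin

lemma simple_obj: "simple_object C S \<Longrightarrow> S \<in> Obj C"
  by (simp add: simple_object_def)

lemma simple_ident_nonzero: "simple_object C S \<Longrightarrow> Ident C S \<noteq> zero_arrow C S S"
  by (auto simp: simple_object_def zero_object_iff)

text \<open>Schur's lemma over an algebraically closed field. If \<open>f\<close> is not a scalar, then \<open>f - c\<close> is invertible for
  every \<open>c\<close>. Every nonzero polynomial \<open>p\<close> splits into linear factors, so \<open>p(f) \<noteq> 0\<close>; thus the
  polynomials embed into \<open>End(S)\<close>, which contradicts its finite dimension.\<close>

lemma simple_end_scalar:
  assumes S: "simple_object C S" and f: "f \<in> Hom C S S"
  shows "\<exists>c. f = c \<odot>\<^bsub>hom_space C S S\<^esub> Ident C S"
proof (rule ccontr)
  assume no: "\<not> ?thesis"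
  let ?E = "hom_space C S S" and ?I = "Ident C S"
  note O [simp] = simple_obj[OF S]
  interpret E: vectorspace class_ring ?E by (rule hom_vectorspace[OF O O])
  have car: "carrier ?E = Hom C S S" by (rule hom_carrier[OF O O])
  have I: "?I \<in> Hom C S S" by (rule ident_hom[OF O])
  have f_comp: "f \<cdot> h \<in> Hom C S S" if "h \<in> Hom C S S" for h using comp_hom[OF that f] .
  \<comment> \<open>Evaluation of polynomials at \<open>f\<close>.\<close>
  define ev where "ev p = fold_coeffs (\<lambda>a h. a \<odot>\<^bsub>?E\<^esub> ?I \<oplus>\<^bsub>?E\<^esub> (f \<cdot> h)) p \<zero>\<^bsub>?E\<^esub>" for p
  have lz: "0 \<odot>\<^bsub>?E\<^esub> h = \<zero>\<^bsub>?E\<^esub>" if "h \<in> Hom C S S" for h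
    using smult_zero_iff[OF that] by simp
  have ev_0: "ev 0 = \<zero>\<^bsub>?E\<^esub>" by (simp add: ev_def)
  have ev_pCons: "ev (pCons a p) = a \<odot>\<^bsub>?E\<^esub> ?I \<oplus>\<^bsub>?E\<^esub> (f \<cdot> ev p)" for a p
  proof (cases "a = 0 \<and> p = 0")
    case True
    then show ?thesis using comp_zero_right[OF f O] lz[OF I] by (simp add: ev_0)
  next
    case False
    then show ?thesis
      by (cases "a = 0") (simp_all add: ev_def fold_coeffs_pCons_coeff_not_0_eq fold_coeffs_pCons_not_0_0_eq)
  qed
  have ev_hom: "ev p \<in> Hom C S S" for p
    by (induction p) (auto simp: ev_0 ev_pCons intro!: hom_zero hom_add hom_smult f_comp I)
  have ev_add: "ev (p + q) = ev p \<oplus>\<^bsub>?E\<^esub> ev q" for p q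
  proof (induction p q rule: poly_induct2)
    case (pCons a p b q)
    have "f \<cdot> (ev p \<oplus>\<^bsub>?E\<^esub> ev q) = (f \<cdot> ev p) \<oplus>\<^bsub>?E\<^esub> (f \<cdot> ev q)"
      by (rule comp_add_right[OF ev_hom ev_hom f])
    moreover have "(a + b) \<odot>\<^bsub>?E\<^esub> ?I = a \<odot>\<^bsub>?E\<^esub> ?I \<oplus>\<^bsub>?E\<^esub> b \<odot>\<^bsub>?E\<^esub> ?I"
      using E.smult_l_distr[of a b ?I] I car by (simp add: class_ring_simps)
    moreover have "a \<odot>\<^bsub>?E\<^esub> ?I \<in> carrier ?E" "b \<odot>\<^bsub>?E\<^esub> ?I \<in> carrier ?E" "f \<cdot> ev p \<in> carrier ?E" "f \<cdot> ev q \<in> carrier ?E"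
      using car I f_comp ev_hom hom_smult by auto
    ultimately show ?case by (simp add: ev_pCons pCons.IH E.M.add.m_ac)
  qed (simp add: ev_0)
  have ev_smult: "ev (smult c p) = c \<odot>\<^bsub>?E\<^esub> ev p" for c p
  proof (induction p)
    case 0
    then show ?case using E.rmult_0[of c] by (simp add: ev_0 class_ring_simps)
  next
    case (pCons a p)
    have *: "a \<odot>\<^bsub>?E\<^esub> ?I \<in> carrier ?E" "f \<cdot> ev p \<in> carrier ?E"
      using car I f_comp ev_hom hom_smult by auto
    have "f \<cdot> (c \<odot>\<^bsub>?E\<^esub> ev p) = c \<odot>\<^bsub>?E\<^esub> (f \<cdot> ev p)"
      by (rule comp_smult_right[OF ev_hom f])
    then show ?case
      using * E.smult_r_distr[of c, OF _ *] E.smult_assoc1[of c a ?I] I car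
      by (simp add: ev_pCons pCons.IH class_ring_simps)
  qed
  define g where "g c = f \<oplus>\<^bsub>?E\<^esub> (- c) \<odot>\<^bsub>?E\<^esub> ?I" for c
  have g: "g c \<in> Hom C S S" for c unfolding g_def by (intro hom_add hom_smult f I)
  have ev_factor: "ev ([:- c, 1:] * q) = g c \<cdot> ev q" for c q
  proof -
    have c: "(- c) \<odot>\<^bsub>?E\<^esub> ?I \<in> Hom C S S" by (rule hom_smult[OF I])
    have "g c \<cdot> ev q = (f \<cdot> ev q) \<oplus>\<^bsub>?E\<^esub> (- c) \<odot>\<^bsub>?E\<^esub> ev q"
      unfolding g_def
      using comp_add_left[OF ev_hom f c] comp_smult_left[OF ev_hom I] ident_comp[OF ev_hom] by simp
    moreover have "f \<cdot> ev q \<in> carrier ?E" "(- c) \<odot>\<^bsub>?E\<^esub> ev q \<in> carrier ?E"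
      using car f_comp ev_hom hom_smult by auto
    moreover have "[:- c, 1:] * q = pCons 0 q + smult (- c) q" by simp
    ultimately show ?thesis
      using lz[OF I] by (simp only: ev_add ev_smult ev_pCons) simp
  qed
  have g_iso: "iso_arrow C (g c)" for c
  proof -
    have cc: "(- c) \<odot>\<^bsub>?E\<^esub> ?I \<oplus>\<^bsub>?E\<^esub> c \<odot>\<^bsub>?E\<^esub> ?I = \<zero>\<^bsub>?E\<^esub>"
      using E.smult_l_distr[of "- c" c ?I] I car lz[OF I] by (simp add: class_ring_simps)
    have "(- c) \<odot>\<^bsub>?E\<^esub> ?I \<in> carrier ?E" "c \<odot>\<^bsub>?E\<^esub> ?I \<in> carrier ?E" "f \<in> carrier ?E"
      using car I f hom_smult by auto
    then have "f = g c \<oplus>\<^bsub>?E\<^esub> c \<odot>\<^bsub>?E\<^esub> ?I" by (simp add: g_def E.M.add.m_assoc cc)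
    then have "g c \<noteq> \<zero>\<^bsub>?E\<^esub>" using no I hom_smult car by auto
    then show ?thesis using simple_hom_zero_or_iso[OF S S g] by blast
  qed
  have ev_nonzero: "ev p \<noteq> \<zero>\<^bsub>?E\<^esub>" if "p \<noteq> 0" for p
    using that
  proof (induction "degree p" arbitrary: p)
    case 0
    then obtain a where p: "p = [:a:]" "a \<noteq> 0" by (metis degree_eq_zeroE pCons_0_0)
    then have "ev p = a \<odot>\<^bsub>?E\<^esub> ?I"
      using comp_zero_right[OF f O] hom_smult[OF I] car by (simp add: ev_pCons ev_0)
    then show ?case using p smult_zero_iff[OF I] simple_ident_nonzero[OF S] by simp
  next
    case (Suc d)
    then obtain c where "poly p c = 0" using alg_closed_imp_poly_has_root[of p] by auto
    then obtain q where q: "p = [:- c, 1:] * q" by (auto simp: poly_eq_0_iff_dvd)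
    with Suc.prems have q0: "q \<noteq> 0" by auto
    then have "degree p = Suc (degree q)" unfolding q by (subst degree_mult_eq) auto
    then have "ev q \<noteq> \<zero>\<^bsub>?E\<^esub>" using Suc.hyps q0 by simp
    moreover have "inv_arrow C (g c) \<cdot> ev p = (inv_arrow C (g c) \<cdot> g c) \<cdot> ev q"
      unfolding q ev_factor by (rule comp_assoc[OF ev_hom g inv_arrow(1)[OF g_iso g], symmetric])
    then have "inv_arrow C (g c) \<cdot> ev p = ev q"
      using inv_arrow(2)[OF g_iso g] ident_comp[OF ev_hom] by simp
    ultimately show ?case using comp_zero_right[OF inv_arrow(1)[OF g_iso g] O] by auto
  qed
  \<comment> \<open>Coefficient vectors of polynomials of degree less than \<open>n\<close> form a space that is too large for \<open>End(S)\<close>.\<close>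
  define n where "n = Suc E.dim"
  interpret k: vec_space "TYPE('k)" n .
  define P where "P v = (\<Sum>i<n. monom (v $ i) i)" for v :: "'k vec"
  have P_add: "P (v + w) = P v + P w" if "v \<in> carrier_vec n" "w \<in> carrier_vec n" for v w
    using that by (simp add: P_def add_monom flip: sum.distrib)
  have P_smult: "P (c \<cdot>\<^sub>v v) = smult c (P v)" if "v \<in> carrier_vec n" for c v
    using that by (simp add: P_def smult_sum2 smult_monom)
  have P_coeff: "coeff (P v) i = v $ i" if "i < n" for v i
    using that by (simp add: P_def coeff_sum)
  interpret T: linear_map class_ring "module_vec TYPE('k) n" ?E "\<lambda>v. ev (P v)"
    using k.vectorspace_axioms E.vectorspace_axioms
    by (rule linear_mapI) (simp_all add: module_vec_simps P_add P_smult ev_add ev_smult car ev_hom)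
  have "inj_on (\<lambda>v. ev (P v)) (carrier (module_vec TYPE('k) n))"
  proof (rule T.inj_onI_kernel)
    fix v assume v: "v \<in> carrier (module_vec TYPE('k) n)" "ev (P v) = \<zero>\<^bsub>?E\<^esub>"
    then have "P v = 0" using ev_nonzero by blast
    then have "v $ i = 0" if "i < n" for i using P_coeff[OF that, of v] by simp
    then show "v = \<zero>\<^bsub>module_vec TYPE('k) n\<^esub>" using v(1) by (intro eq_vecI) (auto simp: module_vec_simps)
  qed
  then have "k.dim \<le> E.dim" using k.fin_dim hom_fin_dim[OF O O] by (intro T.inj_dim_le)
  moreover have "k.dim = n" by (rule k.dim_is_n)
  ultimately show False unfolding n_def by simp
qed

definition end_scalar :: "'o \<Rightarrow> 'm \<Rightarrow> 'k" where
  "end_scalar S f = (THE c. f = c \<odot>\<^bsub>hom_space C S S\<^esub> Ident C S)"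

lemma smult_ident_inj:
  assumes X: "X \<in> Obj C" and nz: "Ident C X \<noteq> zero_arrow C X X"
    and eq: "c \<odot>\<^bsub>hom_space C X X\<^esub> Ident C X = d \<odot>\<^bsub>hom_space C X X\<^esub> Ident C X"
  shows "c = d"
proof -
  interpret vectorspace class_ring "hom_space C X X" by (rule hom_vectorspace[OF X X])
  have I: "Ident C X \<in> carrier (hom_space C X X)" using ident_hom[OF X] hom_carrier[OF X X] by simp
  have "(c - d) \<odot>\<^bsub>hom_space C X X\<^esub> Ident C X
    = c \<odot>\<^bsub>hom_space C X X\<^esub> Ident C X \<oplus>\<^bsub>hom_space C X X\<^esub> (- d) \<odot>\<^bsub>hom_space C X X\<^esub> Ident C X"
    using smult_l_distr[of c "- d" "Ident C X"] I by (simp add: class_ring_simps)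
  also have "\<dots> = (d - d) \<odot>\<^bsub>hom_space C X X\<^esub> Ident C X"
    using smult_l_distr[of d "- d" "Ident C X"] I by (simp add: class_ring_simps eq)
  also have "\<dots> = zero_arrow C X X" using smult_zero_iff[OF ident_hom[OF X], of 0] by simp
  finally show ?thesis using smult_zero_iff[OF ident_hom[OF X]] nz by simp
qed

lemma end_scalar_smult:
  assumes S: "simple_object C S"
  shows "end_scalar S (c \<odot>\<^bsub>hom_space C S S\<^esub> Ident C S) = c"
  unfolding end_scalar_def
  using smult_ident_inj[OF simple_obj[OF S] simple_ident_nonzero[OF S]] by (intro the_equality) auto

lemma end_scalar:
  assumes S: "simple_object C S" and f: "f \<in> Hom C S S"
  shows "f = end_scalar S f \<odot>\<^bsub>hom_space C S S\<^esub> Ident C S"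
  using simple_end_scalar[OF S f] end_scalar_smult[OF S] by auto

lemma end_scalar_simps:
  assumes S: "simple_object C S"
  shows "\<lbrakk>f \<in> Hom C S S; g \<in> Hom C S S\<rbrakk> \<Longrightarrow>
      end_scalar S (f \<oplus>\<^bsub>hom_space C S S\<^esub> g) = end_scalar S f + end_scalar S g"
    and "f \<in> Hom C S S \<Longrightarrow> end_scalar S (c \<odot>\<^bsub>hom_space C S S\<^esub> f) = c * end_scalar S f"
    and "end_scalar S (Ident C S) = 1"
    and "end_scalar S (zero_arrow C S S) = 0"
    and "f \<in> Hom C S S \<Longrightarrow> end_scalar S f = 0 \<longleftrightarrow> f = zero_arrow C S S"
proof -
  note O = simple_obj[OF S]
  interpret vectorspace class_ring "hom_space C S S" by (rule hom_vectorspace[OF O O])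
  have I: "Ident C S \<in> carrier (hom_space C S S)" using ident_hom[OF O] hom_carrier[OF O O] by simp
  have z: "0 \<odot>\<^bsub>hom_space C S S\<^esub> Ident C S = zero_arrow C S S"
    using smult_zero_iff[OF ident_hom[OF O]] by simp
  show "end_scalar S (f \<oplus>\<^bsub>hom_space C S S\<^esub> g) = end_scalar S f + end_scalar S g"
    if fg: "f \<in> Hom C S S" "g \<in> Hom C S S"
  proof -
    have "f \<oplus>\<^bsub>hom_space C S S\<^esub> g = (end_scalar S f + end_scalar S g) \<odot>\<^bsub>hom_space C S S\<^esub> Ident C S"
      using smult_l_distr[of "end_scalar S f" "end_scalar S g" "Ident C S"] I
        end_scalar[OF S fg(1)] end_scalar[OF S fg(2)] by (simp add: class_ring_simps)
    then show ?thesis by (simp add: end_scalar_smult[OF S])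
  qed
  show "end_scalar S (c \<odot>\<^bsub>hom_space C S S\<^esub> f) = c * end_scalar S f" if f: "f \<in> Hom C S S"
  proof -
    have "c \<odot>\<^bsub>hom_space C S S\<^esub> f = (c * end_scalar S f) \<odot>\<^bsub>hom_space C S S\<^esub> Ident C S"
      using smult_assoc1[of c "end_scalar S f" "Ident C S"] I
        end_scalar[OF S f] by (simp add: class_ring_simps)
    then show ?thesis by (simp add: end_scalar_smult[OF S])
  qed
  show "end_scalar S (Ident C S) = 1"
    using end_scalar_smult[OF S, of 1] smult_one[OF I] by (simp add: class_ring_simps)
  show *: "end_scalar S (zero_arrow C S S) = 0"
    using end_scalar_smult[OF S, of 0] by (simp add: z)
  show "end_scalar S f = 0 \<longleftrightarrow> f = zero_arrow C S S" if f: "f \<in> Hom C S S"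
    using end_scalar[OF S f] * z by metis
qed

text \<open>By Schur's lemma, a morphism \<open>S \<rightarrow> Y\<close> has components only in the summands isomorphic to \<open>S\<close>, and each
  such component is a scalar after identifying the summand with \<open>S\<close>. These scalars are coordinates
  whose dual basis consists of the inclusions of those summands; likewise for morphisms \<open>Y \<rightarrow> S\<close>.\<close>

lemma hom_dim_decomposes:
  assumes S: "simple_object C S" and Y: "decomposes Y I X inc proj"
    and X: "\<And>i. i \<in> I \<Longrightarrow> simple_object C (X i)"
  shows "hom_dim S Y = card {i \<in> I. isomorphic C S (X i)}"
    and "hom_dim Y S = card {i \<in> I. isomorphic C S (X i)}"
proof -
  define J where "J = {i \<in> I. isomorphic C S (X i)}"
  have inc: "inc i \<in> Hom C (X i) Y" and proj: "proj i \<in> Hom C Y (X i)" if "i \<in> I" for i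
    using Y that by (auto simp: decomposes_def)
  have orth: "proj i \<cdot> inc j = (if i = j then Ident C (X i) else zero_arrow C (X j) (X i))"
    if "i \<in> I" "j \<in> I" for i j
    using Y that by (auto simp: decomposes_def)
  have YO: "Y \<in> Obj C" and J: "finite J" using Y by (auto simp: decomposes_def J_def)
  note SO = simple_obj[OF S]
  have "\<forall>i\<in>J. \<exists>\<phi> \<psi>. \<phi> \<in> Hom C S (X i) \<and> \<psi> \<in> Hom C (X i) S \<and> \<psi> \<cdot> \<phi> = Ident C S \<and> \<phi> \<cdot> \<psi> = Ident C (X i)"
    unfolding J_def by (blast elim: isomorphicE)
  then obtain \<phi> \<psi> where \<phi>: "\<And>i. i \<in> J \<Longrightarrow> \<phi> i \<in> Hom C S (X i)" and \<psi>: "\<And>i. i \<in> J \<Longrightarrow> \<psi> i \<in> Hom C (X i) S"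
    and \<psi>\<phi>: "\<And>i. i \<in> J \<Longrightarrow> \<psi> i \<cdot> \<phi> i = Ident C S" and \<phi>\<psi>: "\<And>i. i \<in> J \<Longrightarrow> \<phi> i \<cdot> \<psi> i = Ident C (X i)"
    by metis
  define b where "b i = inc i \<cdot> \<phi> i" for i
  define b' where "b' i = \<psi> i \<cdot> proj i" for i
  have JI: "i \<in> I" if "i \<in> J" for i using that by (simp add: J_def)
  have b: "b i \<in> Hom C S Y" and b': "b' i \<in> Hom C Y S" if "i \<in> J" for i
    unfolding b_def b'_def using inc proj \<phi> \<psi> JI that comp_hom by blast+
  have b'b: "b' i \<cdot> b j = (if i = j then Ident C S else zero_arrow C S S)" if "i \<in> J" "j \<in> J" for i j
  proof -
    note h = inc[OF JI[OF that(2)]] proj[OF JI[OF that(1)]] \<phi>[OF that(2)] \<psi>[OF that(1)]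
    have "b' i \<cdot> b j = \<psi> i \<cdot> (proj i \<cdot> inc j) \<cdot> \<phi> j"
      unfolding b_def b'_def using h by (simp add: Hom_iff)
    then show ?thesis
      using orth[OF JI JI, OF that] ident_comp[OF h(3)] \<psi>\<phi>[OF that(1)]
        comp_zero_left[OF h(3) Hom_obj(1)[OF h(4)]] comp_zero_right[OF h(4) SO]
      by auto
  qed
  have V: "vectorspace class_ring (hom_space C S Y)" "vectorspace.fin_dim class_ring (hom_space C S Y)"
    and V': "vectorspace class_ring (hom_space C Y S)" "vectorspace.fin_dim class_ring (hom_space C Y S)"
    using hom_vectorspace hom_fin_dim SO YO by auto
  note car = hom_carrier[OF SO YO] hom_carrier[OF YO SO]
  show "hom_dim S Y = card {i \<in> I. isomorphic C S (X i)}"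
    unfolding J_def[symmetric]
  proof (rule dim_eq_card_dual_basis[OF V J, where b = b and c = "\<lambda>i v. end_scalar S (b' i \<cdot> v)"])
    fix v assume "v \<in> carrier (hom_space C S Y)" and z: "\<And>i. i \<in> J \<Longrightarrow> end_scalar S (b' i \<cdot> v) = 0"
    then have v: "v \<in> Hom C S Y" by (simp add: car)
    have "proj i \<cdot> v = zero_arrow C S (X i)" if i: "i \<in> I" for i
    proof (cases "i \<in> J")
      case True
      have "b' i \<cdot> v = zero_arrow C S S"
        using z[OF True] end_scalar_simps(5)[OF S comp_hom[OF v b'[OF True]]] by simp
      moreover have "\<phi> i \<cdot> b' i \<cdot> v = (\<phi> i \<cdot> \<psi> i) \<cdot> proj i \<cdot> v"
        unfolding b'_def using \<phi>[OF True] \<psi>[OF True] proj[OF i] v by (simp add: Hom_iff)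
      ultimately show ?thesis
        using comp_zero_right[OF \<phi>[OF True] SO] \<phi>\<psi>[OF True] ident_comp[OF comp_hom[OF v proj[OF i]]] by simp
    next
      case False
      then have "\<not> iso_arrow C (proj i \<cdot> v)"
        using i comp_hom[OF v proj[OF i]] by (auto simp: J_def isomorphic_def)
      then show ?thesis using simple_hom_zero_or_iso[OF S X[OF i] comp_hom[OF v proj[OF i]]] by blast
    qed
    then show "v = zero_arrow C S Y" using Y v unfolding decomposes_def by blast
  qed (use b b' in \<open>auto simp: car b'b comp_add_right[OF _ _ b'] comp_smult_right[OF _ b']
      end_scalar_simps(3,4)[OF S] intro!: end_scalar_simps(1,2)[OF S] comp_hom[OF _ b']\<close>)
  show "hom_dim Y S = card {i \<in> I. isomorphic C S (X i)}"
    unfolding J_def[symmetric]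
  proof (rule dim_eq_card_dual_basis[OF V' J, where b = b' and c = "\<lambda>i v. end_scalar S (v \<cdot> b i)"])
    fix v assume "v \<in> carrier (hom_space C Y S)" and z: "\<And>i. i \<in> J \<Longrightarrow> end_scalar S (v \<cdot> b i) = 0"
    then have v: "v \<in> Hom C Y S" by (simp add: car)
    have "v \<cdot> inc i = zero_arrow C (X i) S" if i: "i \<in> I" for i
    proof (cases "i \<in> J")
      case True
      have "v \<cdot> b i = zero_arrow C S S"
        using z[OF True] end_scalar_simps(5)[OF S comp_hom[OF b[OF True] v]] by simp
      moreover have "(v \<cdot> b i) \<cdot> \<psi> i = (v \<cdot> inc i) \<cdot> \<phi> i \<cdot> \<psi> i"
        unfolding b_def using \<phi>[OF True] \<psi>[OF True] inc[OF i] v by (simp add: Hom_iff)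
      ultimately show ?thesis
        using comp_zero_left[OF \<psi>[OF True] SO] \<phi>\<psi>[OF True] comp_ident[OF comp_hom[OF inc[OF i] v]] by simp
    next
      case False
      then have "\<not> iso_arrow C (v \<cdot> inc i)"
        using i comp_hom[OF inc[OF i] v] isomorphic_sym[of "X i" S] unfolding J_def isomorphic_def by blast
      then show ?thesis using simple_hom_zero_or_iso[OF X[OF i] S comp_hom[OF inc[OF i] v]] by blast
    qed
    then show "v = zero_arrow C Y S" using Y v unfolding decomposes_def by blast
  qed (use b b' in \<open>auto simp: car b'b comp_add_left[OF b] comp_smult_left[OF b]
      end_scalar_simps(3,4)[OF S] intro!: end_scalar_simps(1,2)[OF S] comp_hom[OF b]\<close>)
qed

text \<open>In particular the number of summands isomorphic to \<open>S\<close> does not depend on the decomposition.\<close>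

lemma multiplicity_eq_hom_dim:
  assumes S: "simple_object C S" and Y: "Y \<in> Obj C"
  shows "multiplicity C S Y = hom_dim S Y" and "hom_dim Y S = hom_dim S Y"
proof -
  have *: "length (filter (isomorphic C S) Ss) = hom_dim S Y \<and> hom_dim Y S = hom_dim S Y"
    if Ss: "\<forall>T \<in> set Ss. simple_object C T" "is_direct_sum C Y Ss" for Ss
  proof -
    obtain inc proj where d: "decomposes Y {..<length Ss} ((!) Ss) inc proj"
      using is_direct_sum_decomposes[OF Ss(2)] by blast
    have "length (filter (isomorphic C S) Ss) = card {i \<in> {..<length Ss}. isomorphic C S (Ss ! i)}"
      by (simp add: length_filter_conv_card)
    then show ?thesis using hom_dim_decomposes[OF S d] Ss(1) by simp
  qed
  obtain Ss where Ss: "\<forall>T \<in> set Ss. simple_object C T" "is_direct_sum C Y Ss"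
    using semisimple[OF Y] by blast
  show "multiplicity C S Y = hom_dim S Y"
    unfolding multiplicity_def
  proof (rule the_equality)
    show "\<exists>Ss. (\<forall>T\<in>set Ss. simple_object C T) \<and> is_direct_sum C Y Ss \<and>
      hom_dim S Y = length (filter (isomorphic C S) Ss)"
      using Ss *[OF Ss] by (intro exI[of _ Ss]) simp
  qed (use * in auto)
  show "hom_dim Y S = hom_dim S Y" using *[OF Ss] by blast
qed

end

section \<open>Tensor products and duals\<close>

lemma (in monoidal_category) isomorphic_tensor:
  assumes "isomorphic C X X'" and Z: "Z \<in> Obj C"
  shows "isomorphic C (X \<otimes>\<^sub>o Z) (X' \<otimes>\<^sub>o Z)" "isomorphic C (Z \<otimes>\<^sub>o X) (Z \<otimes>\<^sub>o X')"
proof -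
  obtain f g where fg: "f \<in> Hom C X X'" "g \<in> Hom C X' X" "g \<cdot> f = Ident C X" "f \<cdot> g = Ident C X'"
    using assms(1) by (rule isomorphicE)
  note O = Hom_obj[OF fg(1)]
  show "isomorphic C (X \<otimes>\<^sub>o Z) (X' \<otimes>\<^sub>o Z)"
    using fg O Z
    by (intro isomorphicI[of "f \<otimes>\<^sub>a Ident C Z" _ _ "g \<otimes>\<^sub>a Ident C Z"])
      (auto simp: Hom_iff tensor_comp_arr tensor_ident)
  show "isomorphic C (Z \<otimes>\<^sub>o X) (Z \<otimes>\<^sub>o X')"
    using fg O Z
    by (intro isomorphicI[of "Ident C Z \<otimes>\<^sub>a f" _ _ "Ident C Z \<otimes>\<^sub>a g"])
      (auto simp: Hom_iff tensor_comp_arr tensor_ident)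
qed

context fusion_category
begin

lemma linear_tensor_left:
  assumes g: "g \<in> Hom C X' Y'" and X: "X \<in> Obj C" and Y: "Y \<in> Obj C"
  shows "linear_map class_ring (hom_space C X Y) (hom_space C (X \<otimes>\<^sub>o X') (Y \<otimes>\<^sub>o Y')) (\<lambda>f. f \<otimes>\<^sub>a g)"
  using Hom_obj[OF g] X Y
  by (intro hom_linear_mapI)
    (auto intro: tensor_arr[OF _ g] tensor_add_left[OF _ _ g] tensor_smult_left[OF _ g])

lemma linear_tensor_right:
  assumes g: "g \<in> Hom C X' Y'" and X: "X \<in> Obj C" and Y: "Y \<in> Obj C"
  shows "linear_map class_ring (hom_space C X Y) (hom_space C (X' \<otimes>\<^sub>o X) (Y' \<otimes>\<^sub>o Y)) (\<lambda>f. g \<otimes>\<^sub>a f)"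
  using Hom_obj[OF g] X Y
  by (intro hom_linear_mapI)
    (auto intro: tensor_arr[OF g] tensor_add_right[OF g] tensor_smult_right[OF g])

lemma tensor_zero:
  assumes g: "g \<in> Hom C X' Y'" and X: "X \<in> Obj C" and Y: "Y \<in> Obj C"
  shows "zero_arrow C X Y \<otimes>\<^sub>a g = zero_arrow C (X \<otimes>\<^sub>o X') (Y \<otimes>\<^sub>o Y')"
    and "g \<otimes>\<^sub>a zero_arrow C X Y = zero_arrow C (X' \<otimes>\<^sub>o X) (Y' \<otimes>\<^sub>o Y)"
proof -
  interpret l: linear_map class_ring "hom_space C X Y" "hom_space C (X \<otimes>\<^sub>o X') (Y \<otimes>\<^sub>o Y')" "\<lambda>f. f \<otimes>\<^sub>a g"
    by (rule linear_tensor_left[OF assms])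
  interpret r: linear_map class_ring "hom_space C X Y" "hom_space C (X' \<otimes>\<^sub>o X) (Y' \<otimes>\<^sub>o Y)" "\<lambda>f. g \<otimes>\<^sub>a f"
    by (rule linear_tensor_right[OF assms])
  show "zero_arrow C X Y \<otimes>\<^sub>a g = zero_arrow C (X \<otimes>\<^sub>o X') (Y \<otimes>\<^sub>o Y')" by (rule l.f0_is_0)
  show "g \<otimes>\<^sub>a zero_arrow C X Y = zero_arrow C (X' \<otimes>\<^sub>o X) (Y' \<otimes>\<^sub>o Y)" by (rule r.f0_is_0)
qed

lemma hom_finsum_cong:
  assumes "X \<in> Obj C" "Y \<in> Obj C" "\<And>i. i \<in> I \<Longrightarrow> f i = g i" "\<And>i. i \<in> I \<Longrightarrow> g i \<in> Hom C X Y"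
  shows "(\<Oplus>\<^bsub>hom_space C X Y\<^esub> i\<in>I. f i) = (\<Oplus>\<^bsub>hom_space C X Y\<^esub> i\<in>I. g i)"
proof -
  interpret vectorspace class_ring "hom_space C X Y" by (rule hom_vectorspace[OF assms(1,2)])
  show ?thesis using assms hom_carrier by (intro M.finsum_cong') auto
qed

text \<open>Tensoring with \<open>Z\<close> is additive, so it preserves the equation \<open>\<Sum>i. inc i \<cdot> proj i = id\<close>.\<close>

lemma tensor_decomposes:
  assumes Y: "is_direct_sum C Y Xs" and Z: "Z \<in> Obj C"
  shows "\<exists>inc proj. decomposes (Y \<otimes>\<^sub>o Z) {..<length Xs} (\<lambda>i. Xs ! i \<otimes>\<^sub>o Z) inc proj"
    and "\<exists>inc proj. decomposes (Z \<otimes>\<^sub>o Y) {..<length Xs} (\<lambda>i. Z \<otimes>\<^sub>o Xs ! i) inc proj"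
proof -
  have YO: "Y \<in> Obj C" using Y by (simp add: is_direct_sum_def)
  note I = ident_hom[OF Z]
  obtain inc proj where inc: "\<And>i. i < length Xs \<Longrightarrow> inc i \<in> Hom C (Xs ! i) Y"
    and proj: "\<And>i. i < length Xs \<Longrightarrow> proj i \<in> Hom C Y (Xs ! i)"
    and orth: "\<And>i j. \<lbrakk>i < length Xs; j < length Xs\<rbrakk> \<Longrightarrow>
      proj i \<cdot> inc j = (if i = j then Ident C (Xs ! i) else zero_arrow C (Xs ! j) (Xs ! i))"
    and sum: "(\<Oplus>\<^bsub>hom_space C Y Y\<^esub> i \<in> {..<length Xs}. inc i \<cdot> proj i) = Ident C Y"
    using is_direct_sumE[OF Y] by blast
  have XO: "Xs ! i \<in> Obj C" if "i < length Xs" for i using inc[OF that] Hom_obj by blast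
  have ip: "inc i \<cdot> proj i \<in> Hom C Y Y" if "i \<in> {..<length Xs}" for i
    using comp_hom[OF proj inc] that by simp
  have "decomposes (Y \<otimes>\<^sub>o Z) {..<length Xs} (\<lambda>i. Xs ! i \<otimes>\<^sub>o Z) (\<lambda>i. inc i \<otimes>\<^sub>a Ident C Z) (\<lambda>i. proj i \<otimes>\<^sub>a Ident C Z)"
  proof (rule decomposesI)
    fix i j assume ij: "i \<in> {..<length Xs}" "j \<in> {..<length Xs}"
    then have "(proj i \<otimes>\<^sub>a Ident C Z) \<cdot> (inc j \<otimes>\<^sub>a Ident C Z) = (proj i \<cdot> inc j) \<otimes>\<^sub>a Ident C Z"
      using inc[of j] proj[of i] by (simp add: tensor_comp_arr Hom_iff Z)
    then show "(proj i \<otimes>\<^sub>a Ident C Z) \<cdot> (inc j \<otimes>\<^sub>a Ident C Z) =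
        (if i = j then Ident C (Xs ! i \<otimes>\<^sub>o Z) else zero_arrow C (Xs ! j \<otimes>\<^sub>o Z) (Xs ! i \<otimes>\<^sub>o Z))"
      using ij orth[of i j] tensor_zero(1)[OF I] tensor_ident[OF _ Z] XO by auto
  next
    have "Ident C (Y \<otimes>\<^sub>o Z) = (\<Oplus>\<^bsub>hom_space C Y Y\<^esub> i \<in> {..<length Xs}. inc i \<cdot> proj i) \<otimes>\<^sub>a Ident C Z"
      using sum tensor_ident[OF YO Z] by simp
    also have "\<dots> = (\<Oplus>\<^bsub>hom_space C (Y \<otimes>\<^sub>o Z) (Y \<otimes>\<^sub>o Z)\<^esub> i \<in> {..<length Xs}. (inc i \<cdot> proj i) \<otimes>\<^sub>a Ident C Z)"
      by (rule linear_finsum[OF linear_tensor_left[OF I YO YO] YO YO finite_lessThan ip])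
    also have "\<dots> = (\<Oplus>\<^bsub>hom_space C (Y \<otimes>\<^sub>o Z) (Y \<otimes>\<^sub>o Z)\<^esub> i \<in> {..<length Xs}. (inc i \<otimes>\<^sub>a Ident C Z) \<cdot> (proj i \<otimes>\<^sub>a Ident C Z))"
      using inc proj XO YO Z by (intro hom_finsum_cong) (auto simp: Hom_iff tensor_comp_arr)
    finally show "(\<Oplus>\<^bsub>hom_space C (Y \<otimes>\<^sub>o Z) (Y \<otimes>\<^sub>o Z)\<^esub> i \<in> {..<length Xs}. (inc i \<otimes>\<^sub>a Ident C Z) \<cdot> (proj i \<otimes>\<^sub>a Ident C Z)) = Ident C (Y \<otimes>\<^sub>o Z)"
      by simp
  qed (use inc proj I YO Z in \<open>auto intro: tensor_arr\<close>)
  then show "\<exists>inc proj. decomposes (Y \<otimes>\<^sub>o Z) {..<length Xs} (\<lambda>i. Xs ! i \<otimes>\<^sub>o Z) inc proj" by blast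
  have "decomposes (Z \<otimes>\<^sub>o Y) {..<length Xs} (\<lambda>i. Z \<otimes>\<^sub>o Xs ! i) (\<lambda>i. Ident C Z \<otimes>\<^sub>a inc i) (\<lambda>i. Ident C Z \<otimes>\<^sub>a proj i)"
  proof (rule decomposesI)
    fix i j assume ij: "i \<in> {..<length Xs}" "j \<in> {..<length Xs}"
    then have "(Ident C Z \<otimes>\<^sub>a proj i) \<cdot> (Ident C Z \<otimes>\<^sub>a inc j) = Ident C Z \<otimes>\<^sub>a (proj i \<cdot> inc j)"
      using inc[of j] proj[of i] by (simp add: tensor_comp_arr Hom_iff Z)
    then show "(Ident C Z \<otimes>\<^sub>a proj i) \<cdot> (Ident C Z \<otimes>\<^sub>a inc j) =
        (if i = j then Ident C (Z \<otimes>\<^sub>o Xs ! i) else zero_arrow C (Z \<otimes>\<^sub>o Xs ! j) (Z \<otimes>\<^sub>o Xs ! i))"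
      using ij orth[of i j] tensor_zero(2)[OF I] tensor_ident[OF Z] XO by auto
  next
    have "Ident C (Z \<otimes>\<^sub>o Y) = Ident C Z \<otimes>\<^sub>a (\<Oplus>\<^bsub>hom_space C Y Y\<^esub> i \<in> {..<length Xs}. inc i \<cdot> proj i)"
      using sum tensor_ident[OF Z YO] by simp
    also have "\<dots> = (\<Oplus>\<^bsub>hom_space C (Z \<otimes>\<^sub>o Y) (Z \<otimes>\<^sub>o Y)\<^esub> i \<in> {..<length Xs}. Ident C Z \<otimes>\<^sub>a (inc i \<cdot> proj i))"
      by (rule linear_finsum[OF linear_tensor_right[OF I YO YO] YO YO finite_lessThan ip])
    also have "\<dots> = (\<Oplus>\<^bsub>hom_space C (Z \<otimes>\<^sub>o Y) (Z \<otimes>\<^sub>o Y)\<^esub> i \<in> {..<length Xs}. (Ident C Z \<otimes>\<^sub>a inc i) \<cdot> (Ident C Z \<otimes>\<^sub>a proj i))"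
      using inc proj XO YO Z by (intro hom_finsum_cong) (auto simp: Hom_iff tensor_comp_arr)
    finally show "(\<Oplus>\<^bsub>hom_space C (Z \<otimes>\<^sub>o Y) (Z \<otimes>\<^sub>o Y)\<^esub> i \<in> {..<length Xs}. (Ident C Z \<otimes>\<^sub>a inc i) \<cdot> (Ident C Z \<otimes>\<^sub>a proj i)) = Ident C (Z \<otimes>\<^sub>o Y)"
      by simp
  qed (use inc proj I YO Z in \<open>auto intro: tensor_arr\<close>)
  then show "\<exists>inc proj. decomposes (Z \<otimes>\<^sub>o Y) {..<length Xs} (\<lambda>i. Z \<otimes>\<^sub>o Xs ! i) inc proj" by blast
qed

text \<open>Transposition along the dual pair, \<open>f \<mapsto> (X \<otimes> f) (coev \<otimes> A)\<close>, is injective: by \<open>transpose_transpose\<close>, the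
  transpose determines \<open>f\<close> composed with the zigzag \<open>K\<close>, and the zigzag identity says that \<open>K\<close> differs
  from the identity only by unitors, so it is invertible.\<close>

lemma hom_dim_left_dual:
  assumes dual: "left_dual C V X" and A: "A \<in> Obj C" and B: "B \<in> Obj C"
  shows "hom_dim (V \<otimes>\<^sub>o A) B \<le> hom_dim A (X \<otimes>\<^sub>o B)"
proof -
  let ?u = "unit_obj C"
  have V: "V \<in> Obj C" and X: "X \<in> Obj C" using dual by (auto simp: left_dual_def)
  obtain ev coev where ev: "ev \<in> Hom C (V \<otimes>\<^sub>o X) ?u" and coev: "coev \<in> Hom C ?u (X \<otimes>\<^sub>o V)"
    and zz: "lunitor C V \<cdot> (ev \<otimes>\<^sub>a Ident C V) \<cdot> inv_associator V X V \<cdot> (Ident C V \<otimes>\<^sub>a coev) = runitor C V"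
    using dual unfolding left_dual_def by blast
  note obj [simp] = A B V X
  note arr [simp] = ev[unfolded Hom_iff] coev[unfolded Hom_iff]
  define k where "k = associator C X V A \<cdot> (coev \<otimes>\<^sub>a Ident C A)"
  have k: "k \<in> Hom C (?u \<otimes>\<^sub>o A) (X \<otimes>\<^sub>o (V \<otimes>\<^sub>o A))" unfolding k_def by (simp add: Hom_iff)
  have Xf: "Ident C X \<otimes>\<^sub>a f \<in> Hom C (X \<otimes>\<^sub>o (V \<otimes>\<^sub>o A)) (X \<otimes>\<^sub>o B)" if "f \<in> Hom C (V \<otimes>\<^sub>o A) B" for f
    using tensor_arr[OF ident_hom[OF X] that] .
  have lin: "linear_map class_ring (hom_space C (V \<otimes>\<^sub>o A) B) (hom_space C (?u \<otimes>\<^sub>o A) (X \<otimes>\<^sub>o B))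
      (\<lambda>f. (Ident C X \<otimes>\<^sub>a f) \<cdot> k)"
    by (rule hom_linear_mapI)
      (simp_all add: tensor_add_right[OF ident_hom[OF X]] tensor_smult_right[OF ident_hom[OF X]]
        comp_add_left[OF k Xf Xf] comp_smult_left[OF k Xf] comp_hom[OF k Xf])
  have ker: "f = zero_arrow C (V \<otimes>\<^sub>o A) B"
    if f: "f \<in> Hom C (V \<otimes>\<^sub>o A) B" and z: "(Ident C X \<otimes>\<^sub>a f) \<cdot> k = zero_arrow C (?u \<otimes>\<^sub>o A) (X \<otimes>\<^sub>o B)" for f
  proof -
    note [simp] = f[unfolded Hom_iff]
    note l = inv_arrow[OF lunitor_iso[OF V] lunitor_hom[OF V]]
    note r = inv_arrow[OF runitor_iso[OF V] runitor_hom[OF V]]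
    note [simp] = l(1)[unfolded Hom_iff] r(1)[unfolded Hom_iff]
    define K where "K = (ev \<otimes>\<^sub>a Ident C V) \<cdot> inv_associator V X V \<cdot> (Ident C V \<otimes>\<^sub>a coev)"
    define K' where "K' = inv_arrow C (runitor C V) \<cdot> lunitor C V"
    have K [simp]: "K \<in> Arr C" "Dom C K = V \<otimes>\<^sub>o ?u" "Cod C K = ?u \<otimes>\<^sub>o V" by (simp_all add: K_def)
    have K' [simp]: "K' \<in> Arr C" "Dom C K' = ?u \<otimes>\<^sub>o V" "Cod C K' = V \<otimes>\<^sub>o ?u" by (simp_all add: K'_def)
    have lK: "lunitor C V \<cdot> K = runitor C V" using zz by (simp add: K_def)
    have "K \<cdot> K' = (inv_arrow C (lunitor C V) \<cdot> lunitor C V) \<cdot> K \<cdot> K'" by (simp add: l(2))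
    also have "\<dots> = inv_arrow C (lunitor C V) \<cdot> (lunitor C V \<cdot> K) \<cdot> K'" by simp
    also have "\<dots> = inv_arrow C (lunitor C V) \<cdot> (runitor C V \<cdot> inv_arrow C (runitor C V)) \<cdot> lunitor C V"
      by (simp add: lK K'_def del: comp_assoc_arr) (simp add: K'_def)
    also have "\<dots> = Ident C (?u \<otimes>\<^sub>o V)" by (simp add: l(2) r(3))
    finally have KK': "K \<cdot> K' = Ident C (?u \<otimes>\<^sub>o V)" .
    define M where "M = associator C ?u V A \<cdot> (K \<otimes>\<^sub>a Ident C A) \<cdot> inv_associator V ?u A"
    define M' where "M' = associator C V ?u A \<cdot> (K' \<otimes>\<^sub>a Ident C A) \<cdot> inv_associator ?u V A"
    have M [simp]: "M \<in> Arr C" "Dom C M = V \<otimes>\<^sub>o (?u \<otimes>\<^sub>o A)" "Cod C M = ?u \<otimes>\<^sub>o (V \<otimes>\<^sub>o A)" by (simp_all add: M_def)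
    have M' [simp]: "M' \<in> Arr C" "Cod C M' = V \<otimes>\<^sub>o (?u \<otimes>\<^sub>o A)" "Dom C M' = ?u \<otimes>\<^sub>o (V \<otimes>\<^sub>o A)" by (simp_all add: M'_def)
    have "M \<cdot> M' = associator C ?u V A \<cdot> (K \<otimes>\<^sub>a Ident C A) \<cdot> (inv_associator V ?u A \<cdot> associator C V ?u A) \<cdot> (K' \<otimes>\<^sub>a Ident C A) \<cdot> inv_associator ?u V A"
      unfolding M_def M'_def by (simp del: associator_simps(7,8))
    also have "\<dots> = associator C ?u V A \<cdot> ((K \<otimes>\<^sub>a Ident C A) \<cdot> (K' \<otimes>\<^sub>a Ident C A)) \<cdot> inv_associator ?u V A" by simp
    also have "\<dots> = Ident C (?u \<otimes>\<^sub>o (V \<otimes>\<^sub>o A))" by (simp add: tensor_comp_arr KK' tensor_ident)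
    finally have MM': "M \<cdot> M' = Ident C (?u \<otimes>\<^sub>o (V \<otimes>\<^sub>o A))" .
    have "(Ident C ?u \<otimes>\<^sub>a f) \<cdot> M
      = (ev \<otimes>\<^sub>a Ident C B) \<cdot> inv_associator V X B \<cdot> (Ident C V \<otimes>\<^sub>a ((Ident C X \<otimes>\<^sub>a f) \<cdot> k))"
      using transpose_transpose[OF ev coev f V X A] by (simp add: M_def K_def k_def)
    also have "\<dots> = (ev \<otimes>\<^sub>a Ident C B) \<cdot> inv_associator V X B \<cdot> zero_arrow C (V \<otimes>\<^sub>o (?u \<otimes>\<^sub>o A)) (V \<otimes>\<^sub>o (X \<otimes>\<^sub>o B))"
      using tensor_zero(2)[OF ident_hom[OF V], of "?u \<otimes>\<^sub>o A" "X \<otimes>\<^sub>o B"] z by simp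
    also have "\<dots> = (ev \<otimes>\<^sub>a Ident C B) \<cdot> zero_arrow C (V \<otimes>\<^sub>o (?u \<otimes>\<^sub>o A)) ((V \<otimes>\<^sub>o X) \<otimes>\<^sub>o B)"
      using comp_zero_right[of "inv_associator V X B" "V \<otimes>\<^sub>o (X \<otimes>\<^sub>o B)" "(V \<otimes>\<^sub>o X) \<otimes>\<^sub>o B"] by (simp add: Hom_iff)
    also have "\<dots> = zero_arrow C (V \<otimes>\<^sub>o (?u \<otimes>\<^sub>o A)) (?u \<otimes>\<^sub>o B)"
      using comp_zero_right[of "ev \<otimes>\<^sub>a Ident C B" "(V \<otimes>\<^sub>o X) \<otimes>\<^sub>o B" "?u \<otimes>\<^sub>o B"] by (simp add: Hom_iff)
    finally have fM: "(Ident C ?u \<otimes>\<^sub>a f) \<cdot> M = zero_arrow C (V \<otimes>\<^sub>o (?u \<otimes>\<^sub>o A)) (?u \<otimes>\<^sub>o B)" .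
    have "Ident C ?u \<otimes>\<^sub>a f = (Ident C ?u \<otimes>\<^sub>a f) \<cdot> M \<cdot> M'" by (simp add: MM')
    also have "\<dots> = ((Ident C ?u \<otimes>\<^sub>a f) \<cdot> M) \<cdot> M'" by simp
    also have "\<dots> = zero_arrow C (?u \<otimes>\<^sub>o (V \<otimes>\<^sub>o A)) (?u \<otimes>\<^sub>o B)"
      using comp_zero_left[of M' "?u \<otimes>\<^sub>o (V \<otimes>\<^sub>o A)" "V \<otimes>\<^sub>o (?u \<otimes>\<^sub>o A)" "?u \<otimes>\<^sub>o B"] by (simp add: fM Hom_iff)
    finally have "f \<cdot> lunitor C (V \<otimes>\<^sub>o A) = zero_arrow C (?u \<otimes>\<^sub>o (V \<otimes>\<^sub>o A)) B"
      using lunitor_natural[OF f] comp_zero_right[OF lunitor_hom[OF B], of "?u \<otimes>\<^sub>o (V \<otimes>\<^sub>o A)"] by simp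
    moreover note l' = inv_arrow[OF lunitor_iso lunitor_hom, of "V \<otimes>\<^sub>o A"]
    have "f = (f \<cdot> lunitor C (V \<otimes>\<^sub>o A)) \<cdot> inv_arrow C (lunitor C (V \<otimes>\<^sub>o A))"
      using l' by (simp add: Hom_iff)
    ultimately show ?thesis using comp_zero_left[OF l'(1) B] by simp
  qed
  have "hom_dim (V \<otimes>\<^sub>o A) B \<le> hom_dim (?u \<otimes>\<^sub>o A) (X \<otimes>\<^sub>o B)"
    by (rule hom_dim_mono[OF lin]) (use ker in auto)
  moreover have "isomorphic C (?u \<otimes>\<^sub>o A) A"
    using lunitor_iso[OF A] lunitor_hom[OF A] unfolding isomorphic_def by blast
  ultimately show ?thesis using hom_dim_isomorphic(2)[of "?u \<otimes>\<^sub>o A" A "X \<otimes>\<^sub>o B"] by simp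
qed

text \<open>If the dual is zero then so is the coevaluation, through which the zigzag identity factors the
  isomorphism \<open>1 \<otimes> X \<rightarrow> X\<close>.\<close>

lemma left_dual_zero:
  assumes dual: "left_dual C V X" and V0: "Ident C V = zero_arrow C V V"
  shows "Ident C X = zero_arrow C X X"
proof -
  let ?u = "unit_obj C"
  have V [simp]: "V \<in> Obj C" and X [simp]: "X \<in> Obj C" using dual by (auto simp: left_dual_def)
  obtain ev coev where ev: "ev \<in> Hom C (V \<otimes>\<^sub>o X) ?u" and coev: "coev \<in> Hom C ?u (X \<otimes>\<^sub>o V)"
    and zz: "runitor C X \<cdot> (Ident C X \<otimes>\<^sub>a ev) \<cdot> associator C X V X \<cdot> (coev \<otimes>\<^sub>a Ident C X) = lunitor C X"
    using dual unfolding left_dual_def by blast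
  note arr [simp] = ev[unfolded Hom_iff] coev[unfolded Hom_iff]
  have "Ident C (X \<otimes>\<^sub>o V) = zero_arrow C (X \<otimes>\<^sub>o V) (X \<otimes>\<^sub>o V)"
    using tensor_ident[OF X V] V0 tensor_zero(2)[OF ident_hom[OF X] V V] by simp
  then have "coev = zero_arrow C ?u (X \<otimes>\<^sub>o V)"
    using ident_comp[OF coev] comp_zero_left[OF coev, of "X \<otimes>\<^sub>o V"] by simp
  then have c0: "coev \<otimes>\<^sub>a Ident C X = zero_arrow C (?u \<otimes>\<^sub>o X) ((X \<otimes>\<^sub>o V) \<otimes>\<^sub>o X)"
    using tensor_zero(1)[OF ident_hom[OF X], of ?u "X \<otimes>\<^sub>o V"] by simp
  define h where "h = runitor C X \<cdot> (Ident C X \<otimes>\<^sub>a ev) \<cdot> associator C X V X"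
  have h: "h \<in> Hom C ((X \<otimes>\<^sub>o V) \<otimes>\<^sub>o X) X" by (simp add: h_def Hom_iff)
  have "lunitor C X = h \<cdot> (coev \<otimes>\<^sub>a Ident C X)" using zz by (simp add: h_def)
  then have l0: "lunitor C X = zero_arrow C (?u \<otimes>\<^sub>o X) X"
    using comp_zero_right[OF h, of "?u \<otimes>\<^sub>o X"] by (simp add: c0)
  note l = inv_arrow[OF lunitor_iso[OF X] lunitor_hom[OF X]]
  have "Ident C X = lunitor C X \<cdot> inv_arrow C (lunitor C X)" using l(3) by simp
  also have "\<dots> = zero_arrow C (?u \<otimes>\<^sub>o X) X \<cdot> inv_arrow C (lunitor C X)" by (subst l0) (rule refl)
  also have "\<dots> = zero_arrow C X X" by (rule comp_zero_left[OF l(1) X])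
  finally show ?thesis .
qed

end

context alg_closed_fusion_category
begin

lemma unit_nonzero: "Ident C (unit_obj C) \<noteq> zero_arrow C (unit_obj C) (unit_obj C)"
proof
  let ?u = "unit_obj C"
  assume "Ident C ?u = zero_arrow C ?u ?u"
  then have "0 \<odot>\<^bsub>hom_space C ?u ?u\<^esub> Ident C ?u = 1 \<odot>\<^bsub>hom_space C ?u ?u\<^esub> Ident C ?u"
    using smult_zero_iff[OF ident_hom[OF unit_obj]] by simp
  moreover have "inj (\<lambda>c. c \<odot>\<^bsub>hom_space C ?u ?u\<^esub> Ident C ?u)"
    using end_unit by (simp add: bij_betw_def)
  ultimately have "(0 :: 'k) = 1" by (rule injD[rotated])
  then show False by simp
qed

lemma ex_simple_summand:
  assumes Y: "Y \<in> Obj C" and nz: "Ident C Y \<noteq> zero_arrow C Y Y"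
  obtains S i r where "simple_object C S" "i \<in> Hom C S Y" "r \<in> Hom C Y S" "r \<cdot> i = Ident C S"
proof -
  obtain Ss where Ss: "\<forall>T \<in> set Ss. simple_object C T" "is_direct_sum C Y Ss"
    using semisimple[OF Y] by blast
  then obtain inc proj where d: "decomposes Y {..<length Ss} ((!) Ss) inc proj"
    using is_direct_sum_decomposes by blast
  have "0 < length Ss"
  proof (rule ccontr)
    assume "\<not> 0 < length Ss"
    then show False using d ident_hom[OF Y] nz unfolding decomposes_def by auto
  qed
  then show thesis using d Ss(1) by (intro that[of "Ss ! 0" "inc 0" "proj 0"]) (auto simp: decomposes_def)
qed

text \<open>For a simple summand of the unit with inclusion \<open>i\<close> and retraction \<open>r\<close>, the endomorphism \<open>i \<cdot> r\<close> of the
  unit is a nonzero idempotent scalar, that is, the identity.\<close>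

lemma unit_isomorphic_simple: "\<exists>S. simple_object C S \<and> isomorphic C (unit_obj C) S"
proof -
  let ?u = "unit_obj C"
  obtain S i r where S: "simple_object C S" and i: "i \<in> Hom C S ?u" and r: "r \<in> Hom C ?u S"
    and ri: "r \<cdot> i = Ident C S"
    using ex_simple_summand[OF unit_obj unit_nonzero] .
  interpret vectorspace class_ring "hom_space C ?u ?u" by (rule hom_vectorspace[OF unit_obj unit_obj])
  note I = ident_hom[OF unit_obj]
  have Ic: "Ident C ?u \<in> carrier (hom_space C ?u ?u)" using I hom_carrier[OF unit_obj unit_obj] by simp
  have ir: "i \<cdot> r \<in> Hom C ?u ?u" using comp_hom[OF r i] .
  then obtain c where c: "i \<cdot> r = c \<odot>\<^bsub>hom_space C ?u ?u\<^esub> Ident C ?u"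
    using end_unit unfolding bij_betw_def by blast
  have "(i \<cdot> r) \<cdot> i \<cdot> r = i \<cdot> (r \<cdot> i) \<cdot> r" using i r by (simp add: Hom_iff)
  also have "\<dots> = i \<cdot> r" using i r by (simp add: ri Hom_iff)
  finally have "(c \<odot>\<^bsub>hom_space C ?u ?u\<^esub> Ident C ?u) \<cdot> (i \<cdot> r) = i \<cdot> r" by (simp only: c)
  then have "c \<odot>\<^bsub>hom_space C ?u ?u\<^esub> (i \<cdot> r) = i \<cdot> r"
    using comp_smult_left[OF ir I] ident_comp[OF ir] by simp
  then have "(c * c) \<odot>\<^bsub>hom_space C ?u ?u\<^esub> Ident C ?u = c \<odot>\<^bsub>hom_space C ?u ?u\<^esub> Ident C ?u"
    using smult_assoc1[of c c "Ident C ?u"] Ic by (simp add: c class_ring_simps)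
  then have "c * c = c" by (rule smult_ident_inj[OF unit_obj unit_nonzero])
  moreover have "c \<noteq> 0"
  proof
    assume "c = 0"
    then have "i \<cdot> r = zero_arrow C ?u ?u" using c smult_zero_iff[OF I] by simp
    then have "(i \<cdot> r) \<cdot> i = zero_arrow C S ?u" using comp_zero_left[OF i unit_obj] by simp
    moreover have "(i \<cdot> r) \<cdot> i = i" using i r ri by (simp add: Hom_iff)
    ultimately have "Ident C S = r \<cdot> zero_arrow C S ?u" using ri by simp
    then show False using comp_zero_right[OF r simple_obj[OF S]] simple_ident_nonzero[OF S] by simp
  qed
  ultimately have "c = 1" by simp
  then have "i \<cdot> r = Ident C ?u" using c smult_one[OF Ic] by (simp add: class_ring_simps)
  then have "isomorphic C ?u S" using isomorphicI[OF r i _ ri] by simp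
  with S show ?thesis by blast
qed

lemma hom_dim_simple:
  assumes S: "simple_object C S" and T: "simple_object C T"
  shows "hom_dim S T = (if isomorphic C S T then 1 else 0)"
proof -
  note T' = simple_obj[OF T]
  have "decomposes T {()} (\<lambda>_. T) (\<lambda>_. Ident C T) (\<lambda>_. Ident C T)"
    unfolding decomposes_def using T' ident_hom[OF T'] comp_ident ident_comp by auto
  from hom_dim_decomposes(1)[OF S this] T show ?thesis by auto
qed

lemma hom_dim_sum:
  assumes S: "simple_object C S" and Y: "decomposes Y I X inc proj"
  shows "hom_dim S Y = (\<Sum>i\<in>I. hom_dim S (X i))"
proof -
  have I: "finite I" using Y by (simp add: decomposes_def)
  have "\<forall>i\<in>I. \<exists>Ss. (\<forall>T\<in>set Ss. simple_object C T) \<and> is_direct_sum C (X i) Ss"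
    using Y semisimple Hom_obj unfolding decomposes_def by blast
  then obtain Ss where Ss: "\<And>i T. \<lbrakk>i \<in> I; T \<in> set (Ss i)\<rbrakk> \<Longrightarrow> simple_object C T"
    "\<And>i. i \<in> I \<Longrightarrow> is_direct_sum C (X i) (Ss i)"
    by metis
  define J where "J i = {..<length (Ss i)}" for i
  have "\<forall>i\<in>I. \<exists>inc' proj'. decomposes (X i) (J i) ((!) (Ss i)) inc' proj'"
    unfolding J_def using is_direct_sum_decomposes[OF Ss(2)] by blast
  then obtain inc' proj' where d: "\<And>i. i \<in> I \<Longrightarrow> decomposes (X i) (J i) ((!) (Ss i)) (inc' i) (proj' i)"
    by metis
  have "hom_dim S Y = card {ij \<in> Sigma I J. isomorphic C S (case ij of (i, j) \<Rightarrow> Ss i ! j)}"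
    using Ss(1) by (intro hom_dim_decomposes(1)[OF S decomposes_Sigma[OF Y d]]) (auto simp: J_def)
  also have "{ij \<in> Sigma I J. isomorphic C S (case ij of (i, j) \<Rightarrow> Ss i ! j)}
    = Sigma I (\<lambda>i. {j \<in> J i. isomorphic C S (Ss i ! j)})" by auto
  also have "card \<dots> = (\<Sum>i\<in>I. card {j \<in> J i. isomorphic C S (Ss i ! j)})"
    using I by (intro card_SigmaI) (auto simp: J_def)
  also have "\<dots> = (\<Sum>i\<in>I. hom_dim S (X i))"
    using Ss(1) by (intro sum.cong refl hom_dim_decomposes(1)[OF S d, symmetric]) (auto simp: J_def)
  finally show ?thesis .
qed

context
  fixes Xs :: "'o list"
  assumes reps: "simple_representatives C Xs"
begin

lemma rep_simple: "x \<in> set Xs \<Longrightarrow> simple_object C x"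
  using reps by (simp add: simple_representatives_def)

lemma rep_obj: "x \<in> set Xs \<Longrightarrow> x \<in> Obj C"
  using rep_simple simple_obj by blast

lemma rep_isomorphic_iff:
  assumes "x \<in> set Xs" "y \<in> set Xs"
  shows "isomorphic C x y \<longleftrightarrow> x = y"
  using assms reps isomorphic_refl[OF rep_obj[OF assms(1)]]
  unfolding simple_representatives_def by (metis in_set_conv_nth)

lemma distinct_reps: "distinct Xs"
  unfolding distinct_conv_nth
  using reps isomorphic_refl[OF rep_obj] unfolding simple_representatives_def by (metis nth_mem)

text \<open>A sum over the simple summands of \<open>Y\<close> is grouped by isomorphism class.\<close>

lemma sum_over_reps:
  fixes g :: "'o \<Rightarrow> nat"
  assumes Ss: "\<forall>T \<in> set Ss. simple_object C T" "is_direct_sum C Y Ss"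
    and g: "\<And>S T. \<lbrakk>simple_object C S; isomorphic C S T\<rbrakk> \<Longrightarrow> g S = g T"
  shows "(\<Sum>i<length Ss. g (Ss ! i)) = (\<Sum>x\<in>set Xs. hom_dim x Y * g x)"
proof -
  obtain inc proj where d: "decomposes Y {..<length Ss} ((!) Ss) inc proj"
    using is_direct_sum_decomposes[OF Ss(2)] by blast
  have "hom_dim x Y * g x = (\<Sum>i<length Ss. if isomorphic C x (Ss ! i) then g x else 0)"
    if "x \<in> set Xs" for x
    using hom_dim_decomposes(1)[OF rep_simple[OF that] d] Ss(1)
    by (simp add: sum.If_cases Int_def)
  then have "(\<Sum>x\<in>set Xs. hom_dim x Y * g x)
    = (\<Sum>x\<in>set Xs. \<Sum>i<length Ss. if isomorphic C x (Ss ! i) then g x else 0)" by simp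
  also have "\<dots> = (\<Sum>i<length Ss. \<Sum>x\<in>set Xs. if isomorphic C x (Ss ! i) then g x else 0)"
    by (rule sum.swap)
  also have "\<dots> = (\<Sum>i<length Ss. g (Ss ! i))"
  proof (rule sum.cong[OF refl])
    fix i assume "i \<in> {..<length Ss}"
    then have S: "simple_object C (Ss ! i)" using Ss(1) by simp
    then obtain x0 where x0: "x0 \<in> set Xs" "isomorphic C (Ss ! i) x0"
      using reps unfolding simple_representatives_def by blast
    have "isomorphic C x (Ss ! i) \<longleftrightarrow> x = x0" if "x \<in> set Xs" for x
      using rep_isomorphic_iff[OF that x0(1)] isomorphic_trans[OF _ x0(2)] isomorphic_sym[OF x0(2)] by blast
    then have "(\<Sum>x\<in>set Xs. if isomorphic C x (Ss ! i) then g x else 0) = (\<Sum>x\<in>set Xs. if x = x0 then g x else 0)"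
      by (intro sum.cong) auto
    also have "\<dots> = g (Ss ! i)" using x0 g[OF S x0(2)] by simp
    finally show "(\<Sum>x\<in>set Xs. if isomorphic C x (Ss ! i) then g x else 0) = g (Ss ! i)" .
  qed
  finally show ?thesis by simp
qed

lemma hom_dim_tensor:
  assumes S: "simple_object C S" and Y: "Y \<in> Obj C" and Z: "Z \<in> Obj C"
  shows "hom_dim S (Y \<otimes>\<^sub>o Z) = (\<Sum>x\<in>set Xs. hom_dim x Y * hom_dim S (x \<otimes>\<^sub>o Z))"
    and "hom_dim S (Z \<otimes>\<^sub>o Y) = (\<Sum>x\<in>set Xs. hom_dim x Y * hom_dim S (Z \<otimes>\<^sub>o x))"
proof -
  obtain Ss where Ss: "\<forall>T \<in> set Ss. simple_object C T" "is_direct_sum C Y Ss"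
    using semisimple[OF Y] by blast
  obtain i1 p1 where d1: "decomposes (Y \<otimes>\<^sub>o Z) {..<length Ss} (\<lambda>i. Ss ! i \<otimes>\<^sub>o Z) i1 p1"
    using tensor_decomposes(1)[OF Ss(2) Z] by blast
  obtain i2 p2 where d2: "decomposes (Z \<otimes>\<^sub>o Y) {..<length Ss} (\<lambda>i. Z \<otimes>\<^sub>o Ss ! i) i2 p2"
    using tensor_decomposes(2)[OF Ss(2) Z] by blast
  note inv = hom_dim_isomorphic(1)[OF isomorphic_tensor(1)[OF _ Z] simple_obj[OF S]]
    hom_dim_isomorphic(1)[OF isomorphic_tensor(2)[OF _ Z] simple_obj[OF S]]
  show "hom_dim S (Y \<otimes>\<^sub>o Z) = (\<Sum>x\<in>set Xs. hom_dim x Y * hom_dim S (x \<otimes>\<^sub>o Z))"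
    using sum_over_reps[OF Ss, of "\<lambda>x. hom_dim S (x \<otimes>\<^sub>o Z)"] inv(1) hom_dim_sum[OF S d1] by simp
  show "hom_dim S (Z \<otimes>\<^sub>o Y) = (\<Sum>x\<in>set Xs. hom_dim x Y * hom_dim S (Z \<otimes>\<^sub>o x))"
    using sum_over_reps[OF Ss, of "\<lambda>x. hom_dim S (Z \<otimes>\<^sub>o x)"] inv(2) hom_dim_sum[OF S d2] by simp
qed

lemma fusion_coeff_eq_hom_dim:
  assumes "a \<in> set Xs" "b \<in> set Xs" "c \<in> set Xs"
  shows "fusion_coeff C a b c = hom_dim c (a \<otimes>\<^sub>o b)" "fusion_coeff C a b c = hom_dim (a \<otimes>\<^sub>o b) c"
  using multiplicity_eq_hom_dim[OF rep_simple[OF assms(3)] tensor_obj[OF rep_obj[OF assms(1)] rep_obj[OF assms(2)]]]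
  by (simp_all add: fusion_coeff_def)

end

end

section \<open>The fusion rule of the simple objects and its dimension\<close>

context alg_closed_fusion_category
begin

text \<open>The two decompositions of \<open>a \<otimes> b \<otimes> c\<close> give associativity, and the unitors give the unit laws. The dual
  of \<open>x\<close> in the list is the representative \<open>z\<close> of some simple summand \<open>S\<close> of a left dual \<open>V\<close> of \<open>x\<close>: then
  \<open>S \<otimes> a\<close> is a retract of \<open>V \<otimes> a\<close>, and transposition bounds \<open>Hom(V \<otimes> a, b)\<close> by \<open>Hom(a, x \<otimes> b)\<close>.\<close>

lemma fusion_rule_simple_objects:
  assumes reps: "simple_representatives C Xs"
  shows "\<exists>e s. fusion_rule (set Xs) (fusion_coeff C) e s"
proof -
  note simple = rep_simple[OF reps] and obj = rep_obj[OF reps]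
  note N = fusion_coeff_eq_hom_dim[OF reps]
  let ?u = "unit_obj C"
  obtain S where "simple_object C S" "isomorphic C ?u S" using unit_isomorphic_simple by blast
  then obtain e where e: "e \<in> set Xs" and eu: "isomorphic C e ?u"
    using reps isomorphic_trans isomorphic_sym unfolding simple_representatives_def by metis
  have delta: "hom_dim b a = (if a = b then 1 else 0)" if "a \<in> set Xs" "b \<in> set Xs" for a b
    using hom_dim_simple[OF simple simple, OF that(2,1)] rep_isomorphic_iff[OF reps that(2,1)] by auto
  have unit: "isomorphic C (e \<otimes>\<^sub>o a) a" "isomorphic C (a \<otimes>\<^sub>o e) a" if a: "a \<in> set Xs" for a
  proof -
    note aO = obj[OF a]
    have "isomorphic C (?u \<otimes>\<^sub>o a) a" "isomorphic C (a \<otimes>\<^sub>o ?u) a"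
      using lunitor_iso[OF aO] lunitor_hom[OF aO] runitor_iso[OF aO] runitor_hom[OF aO]
      unfolding isomorphic_def by blast+
    with isomorphic_tensor[OF eu aO] show "isomorphic C (e \<otimes>\<^sub>o a) a" "isomorphic C (a \<otimes>\<^sub>o e) a"
      using isomorphic_trans by blast+
  qed
  have "\<exists>z\<in>set Xs. \<forall>a\<in>set Xs. \<forall>b\<in>set Xs. fusion_coeff C z a b \<le> fusion_coeff C x b a"
    if x: "x \<in> set Xs" for x
  proof -
    obtain V where V: "left_dual C V x" using ex_left_dual[OF obj[OF x]] by blast
    then have VO: "V \<in> Obj C" by (simp add: left_dual_def)
    have "Ident C V \<noteq> zero_arrow C V V"
      using left_dual_zero[OF V] simple_ident_nonzero[OF simple[OF x]] by blast
    then obtain S i r where S: "simple_object C S" and ir: "i \<in> Hom C S V" "r \<in> Hom C V S" "r \<cdot> i = Ident C S"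
      using ex_simple_summand[OF VO] by blast
    obtain z where z: "z \<in> set Xs" "isomorphic C S z"
      using reps S unfolding simple_representatives_def by blast
    have "fusion_coeff C z a b \<le> fusion_coeff C x b a" if a: "a \<in> set Xs" and b: "b \<in> set Xs" for a b
    proof -
      note aO = obj[OF a] and bO = obj[OF b]
      have ri: "(r \<otimes>\<^sub>a Ident C a) \<cdot> (i \<otimes>\<^sub>a Ident C a) = Ident C (S \<otimes>\<^sub>o a)"
        using ir aO simple_obj[OF S] by (simp add: Hom_iff tensor_comp_arr tensor_ident)
      have "fusion_coeff C z a b = hom_dim (z \<otimes>\<^sub>o a) b" by (rule N(2)[OF z(1) a b])
      also have "\<dots> = hom_dim (S \<otimes>\<^sub>o a) b"
        using hom_dim_isomorphic(2)[OF isomorphic_tensor(1)[OF z(2) aO] bO] by simp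
      also have "\<dots> \<le> hom_dim (V \<otimes>\<^sub>o a) b"
        by (rule hom_dim_retract(2)[OF tensor_arr[OF ir(1) ident_hom[OF aO]]
              tensor_arr[OF ir(2) ident_hom[OF aO]] ri bO])
      also have "\<dots> \<le> hom_dim a (x \<otimes>\<^sub>o b)" by (rule hom_dim_left_dual[OF V aO bO])
      also have "\<dots> = fusion_coeff C x b a" by (rule N(1)[OF x b a, symmetric])
      finally show ?thesis .
    qed
    with z(1) show ?thesis by blast
  qed
  then obtain s where s: "\<And>x. x \<in> set Xs \<Longrightarrow> s x \<in> set Xs"
    "\<And>x a b. \<lbrakk>x \<in> set Xs; a \<in> set Xs; b \<in> set Xs\<rbrakk> \<Longrightarrow> fusion_coeff C (s x) a b \<le> fusion_coeff C x b a"
    by metis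
  have "fusion_rule (set Xs) (fusion_coeff C) e s"
  proof
    fix a b c d assume m: "a \<in> set Xs" "b \<in> set Xs" "c \<in> set Xs" "d \<in> set Xs"
    note O = obj[OF m(1)] obj[OF m(2)] obj[OF m(3)] obj[OF m(4)]
    have "isomorphic C ((a \<otimes>\<^sub>o b) \<otimes>\<^sub>o c) (a \<otimes>\<^sub>o (b \<otimes>\<^sub>o c))"
      using associator_iso[OF O(1-3)] associator_hom[OF O(1-3)] unfolding isomorphic_def by blast
    then have "hom_dim d ((a \<otimes>\<^sub>o b) \<otimes>\<^sub>o c) = hom_dim d (a \<otimes>\<^sub>o (b \<otimes>\<^sub>o c))"
      using O(4) by (rule hom_dim_isomorphic(1))
    then show "(\<Sum>x\<in>set Xs. fusion_coeff C a b x * fusion_coeff C x c d)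
        = (\<Sum>y\<in>set Xs. fusion_coeff C a y d * fusion_coeff C b c y)"
      using hom_dim_tensor(1)[OF reps simple[OF m(4)] tensor_obj[OF O(1,2)] O(3)]
        hom_dim_tensor(2)[OF reps simple[OF m(4)] tensor_obj[OF O(2,3)] O(1)] m
      by (simp add: N(1) mult.commute)
  next
    fix a b assume m: "a \<in> set Xs" "b \<in> set Xs"
    note O = obj[OF m(1)] obj[OF m(2)]
    show "fusion_coeff C e a b = (if a = b then 1 else 0)" "fusion_coeff C a e b = (if a = b then 1 else 0)"
      using m e delta hom_dim_isomorphic(1)[OF unit(1)[OF m(1)] O(2)]
        hom_dim_isomorphic(1)[OF unit(2)[OF m(1)] O(2)]
      by (simp_all add: N(1))
  qed (use e s in auto)
  then show ?thesis by blast
qed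

lemma groth_class_rep:
  assumes reps: "simple_representatives C Xs" and i: "i < length Xs"
  shows "groth_class C Xs (Xs ! i) = unit_vec (length Xs) i"
proof (rule eq_vecI)
  fix k assume "k < dim_vec (unit_vec (length Xs) i)"
  then have k: "k < length Xs" by simp
  have "multiplicity C (Xs ! k) (Xs ! i) = (if k = i then 1 else 0)"
    using k i multiplicity_eq_hom_dim(1)[OF rep_simple[OF reps] rep_obj[OF reps], of "Xs ! k" "Xs ! i"]
      hom_dim_simple[OF rep_simple[OF reps] rep_simple[OF reps], of "Xs ! k" "Xs ! i"]
      rep_isomorphic_iff[OF reps, of "Xs ! k" "Xs ! i"] nth_eq_iff_index_eq[OF distinct_reps[OF reps] k i]
    by simp
  then show "groth_class C Xs (Xs ! i) $ k = unit_vec (length Xs) i $ k"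
    using k i by (simp add: groth_class_def)
qed (simp add: groth_class_def)

lemma left_mult_matrix_rep:
  assumes reps: "simple_representatives C Xs" and i: "i < length Xs" and k: "k < length Xs" and j: "j < length Xs"
  shows "left_mult_matrix C Xs (Xs ! i) $$ (k, j) = real (fusion_coeff C (Xs ! i) (Xs ! j) (Xs ! k))"
proof -
  let ?n = "length Xs"
  let ?N = "\<lambda>a b. int (fusion_coeff C (Xs ! a) (Xs ! b) (Xs ! k))"
  have "(\<Sum>a<?n. \<Sum>b<?n. unit_vec ?n i $ a * unit_vec ?n j $ b * ?N a b)
    = (\<Sum>a<?n. \<Sum>b<?n. if b = j then if a = i then ?N a b else 0 else 0)"
    using i j by (intro sum.cong refl) auto
  also have "\<dots> = ?N i j" using i j by simp
  finally have "(groth_class C Xs (Xs ! i) \<otimes>\<^bsub>groth_ring C Xs\<^esub> groth_class C Xs (Xs ! j)) $ k = ?N i j"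
    using k by (simp add: groth_class_rep[OF reps i] groth_class_rep[OF reps j] groth_ring_def Let_def)
  then show ?thesis using j k by (simp add: left_mult_matrix_def)
qed

text \<open>The values of \<open>d\<close> form a positive eigenvector of the nonnegative matrix of left multiplication by \<open>x\<close>,
  with eigenvalue \<open>d x\<close>.\<close>

lemma FPdim_eq_character:
  assumes reps: "simple_representatives C Xs"
    and pos: "\<And>a. a \<in> set Xs \<Longrightarrow> 0 < d a"
    and eig: "\<And>a c. \<lbrakk>a \<in> set Xs; c \<in> set Xs\<rbrakk> \<Longrightarrow>
      (\<Sum>b\<in>set Xs. real (fusion_coeff C a b c) * d b) = d a * d c"
    and x: "x \<in> set Xs"
  shows "FPdim C Xs x = d x"
proof -
  obtain i where i: "i < length Xs" "x = Xs ! i" using x by (metis in_set_conv_nth)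
  show ?thesis
    unfolding FPdim_def
  proof (rule Max_eigenvalue_nonneg_matrix[where w = "\<lambda>j. d (Xs ! j)"])
    show "left_mult_matrix C Xs x \<in> carrier_mat (length Xs) (length Xs)"
      by (simp add: left_mult_matrix_def)
    fix k assume k: "k < length Xs"
    have "(\<Sum>j<length Xs. left_mult_matrix C Xs x $$ (k, j) * d (Xs ! j))
      = (\<Sum>j<length Xs. real (fusion_coeff C x (Xs ! j) (Xs ! k)) * d (Xs ! j))"
      using i k by (intro sum.cong) (auto simp: left_mult_matrix_rep[OF reps])
    also have "\<dots> = (\<Sum>b\<in>set Xs. real (fusion_coeff C x b (Xs ! k)) * d b)"
      by (rule sum.reindex_bij_betw[OF bij_betw_nth[OF distinct_reps[OF reps] refl refl]])
    also have "\<dots> = d x * d (Xs ! k)" using eig x k by simp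
    finally show "(\<Sum>j<length Xs. left_mult_matrix C Xs x $$ (k, j) * d (Xs ! j)) = d x * d (Xs ! k)" .
  qed (use i x pos in \<open>auto simp: left_mult_matrix_rep[OF reps]\<close>)
qed

end

theorem theorem3p1:
  fixes C :: "('o, 'm, 'k :: {alg_closed_field, field_char_0}) mon_cat"
    and Xs :: "'o list"
  assumes "fusion_category C"
    and "simple_representatives C Xs"
  shows "probability_group (set Xs)
    (\<lambda>X Y Z. real (fusion_coeff C X Y Z) * FPdim C Xs Z / (FPdim C Xs X * FPdim C Xs Y))"
proof -
  interpret alg_closed_fusion_category C
    using assms(1) by (rule alg_closed_fusion_category.intro)
  obtain e s where "fusion_rule (set Xs) (fusion_coeff C) e s"
    using fusion_rule_simple_objects[OF assms(2)] by blast
  then interpret R: fusion_rule "set Xs" "fusion_coeff C" e s .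
  obtain d where d: "\<And>a. a \<in> set Xs \<Longrightarrow> 0 < d a"
    "\<And>a b. \<lbrakk>a \<in> set Xs; b \<in> set Xs\<rbrakk> \<Longrightarrow> (\<Sum>c\<in>set Xs. real (fusion_coeff C a b c) * d c) = d a * d b"
    "\<And>a. a \<in> set Xs \<Longrightarrow> d (s a) = d a"
    "\<And>a c. \<lbrakk>a \<in> set Xs; c \<in> set Xs\<rbrakk> \<Longrightarrow> (\<Sum>b\<in>set Xs. real (fusion_coeff C a b c) * d b) = d a * d c"
    using R.ex_positive_character by blast
  have FP: "FPdim C Xs a = d a" if "a \<in> set Xs" for a
    using FPdim_eq_character[OF assms(2), of d] d(1,4) that by blast
  have "probability_structure (set Xs)
    (\<lambda>a b c. real (fusion_coeff C a b c) * FPdim C Xs c / (FPdim C Xs a * FPdim C Xs b)) e s"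
    by (rule R.probability_structure_of_character) (use d R.dual_mem in \<open>simp_all add: FP\<close>)
  then show ?thesis unfolding probability_group_def by blast
qed

end
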